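(* There exists a smooth, strictly positive, Gaussian-decaying probability density $f$ on $\mathbb R^2$ such that \[ \mathcal I[f]\,\mathcal D[f]-\mathcal Q[f]^2<0. \] Moreover, if $f_t=P_tf$ and $\Phi_f(t):=I(t)I''(t)-I'(t)^2$, where $I(t)$ is the Fisher information of $f_t$, then $\Phi_f(0)<0$, and consequently $I(t)I''(t)-I'(t)^2<0$ for all sufficiently small $t>0$. In particular, Fisher information along the heat flow is not log-convex in dimension two.
   Context: The heat semigroup on $\mathbb R^d$ is $P_t=e^{t\Delta/2}$, so $f_t=P_tf$ solves $\partial_tf_t=\tfrac12\Delta f_t$ (equivalently $f_t$ is the density of $X+\sqrt t Z$ with $X\sim f$ and $Z$ an independent standard Gaussian). The Fisher information is $I(t)=\int_{\mathbb R^d}|\nabla f_t|^2/f_t\,dx$. For a smooth positive probability density $f=e^u$ on $\mathbb R^d$ with sufficient decay, set $\mathsf H_f=-\nabla^2u$ (the negative Hessian of $\log f$) and \[ \mathcal I[f]=\int\operatorname{tr}(\mathsf H_f)f\,dx,\quad \mathcal Q[f]=\int\operatorname{tr}(\mathsf H_f^2)f\,dx,\quad \mathcal D[f]=\int\big(|\nabla\mathsf H_f|^2+2\operatorname{tr}(\mathsf H_f^3)\big)f\,dx, \] where $|\nabla\mathsf H_f|^2=\sum_{i,j,k}(\partial_k(\mathsf H_f)_{ij})^2$. *)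

theory Defs
  imports "HOL-Analysis.Analysis"
begin

definition pd :: "2 \<Rightarrow> (real^2 \<Rightarrow> real) \<Rightarrow> real^2 \<Rightarrow> real" where
  "pd i g x = deriv (\<lambda>s. g (x + s *\<^sub>R axis i 1)) 0"

fun iter_pd :: "2 list \<Rightarrow> (real^2 \<Rightarrow> real) \<Rightarrow> real^2 \<Rightarrow> real" where
  "iter_pd [] g = g"
| "iter_pd (i # is) g = pd i (iter_pd is g)"

definition smooth_fun :: "(real^2 \<Rightarrow> real) \<Rightarrow> bool" where
  "smooth_fun g \<longleftrightarrow> (\<forall>is x. iter_pd is g differentiable (at x))"

definition gaussian_decay :: "(real^2 \<Rightarrow> real) \<Rightarrow> bool" where
  "gaussian_decay g \<longleftrightarrow> (\<exists>C c. c > 0 \<and> (\<forall>x. \<bar>g x\<bar> \<le> C * exp (- c * (norm x)\<^sup>2)))"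

definition prob_density :: "(real^2 \<Rightarrow> real) \<Rightarrow> bool" where
  "prob_density g \<longleftrightarrow> (\<forall>x. g x > 0) \<and> integrable lborel g \<and> (\<integral>x. g x \<partial>lborel) = 1"

definition negHess :: "(real^2 \<Rightarrow> real) \<Rightarrow> 2 \<Rightarrow> 2 \<Rightarrow> real^2 \<Rightarrow> real" where
  "negHess f i j x = - pd i (pd j (\<lambda>y. ln (f y))) x"

definition trH :: "(real^2 \<Rightarrow> real) \<Rightarrow> real^2 \<Rightarrow> real" where
  "trH f x = (\<Sum>i\<in>UNIV. negHess f i i x)"

definition trH2 :: "(real^2 \<Rightarrow> real) \<Rightarrow> real^2 \<Rightarrow> real" where
  "trH2 f x = (\<Sum>i\<in>UNIV. \<Sum>j\<in>UNIV. negHess f i j x * negHess f j i x)"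

definition trH3 :: "(real^2 \<Rightarrow> real) \<Rightarrow> real^2 \<Rightarrow> real" where
  "trH3 f x = (\<Sum>i\<in>UNIV. \<Sum>j\<in>UNIV. \<Sum>k\<in>UNIV.
                 negHess f i j x * negHess f j k x * negHess f k i x)"

definition gradH_sq :: "(real^2 \<Rightarrow> real) \<Rightarrow> real^2 \<Rightarrow> real" where
  "gradH_sq f x = (\<Sum>i\<in>UNIV. \<Sum>j\<in>UNIV. \<Sum>k\<in>UNIV. (pd k (negHess f i j) x)\<^sup>2)"

definition calI :: "(real^2 \<Rightarrow> real) \<Rightarrow> real" where
  "calI f = (\<integral>x. trH f x * f x \<partial>lborel)"

definition calQ :: "(real^2 \<Rightarrow> real) \<Rightarrow> real" where
  "calQ f = (\<integral>x. trH2 f x * f x \<partial>lborel)"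

definition calD :: "(real^2 \<Rightarrow> real) \<Rightarrow> real" where
  "calD f = (\<integral>x. (gradH_sq f x + 2 * trH3 f x) * f x \<partial>lborel)"

text \<open>Heat semigroup P_t = exp(t Laplacian / 2) on R^2 (Gaussian kernel of variance t);
  P_0 f = f.  Values for t < 0 are irrelevant.\<close>
definition heat :: "real \<Rightarrow> (real^2 \<Rightarrow> real) \<Rightarrow> real^2 \<Rightarrow> real" where
  "heat t f x = (if t = 0 then f x
     else (\<integral>y. f y * exp (- (norm (x - y))\<^sup>2 / (2 * t)) / (2 * pi * t) \<partial>lborel))"

definition fisher_integrand :: "(real^2 \<Rightarrow> real) \<Rightarrow> real^2 \<Rightarrow> real" where
  "fisher_integrand g x = (\<Sum>i\<in>UNIV. (pd i g x)\<^sup>2) / g x"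

definition fisher_flow :: "(real^2 \<Rightarrow> real) \<Rightarrow> real \<Rightarrow> real" where
  "fisher_flow f t = (\<integral>x. fisher_integrand (heat t f) x \<partial>lborel)"

end

theory Submission
  imports Defs "HOL-Probability.Probability"
begin

text \<open>
  Let \<open>V\<close> be the sum of the three plane waves \<open>cos (k \<bullet> x)\<close> with unit wave vectors
  satisfying \<open>k\<^sub>1 + k\<^sub>2 + k\<^sub>3 = 0\<close>. On the flat torus \<open>V\<close> is an eigenfunction of the Laplacian,
  so the heat flow of \<open>1 + e V\<close> only shrinks the amplitude \<open>e\<close>, by the factor \<open>exp (- t / 2)\<close>, and
  the Fisher information is the mean of \<open>e\<^sup>2 |\<nabla>V|\<^sup>2 / (1 + e V)\<close>, that is
  \<open>3/2 e\<^sup>2 - 3/4 e\<^sup>3 + O(e\<^sup>4)\<close>. The cubic term, which is due to the resonance of the three waves and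
  has no analogue in dimension one, makes the logarithm of this function strictly concave
  in \<open>log e\<close>, hence in \<open>t\<close>, for small \<open>e > 0\<close>: the quantity \<open>I I'' - (I')\<^sup>2\<close> is
  \<open>- 9/32 e\<^sup>5 + O(e\<^sup>6)\<close>.

  The density on the plane is \<open>1 + e V\<close> times a Gaussian of large variance \<open>s\<close>. Its heat flow is
  again explicit, and as \<open>s\<close> tends to infinity all quantities tend to their values on the torus.
\<close>

text \<open>In the limit of large \<open>s\<close> a term \<open>e^k\<close> of the Fisher
  information decays like \<open>exp (- k * t / 2)\<close>. A single exponential is log-linear, so
  the terms of order \<open>e^4\<close> in \<open>I I'' - (I')^2\<close> cancel; for
  \<open>a * exp (- t) + b * exp (- 3 * t / 2)\<close> this quantity has the sign of
  \<open>a * b\<close>, and \<open>-9/32\<close> is \<open>a * b * (3/2 - 1)^2\<close> with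
  \<open>a = 3/2\<close>, \<open>b = -3/4\<close>. Because of the cancellation all three factors
  must be known through order \<open>e^3\<close>, with an error \<open>O(e^4)\<close> whose constant
  depends on neither \<open>e\<close> nor \<open>s\<close>. The identities \<open>I' = - Q\<close>
  and \<open>I'' = D\<close>, which rest on integrations by parts, are not invoked. The static
  inequality and the one along the flow come from two separate expansions that turn out to have the
  same coefficients, so that one negativity lemma settles both. A common \<open>e\<close> is fixed
  first, and then one \<open>s\<close> that is large enough for both.\<close>

section \<open>Gaussian integrals of plane waves\<close>

lemma
  fixes f :: "'a::euclidean_space \<Rightarrow> real \<Rightarrow> 'b::{real_normed_field,banach,second_countable_topology}"
  assumes f: "\<And>b. b \<in> Basis \<Longrightarrow> integrable lborel (f b)"
  shows integrable_lborel_prod: "integrable lborel (\<lambda>x. \<Prod>b\<in>Basis. f b (x \<bullet> b))"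
    and integral_lborel_prod:
      "(\<integral>x. (\<Prod>b\<in>Basis. f b (x \<bullet> b)) \<partial>lborel) = (\<Prod>b\<in>Basis. \<integral>x. f b x \<partial>lborel)"
proof -
  interpret product_sigma_finite "\<lambda>_::'a. lborel :: real measure" ..
  have [measurable]: "f b \<in> borel_measurable borel" if "b \<in> Basis" for b
    using borel_measurable_integrable[OF f[OF that]] by simp
  have eq: "(\<lambda>x. \<Prod>b\<in>Basis. f b ((\<Sum>c\<in>Basis. x c *\<^sub>R c) \<bullet> b)) = (\<lambda>x. \<Prod>b\<in>Basis. f b (x b))"
    by (intro ext prod.cong) auto
  have meas: "(\<lambda>x. \<Prod>b\<in>Basis. f b (x \<bullet> b)) \<in> borel_measurable (borel :: 'a measure)"
    by measurable
  show "integrable lborel (\<lambda>x. \<Prod>b\<in>Basis. f b (x \<bullet> b))"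
    unfolding lborel_eq[where 'a='a]
    by (subst integrable_distr_eq) (auto simp: eq meas intro!: product_integrable_prod f)
  show "(\<integral>x. (\<Prod>b\<in>Basis. f b (x \<bullet> b)) \<partial>lborel) = (\<Prod>b\<in>Basis. \<integral>x. f b x \<partial>lborel)"
    unfolding lborel_eq[where 'a='a]
    by (subst integral_distr) (auto simp: eq meas product_integral_prod f)
qed

text \<open>With \<open>has_bochner_integral\<close>, integrability and value pass through a
  substitution together; most integrals below are handled in this form.\<close>

lemma has_bochner_integral_lborel_affine:
  fixes f :: "'a::euclidean_space \<Rightarrow> 'b::{banach,second_countable_topology}"
  assumes "has_bochner_integral lborel f y" "c \<noteq> 0"
  shows "has_bochner_integral lborel (\<lambda>x. f (t + c *\<^sub>R x)) (y /\<^sub>R \<bar>c\<bar> ^ DIM('a))"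
proof -
  have [measurable]: "f \<in> borel_measurable borel"
    using assms(1) by (auto dest: borel_measurable_has_bochner_integral)
  have "has_bochner_integral
      (density (distr lborel borel (\<lambda>x. t + c *\<^sub>R x)) (\<lambda>_. ennreal (\<bar>c\<bar> ^ DIM('a)))) f y"
    using assms(1) lborel_affine[OF assms(2), of t] by simp
  then have "has_bochner_integral (distr lborel borel (\<lambda>x. t + c *\<^sub>R x))
      (\<lambda>x. \<bar>c\<bar> ^ DIM('a) *\<^sub>R f x) y"
    by (simp add: has_bochner_integral_iff integrable_density integral_density)
  then have "has_bochner_integral lborel (\<lambda>x. \<bar>c\<bar> ^ DIM('a) *\<^sub>R f (t + c *\<^sub>R x)) y"
    by (simp add: has_bochner_integral_iff integrable_distr_eq integral_distr)
  from has_bochner_integral_scaleR_right[OF this, of "inverse (\<bar>c\<bar> ^ DIM('a))"] assms(2)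
  show ?thesis by simp
qed

text \<open>The complex exponential, unlike the cosine, factorises over the coordinates, and each
  factor is the characteristic function of the standard normal distribution.\<close>

lemma std_gauss_iexp:
  fixes k :: "'a::euclidean_space"
  shows "has_bochner_integral lborel
    (\<lambda>x. complex_of_real (exp (- (norm x)\<^sup>2 / 2)) * iexp (k \<bullet> x))
    (complex_of_real (sqrt (2 * pi) ^ DIM('a) * exp (- (norm k)\<^sup>2 / 2)))"
proof -
  let ?f = "\<lambda>b x. complex_of_real (exp (- x\<^sup>2 / 2)) * iexp ((k \<bullet> b) * x)"
  have d: "exp (- x\<^sup>2 / 2) = sqrt (2 * pi) * std_normal_density x" for x
    by (simp add: std_normal_density_def)
  have int: "integrable lborel (?f b)" for b
  proof (rule Bochner_Integration.integrable_bound)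
    show "integrable lborel (\<lambda>x. sqrt (2 * pi) * std_normal_density x)"
      by (intro integrable_mult_right) (rule integrable_normal_density, simp)
    show "AE x in lborel. norm (?f b x) \<le> norm (sqrt (2 * pi) * std_normal_density x)"
      unfolding d[symmetric] by (simp add: norm_mult)
  qed simp
  have val: "(\<integral>x. ?f b x \<partial>lborel) = sqrt (2 * pi) * exp (- (k \<bullet> b)\<^sup>2 / 2)" for b
  proof -
    have "char std_normal_distribution (k \<bullet> b)
        = (\<integral>x. std_normal_density x *\<^sub>R iexp ((k \<bullet> b) * x) \<partial>lborel)"
      unfolding char_def by (subst integral_density) auto
    then have "(\<integral>x. std_normal_density x *\<^sub>R iexp ((k \<bullet> b) * x) \<partial>lborel) = exp (- (k \<bullet> b)\<^sup>2 / 2)"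
      by (simp add: char_std_normal_distribution)
    moreover have "(\<integral>x. ?f b x \<partial>lborel)
        = (\<integral>x. complex_of_real (sqrt (2 * pi)) * (std_normal_density x *\<^sub>R iexp ((k \<bullet> b) * x)) \<partial>lborel)"
      by (intro Bochner_Integration.integral_cong) (auto simp only: d scaleR_conv_of_real of_real_mult mult.assoc)
    ultimately show ?thesis by (simp only: integral_mult_right_zero of_real_mult)
  qed
  have sq: "(\<Sum>b\<in>Basis. (x \<bullet> b)\<^sup>2) = (norm x)\<^sup>2" for x :: 'a
    unfolding power2_norm_eq_inner euclidean_inner[of x x] by (simp add: power2_eq_square)
  have ip: "(\<Sum>b\<in>Basis. (k \<bullet> b) * (x \<bullet> b)) = k \<bullet> x" for x :: 'a
    by (simp add: euclidean_inner[of k x])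
  have pe: "(\<Prod>b\<in>Basis. ?f b (x \<bullet> b)) = complex_of_real (exp (- (norm x)\<^sup>2 / 2)) * iexp (k \<bullet> x)" for x :: 'a
  proof -
    have "(\<Prod>b\<in>Basis. ?f b (x \<bullet> b))
        = exp (\<Sum>b\<in>Basis. complex_of_real (- (x \<bullet> b)\<^sup>2 / 2) + \<i> * complex_of_real ((k \<bullet> b) * (x \<bullet> b)))"
      by (simp only: exp_sum[OF finite_Basis] exp_add exp_of_real)
    also have "(\<Sum>b\<in>Basis. complex_of_real (- (x \<bullet> b)\<^sup>2 / 2) + \<i> * complex_of_real ((k \<bullet> b) * (x \<bullet> b)))
       = complex_of_real (- (norm x)\<^sup>2 / 2) + \<i> * complex_of_real (k \<bullet> x)"
      unfolding sum.distrib sum_distrib_left[symmetric] of_real_sum[symmetric]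
        sum_divide_distrib[symmetric] sum_negf sq ip by simp
    finally show ?thesis by (simp only: exp_add exp_of_real)
  qed
  have "(\<Prod>b\<in>Basis. sqrt (2 * pi) * exp (- (k \<bullet> b)\<^sup>2 / 2)) = sqrt (2 * pi) ^ DIM('a) * exp (- (norm k)\<^sup>2 / 2)"
    by (simp add: prod.distrib exp_sum[symmetric] sum_divide_distrib[symmetric] sum_negf sq)
  then have "(\<Prod>b\<in>Basis. \<integral>x. ?f b x \<partial>lborel)
      = complex_of_real (sqrt (2 * pi) ^ DIM('a) * exp (- (norm k)\<^sup>2 / 2))"
    unfolding val of_real_prod[symmetric] by simp
  then show ?thesis
    using integrable_lborel_prod[of ?f, OF int] integral_lborel_prod[of ?f, OF int]
    unfolding has_bochner_integral_iff pe by simp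
qed

text \<open>The centre \<open>\<mu>\<close> is needed for the heat kernel, where completing the
  square moves the Gaussian away from the origin.\<close>

lemma gauss_cos_shift:
  fixes k \<mu> :: "real^2"
  assumes "a > 0"
  shows "has_bochner_integral lborel (\<lambda>x. exp (- a * (norm (x - \<mu>))\<^sup>2) * cos (k \<bullet> x))
    (pi / a * exp (- (norm k)\<^sup>2 / (4 * a)) * cos (k \<bullet> \<mu>))"
proof -
  define c where "c = sqrt (2 * a)"
  have c: "c > 0" "c\<^sup>2 = 2 * a" using assms by (auto simp: c_def)
  let ?k = "(1 / c) *\<^sub>R k"
  have "has_bochner_integral lborel
    (\<lambda>x. complex_of_real (exp (- (norm ((- c) *\<^sub>R \<mu> + c *\<^sub>R x))\<^sup>2 / 2)) * iexp (?k \<bullet> ((- c) *\<^sub>R \<mu> + c *\<^sub>R x)))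
    (complex_of_real (2 * pi * exp (- (norm ?k)\<^sup>2 / 2)) /\<^sub>R c\<^sup>2)"
    using has_bochner_integral_lborel_affine[OF std_gauss_iexp[of ?k], of c "(- c) *\<^sub>R \<mu>"] c(1) by simp
  moreover have "(norm ((- c) *\<^sub>R \<mu> + c *\<^sub>R x))\<^sup>2 / 2 = a * (norm (x - \<mu>))\<^sup>2" for x
  proof -
    have "(- c) *\<^sub>R \<mu> + c *\<^sub>R x = c *\<^sub>R (x - \<mu>)" by (simp add: algebra_simps)
    then show ?thesis using c by (simp add: power_mult_distrib)
  qed
  moreover have "(norm ?k)\<^sup>2 / 2 = (norm k)\<^sup>2 / (4 * a)"
    using c by (simp add: power_mult_distrib power_divide)
  moreover have "?k \<bullet> ((- c) *\<^sub>R \<mu> + c *\<^sub>R x) = k \<bullet> x - k \<bullet> \<mu>" for x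
    using c by (simp add: inner_add_right algebra_simps)
  ultimately have "has_bochner_integral lborel
    (\<lambda>x. complex_of_real (exp (- (a * (norm (x - \<mu>))\<^sup>2))) * iexp (k \<bullet> x - k \<bullet> \<mu>))
    (complex_of_real (2 * pi * exp (- ((norm k)\<^sup>2 / (4 * a)))) /\<^sub>R c\<^sup>2)"
    by (simp only: minus_divide_left[symmetric])
  \<comment> \<open>Before real parts are taken, undoing the shift of the argument is multiplication
    by a constant phase.\<close>
  from has_bochner_integral_mult_right[OF this, of "iexp (k \<bullet> \<mu>)"]
  have "has_bochner_integral lborel
    (\<lambda>x. complex_of_real (exp (- (a * (norm (x - \<mu>))\<^sup>2))) * iexp (k \<bullet> x))
    (complex_of_real (pi / a * exp (- ((norm k)\<^sup>2 / (4 * a)))) * iexp (k \<bullet> \<mu>))"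
    using assms
    by (simp add: c exp_diff scaleR_conv_of_real field_simps)
  from has_bochner_integral_bounded_linear[OF bounded_linear_Re this]
  show ?thesis by (simp add: Re_exp)
qed

lemma gauss_cos:
  fixes k :: "real^2"
  assumes "a > 0"
  shows "has_bochner_integral lborel (\<lambda>x. exp (- a * (norm x)\<^sup>2) * cos (k \<bullet> x))
    (pi / a * exp (- (norm k)\<^sup>2 / (4 * a)))"
  using gauss_cos_shift[OF assms, of 0 k] by simp

lemma gauss_integral:
  assumes "a > 0"
  shows "has_bochner_integral lborel (\<lambda>x::real^2. exp (- a * (norm x)\<^sup>2)) (pi / a)"
  using gauss_cos[OF assms, of 0] by simp

lemma one_plus_sq_exp_le:
  fixes a :: real
  assumes "a > 0"
  obtains C where "C \<ge> 0" "\<And>u. u \<ge> 0 \<Longrightarrow> (1 + u)\<^sup>2 \<le> C * exp (a * u)"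
proof
  \<comment> \<open>Chosen so that \<open>1 + u \<le> ?m * (1 + a * u / 2)\<close>; then
    \<open>1 + y \<le> exp y\<close> at \<open>y = a * u / 2\<close> is squared.\<close>
  let ?m = "max 1 (2 / a)"
  show "0 \<le> ?m\<^sup>2" by simp
  fix u :: real assume u: "u \<ge> 0"
  have "1 \<le> ?m" and "u \<le> ?m * (a * u / 2)"
  proof -
    have "(2 / a) * (a * u / 2) \<le> ?m * (a * u / 2)"
      using assms u by (intro mult_right_mono) auto
    then show "u \<le> ?m * (a * u / 2)" using assms by simp
  qed simp
  then have "1 + u \<le> ?m * (1 + a * u / 2)" by (simp only: distrib_left mult_1_right add_mono)
  also have "\<dots> \<le> ?m * exp (a * u / 2)"
    using exp_ge_add_one_self[of "a * u / 2"] by (intro mult_left_mono) auto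
  finally have "(1 + u)\<^sup>2 \<le> (?m * exp (a * u / 2))\<^sup>2"
    using u by (intro power_mono) auto
  also have "\<dots> = ?m\<^sup>2 * exp (a * u)"
    by (simp add: power_mult_distrib flip: exp_double)
  finally show "(1 + u)\<^sup>2 \<le> ?m\<^sup>2 * exp (a * u)" .
qed

text \<open>This weight covers all growth that occurs: each derivative in the Gaussian exponent
  brings down one factor of the squared norm, and at most two such derivatives are taken.\<close>

lemma integrable_gauss_weight:
  assumes "a > 0"
  shows "integrable lborel (\<lambda>x::real^2. exp (- a * (norm x)\<^sup>2) * (1 + (norm x)\<^sup>2)\<^sup>2)"
proof -
  obtain C where C: "C \<ge> 0" "\<And>u. u \<ge> 0 \<Longrightarrow> (1 + u)\<^sup>2 \<le> C * exp (a / 2 * u)"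
    using one_plus_sq_exp_le[of "a / 2"] assms by auto
  show ?thesis
  proof (rule Bochner_Integration.integrable_bound)
    show "integrable lborel (\<lambda>x::real^2. C * exp (- (a / 2) * (norm x)\<^sup>2))"
      using gauss_integral[of "a / 2"] assms by (auto simp: has_bochner_integral_iff)
    show "AE x in lborel. norm (exp (- a * (norm x)\<^sup>2) * (1 + (norm (x::real^2))\<^sup>2)\<^sup>2)
        \<le> norm (C * exp (- (a / 2) * (norm x)\<^sup>2))"
    proof (rule AE_I2)
      fix x :: "real^2"
      have "exp (- a * (norm x)\<^sup>2) * (1 + (norm x)\<^sup>2)\<^sup>2 \<le> exp (- a * (norm x)\<^sup>2) * (C * exp (a / 2 * (norm x)\<^sup>2))"
        by (intro mult_left_mono C) auto
      also have "\<dots> = C * exp (- a * (norm x)\<^sup>2 + a / 2 * (norm x)\<^sup>2)"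
        by (simp only: exp_add mult_ac)
      also have "- a * (norm x)\<^sup>2 + a / 2 * (norm x)\<^sup>2 = - (a / 2) * (norm x)\<^sup>2" by simp
      finally show "norm (exp (- a * (norm x)\<^sup>2) * (1 + (norm x)\<^sup>2)\<^sup>2) \<le> norm (C * exp (- (a / 2) * (norm x)\<^sup>2))"
        using C(1) by (simp add: abs_mult)
    qed
  qed simp
qed

lemma integrable_gauss_bound:
  fixes h :: "real^2 \<Rightarrow> real"
  assumes "a > 0" "h \<in> borel_measurable borel" "\<And>x. \<bar>h x\<bar> \<le> C * (1 + (norm x)\<^sup>2)\<^sup>2"
  shows "integrable lborel (\<lambda>x. exp (- a * (norm x)\<^sup>2) * h x)"
proof (rule Bochner_Integration.integrable_bound)
  show "integrable lborel (\<lambda>x::real^2. C * (exp (- a * (norm x)\<^sup>2) * (1 + (norm x)\<^sup>2)\<^sup>2))"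
    using integrable_gauss_weight[OF assms(1)] by simp
  show "(\<lambda>x. exp (- a * (norm x)\<^sup>2) * h x) \<in> borel_measurable lborel"
    using assms(2) by simp
  have "\<bar>h x\<bar> \<le> \<bar>C * (1 + (norm x)\<^sup>2)\<^sup>2\<bar>" for x using assms(3)[of x] by linarith
  then show "AE x in lborel. norm (exp (- a * (norm x)\<^sup>2) * h x) \<le> norm (C * (exp (- a * (norm x)\<^sup>2) * (1 + (norm x)\<^sup>2)\<^sup>2))"
    by (intro AE_I2) (simp add: abs_mult mult.left_commute mult_left_mono)
qed

section \<open>Derivatives and limits under the integral sign\<close>

text \<open>By the mean value inequality on the convex set \<open>T\<close>, the bound on the
  derivative also bounds the difference quotients, so dominated convergence applies along sequences.
  The set \<open>T\<close> admits one-sided derivatives, as required at time zero on the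
  half-line.\<close>

lemma leibniz_dominated:
  fixes h h' :: "real \<Rightarrow> 'a \<Rightarrow> real"
  assumes T: "convex T" "t \<in> T"
    and der: "\<And>u x. u \<in> T \<Longrightarrow> ((\<lambda>u. h u x) has_real_derivative h' u x) (at u within T)"
    and bnd: "\<And>u x. u \<in> T \<Longrightarrow> \<bar>h' u x\<bar> \<le> b x"
    and b: "integrable M b"
    and int: "\<And>u. u \<in> T \<Longrightarrow> integrable M (h u)"
    and meas: "h' t \<in> borel_measurable M"
  shows "((\<lambda>u. \<integral>x. h u x \<partial>M) has_real_derivative (\<integral>x. h' t x \<partial>M)) (at t within T)"
  unfolding has_field_derivative_iff
proof (subst tendsto_at_iff_sequentially, intro allI impI)
  fix X :: "nat \<Rightarrow> real"
  assume X: "\<forall>i. X i \<in> T - {t}" and lim: "X \<longlonglongrightarrow> t"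
  have q: "((\<lambda>u. \<integral>x. h u x \<partial>M) \<circ> X) n = (\<integral>x. h (X n) x \<partial>M)" for n by simp
  have eq: "((\<integral>x. h (X n) x \<partial>M) - (\<integral>x. h t x \<partial>M)) / (X n - t) = (\<integral>x. (h (X n) x - h t x) / (X n - t) \<partial>M)" for n
    using X int T(2) by (simp add: Bochner_Integration.integral_diff)
  have "(\<lambda>n. \<integral>x. (h (X n) x - h t x) / (X n - t) \<partial>M) \<longlonglongrightarrow> (\<integral>x. h' t x \<partial>M)"
  proof (rule integral_dominated_convergence[where w = b])
    show "AE x in M. (\<lambda>n. (h (X n) x - h t x) / (X n - t)) \<longlonglongrightarrow> h' t x"
    proof (rule AE_I2)
      fix x
      have "((\<lambda>u. (h u x - h t x) / (u - t)) \<longlongrightarrow> h' t x) (at t within T)"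
        using der[OF T(2)] unfolding has_field_derivative_iff .
      then show "(\<lambda>n. (h (X n) x - h t x) / (X n - t)) \<longlonglongrightarrow> h' t x"
        using X lim unfolding tendsto_at_iff_sequentially by (auto simp: comp_def)
    qed
    show "AE x in M. norm ((h (X n) x - h t x) / (X n - t)) \<le> b x" for n
    proof (rule AE_I2)
      fix x
      have "norm (h (X n) x - h t x) \<le> b x * norm (X n - t)"
      proof (rule field_differentiable_bound[OF T(1)])
        show "norm (h' z x) \<le> b x" if "z \<in> T" for z using bnd[OF that] by simp
      qed (use der X T(2) in auto)
      then show "norm ((h (X n) x - h t x) / (X n - t)) \<le> b x"
        using X by (simp add: norm_divide divide_le_eq)
    qed
    show "(\<lambda>x. (h (X n) x - h t x) / (X n - t)) \<in> borel_measurable M" for n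
      using int[of "X n"] int[OF T(2)] X by (auto dest!: borel_measurable_integrable)
  qed (use b meas in auto)
  then show "((\<lambda>u. ((\<integral>x. h u x \<partial>M) - (\<integral>x. h t x \<partial>M)) / (u - t)) \<circ> X) \<longlonglongrightarrow> (\<integral>x. h' t x \<partial>M)"
    by (simp add: comp_def eq)
qed

lemma tendsto_integral_dominated:
  fixes h :: "real \<Rightarrow> 'a \<Rightarrow> real"
  assumes "t \<in> T"
    and lim: "\<And>x. ((\<lambda>u. h u x) \<longlongrightarrow> h t x) (at t within T)"
    and bnd: "\<And>u x. u \<in> T \<Longrightarrow> \<bar>h u x\<bar> \<le> b x"
    and b: "integrable M b"
    and meas: "\<And>u. u \<in> T \<Longrightarrow> h u \<in> borel_measurable M"
  shows "((\<lambda>u. \<integral>x. h u x \<partial>M) \<longlongrightarrow> (\<integral>x. h t x \<partial>M)) (at t within T)"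
proof (subst tendsto_at_iff_sequentially, intro allI impI)
  fix X :: "nat \<Rightarrow> real"
  assume X: "\<forall>i. X i \<in> T - {t}" and l: "X \<longlonglongrightarrow> t"
  have "(\<lambda>n. \<integral>x. h (X n) x \<partial>M) \<longlonglongrightarrow> (\<integral>x. h t x \<partial>M)"
  proof (rule integral_dominated_convergence[where w = b])
    show "AE x in M. (\<lambda>n. h (X n) x) \<longlonglongrightarrow> h t x"
      using lim X l unfolding tendsto_at_iff_sequentially by (auto simp: comp_def)
  qed (use assms X in auto)
  then show "((\<lambda>u. \<integral>x. h u x \<partial>M) \<circ> X) \<longlonglongrightarrow> (\<integral>x. h t x \<partial>M)" by (simp add: comp_def)
qed

section \<open>Smoothness and log-derivatives of wave packets\<close>

text \<open>A class of differentiable functions closed under \<open>pd\<close>, so that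
  differentiability of all iterated partial derivatives is one induction. Quotients and logarithms
  are left out: only the density itself has to be shown smooth.\<close>

inductive elementary :: "(real^2 \<Rightarrow> real) \<Rightarrow> bool" where
  const: "elementary (\<lambda>_. c)"
| inner: "elementary (\<lambda>x. k \<bullet> x)"
| norm_sq: "elementary (\<lambda>x. (norm x)\<^sup>2)"
| add: "elementary g \<Longrightarrow> elementary h \<Longrightarrow> elementary (\<lambda>x. g x + h x)"
| mult: "elementary g \<Longrightarrow> elementary h \<Longrightarrow> elementary (\<lambda>x. g x * h x)"
| exp: "elementary g \<Longrightarrow> elementary (\<lambda>x. exp (g x))"
| cos: "elementary g \<Longrightarrow> elementary (\<lambda>x. cos (g x))"
| sin: "elementary g \<Longrightarrow> elementary (\<lambda>x. sin (g x))"

lemma pd_eqI: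
  "((\<lambda>s. g (x + s *\<^sub>R axis i 1)) has_real_derivative D) (at 0) \<Longrightarrow> pd i g x = D"
  unfolding pd_def by (rule DERIV_imp_deriv)

lemma elementary_differentiable: "elementary g \<Longrightarrow> g differentiable (at x)"
proof (induction rule: elementary.induct)
  case norm_sq
  show ?case by (simp add: power2_norm_eq_inner)
next
  case (exp g)
  then show ?case
    unfolding differentiable_def by (blast intro: has_derivative_exp)
next
  case (cos g)
  then show ?case
    unfolding differentiable_def by (blast intro: has_derivative_cos)
next
  case (sin g)
  then show ?case
    unfolding differentiable_def by (blast intro: has_derivative_sin)
qed auto

lemma has_real_derivative_inner_line [derivative_intros]:
  "((\<lambda>s. k \<bullet> (x + s *\<^sub>R axis i 1)) has_real_derivative k $ i) (at u)"
  by (auto intro!: derivative_eq_intros simp: inner_add_right inner_axis)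

lemma has_real_derivative_norm_sq_line [derivative_intros]:
  "((\<lambda>s. (norm (x + s *\<^sub>R axis i 1))\<^sup>2) has_real_derivative 2 * x $ i) (at 0)"
  unfolding power2_norm_eq_inner
  by (auto intro!: derivative_eq_intros simp: inner_add_right inner_add_left inner_axis inner_axis' algebra_simps)

lemma has_real_derivative_nth_line [derivative_intros]:
  "((\<lambda>s. (x + s *\<^sub>R axis i 1) $ j) has_real_derivative (if i = j then 1 else 0)) (at u)"
  by (auto intro!: derivative_eq_intros simp: axis_def)

lemma elementary_pd:
  assumes "elementary g"
  obtains g' where "elementary g'"
    "\<And>x. ((\<lambda>s. g (x + s *\<^sub>R axis i 1)) has_real_derivative g' x) (at 0)"
  using assms
proof (induction arbitrary: thesis rule: elementary.induct)
  case (const c)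
  show ?case by (rule const(1)[OF elementary.const[of 0]]) simp
next
  case (inner k)
  show ?case
    by (rule inner(1)[OF elementary.const[of "k $ i"]]) (rule has_real_derivative_inner_line)
next
  case norm_sq
  have "elementary (\<lambda>x. 2 * (axis i 1 \<bullet> x))"
    by (intro elementary.mult elementary.const elementary.inner)
  then show ?case
    by (rule norm_sq) (auto intro!: derivative_eq_intros simp: inner_axis')
next
  case (add g h)
  obtain g' h' where gh: "elementary g'" "elementary h'"
    "\<And>x. ((\<lambda>s. g (x + s *\<^sub>R axis i 1)) has_real_derivative g' x) (at 0)"
    "\<And>x. ((\<lambda>s. h (x + s *\<^sub>R axis i 1)) has_real_derivative h' x) (at 0)"
    using add.IH by metis
  show ?case
    by (rule add.prems[of "\<lambda>x. g' x + h' x"]) (auto intro!: gh elementary.add DERIV_add)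
next
  case (mult g h)
  obtain g' h' where gh: "elementary g'" "elementary h'"
    "\<And>x. ((\<lambda>s. g (x + s *\<^sub>R axis i 1)) has_real_derivative g' x) (at 0)"
    "\<And>x. ((\<lambda>s. h (x + s *\<^sub>R axis i 1)) has_real_derivative h' x) (at 0)"
    using mult.IH by metis
  show ?case
    by (rule mult.prems[of "\<lambda>x. g' x * h x + h' x * g x"])
      (auto intro!: gh elementary.add elementary.mult mult.hyps DERIV_mult[THEN DERIV_cong])
next
  case (exp g)
  obtain g' where g': "elementary g'"
    "\<And>x. ((\<lambda>s. g (x + s *\<^sub>R axis i 1)) has_real_derivative g' x) (at 0)"
    using exp.IH by metis
  show ?case
    by (rule exp.prems[of "\<lambda>x. exp (g x) * g' x"])
      (auto intro!: g' elementary.mult elementary.exp exp.hyps derivative_eq_intros)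
next
  case (cos g)
  obtain g' where g': "elementary g'"
    "\<And>x. ((\<lambda>s. g (x + s *\<^sub>R axis i 1)) has_real_derivative g' x) (at 0)"
    using cos.IH by metis
  show ?case
  proof (rule cos.prems[of "\<lambda>x. (- 1) * (sin (g x) * g' x)"])
    show "elementary (\<lambda>x. (- 1) * (sin (g x) * g' x))"
      by (intro g' elementary.mult elementary.sin elementary.const cos.hyps)
  qed (auto intro!: g' derivative_eq_intros)
next
  case (sin g)
  obtain g' where g': "elementary g'"
    "\<And>x. ((\<lambda>s. g (x + s *\<^sub>R axis i 1)) has_real_derivative g' x) (at 0)"
    using sin.IH by metis
  show ?case
    by (rule sin.prems[of "\<lambda>x. cos (g x) * g' x"])
      (auto intro!: g' elementary.mult elementary.cos sin.hyps derivative_eq_intros)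
qed

lemma pd_elementary: "elementary g \<Longrightarrow> elementary (pd i g)"
proof -
  assume "elementary g"
  then obtain g' where g': "elementary g'"
    "\<And>x. ((\<lambda>s. g (x + s *\<^sub>R axis i 1)) has_real_derivative g' x) (at 0)"
    using elementary_pd[where i = i] by metis
  then have "pd i g = g'" by (intro ext pd_eqI)
  with g' show ?thesis by simp
qed

lemma elementary_smooth:
  assumes "elementary g"
  shows "smooth_fun g"
proof -
  have "elementary (iter_pd is g)" for "is"
    by (induction "is") (auto intro: assms pd_elementary)
  then show ?thesis
    unfolding smooth_fun_def by (auto intro: elementary_differentiable)
qed

section \<open>The three waves and their derivatives\<close>

text \<open>Directions at mutual angles of 120 degrees, up to rotation and reflection the only unit
  vectors in the plane that form a closed triangle. Distinct ones have inner product -1/2, the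
  source of all cubic coefficients below.\<close>

definition wavevec :: "3 \<Rightarrow> real^2" where
  "wavevec m = (if m = 1 then vector [1, 0]
    else if m = 2 then vector [- 1 / 2, sqrt 3 / 2] else vector [- 1 / 2, - sqrt 3 / 2])"

lemma wavevec_simps:
  "wavevec 1 $ 1 = 1" "wavevec 1 $ 2 = 0" "wavevec 2 $ 1 = - 1 / 2" "wavevec 2 $ 2 = sqrt 3 / 2"
  "wavevec 3 $ 1 = - 1 / 2" "wavevec 3 $ 2 = - sqrt 3 / 2"
  by (simp_all add: wavevec_def)

lemma norm_wavevec [simp]: "norm (wavevec m) = 1"
  using exhaust_3[of m] by (auto simp: norm_vec_def L2_set_def sum_2 wavevec_simps power2_eq_square)

lemma wavevec_nth_le: "\<bar>wavevec m $ i\<bar> \<le> 1"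
  using component_le_norm_cart[of "wavevec m" i] by simp

definition V :: "real^2 \<Rightarrow> real" where
  "V x = (\<Sum>m\<in>UNIV. cos (wavevec m \<bullet> x))"
definition V1 :: "2 \<Rightarrow> real^2 \<Rightarrow> real" where
  "V1 i x = (\<Sum>m\<in>UNIV. - wavevec m $ i * sin (wavevec m \<bullet> x))"
definition V2 :: "2 \<Rightarrow> 2 \<Rightarrow> real^2 \<Rightarrow> real" where
  "V2 i j x = (\<Sum>m\<in>UNIV. - (wavevec m $ i * wavevec m $ j) * cos (wavevec m \<bullet> x))"
definition V3 :: "2 \<Rightarrow> 2 \<Rightarrow> 2 \<Rightarrow> real^2 \<Rightarrow> real" where
  "V3 i j k x = (\<Sum>m\<in>UNIV. (wavevec m $ i * wavevec m $ j * wavevec m $ k) * sin (wavevec m \<bullet> x))"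

lemma wave_sum_bound:
  fixes c t :: "3 \<Rightarrow> real"
  assumes "\<And>m. \<bar>c m\<bar> \<le> 1" "\<And>m. \<bar>t m\<bar> \<le> 1"
  shows "\<bar>\<Sum>m\<in>UNIV. c m * t m\<bar> \<le> 3"
proof -
  have "\<bar>c m * t m\<bar> \<le> 1" for m
    using mult_mono[OF assms(1)[of m] assms(2)[of m]] by (simp add: abs_mult)
  then have "\<bar>\<Sum>m\<in>UNIV. c m * t m\<bar> \<le> (\<Sum>m\<in>(UNIV::3 set). 1)"
    by (intro order_trans[OF sum_abs] sum_mono)
  then show ?thesis by simp
qed

lemma V_bound: "\<bar>V x\<bar> \<le> 3"
  using wave_sum_bound[of "\<lambda>_. 1" "\<lambda>m. cos (wavevec m \<bullet> x)"] by (simp add: V_def)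

lemma V1_bound: "\<bar>V1 i x\<bar> \<le> 3"
  unfolding V1_def by (rule wave_sum_bound) (auto simp: wavevec_nth_le)

lemma V2_bound: "\<bar>V2 i j x\<bar> \<le> 3"
  unfolding V2_def
  by (rule wave_sum_bound) (auto simp: abs_mult intro!: mult_le_one wavevec_nth_le)

lemma V3_bound: "\<bar>V3 i j k x\<bar> \<le> 3"
  unfolding V3_def
  by (rule wave_sum_bound) (auto simp: abs_mult intro!: mult_le_one wavevec_nth_le)

lemma V_measurable [measurable]: "V \<in> borel_measurable borel"
  unfolding V_def by measurable
lemma V1_measurable [measurable]: "V1 i \<in> borel_measurable borel"
  unfolding V1_def by measurable
lemma V2_measurable [measurable]: "V2 i j \<in> borel_measurable borel"
  unfolding V2_def by measurable
lemma V3_measurable [measurable]: "V3 i j k \<in> borel_measurable borel"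
  unfolding V3_def by measurable

lemma V_line [derivative_intros]:
  "((\<lambda>s. V (\<theta> *\<^sub>R (x + s *\<^sub>R axis i 1))) has_real_derivative \<theta> * V1 i (\<theta> *\<^sub>R x)) (at 0)"
  unfolding V_def V1_def inner_scaleR_right
  by (auto intro!: derivative_eq_intros sum.cong simp: sum_distrib_left)

lemma V_line_1 [derivative_intros]:
  "((\<lambda>s. V (x + s *\<^sub>R axis i 1)) has_real_derivative V1 i x) (at 0)"
  using V_line[of 1] by simp

lemma V1_line [derivative_intros]:
  "((\<lambda>s. V1 j (x + s *\<^sub>R axis i 1)) has_real_derivative V2 i j x) (at 0)"
  unfolding V1_def V2_def
  by (auto intro!: derivative_eq_intros sum.cong simp: sum_distrib_left)

lemma V2_line [derivative_intros]:
  "((\<lambda>s. V2 i j (x + s *\<^sub>R axis k 1)) has_real_derivative V3 i j k x) (at 0)"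
  unfolding V2_def V3_def
  by (auto intro!: derivative_eq_intros sum.cong simp: sum_distrib_left)

section \<open>Gaussian wave packets\<close>

text \<open>The dilation \<open>\<theta>\<close> is there for the heat flow: a packet with dilation
  1 stays in this family, but its waves are stretched as the Gaussian spreads.\<close>

definition packet :: "real \<Rightarrow> real \<Rightarrow> real \<Rightarrow> real \<Rightarrow> real^2 \<Rightarrow> real" where
  "packet A a d \<theta> x = A * exp (- a * (norm x)\<^sup>2) * (1 + d * V (\<theta> *\<^sub>R x))"

text \<open>The origin of the bound 1/10 on amplitudes: since \<open>V\<close> is at most 3 in
  absolute value, the modulation stays away from zero, which gives positivity of the density and a
  uniform bound on the reciprocal of the modulation.\<close>

lemma one_plus_V_ge:
  assumes "0 \<le> d" "d \<le> 1 / 10"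
  shows "1 + d * V x \<ge> 7 / 10"
proof -
  have "\<bar>d * V x\<bar> \<le> 1 / 10 * 3"
    using assms V_bound[of x] unfolding abs_mult by (intro mult_mono) auto
  then show ?thesis by linarith
qed

lemma packet_pos: "A > 0 \<Longrightarrow> 0 \<le> d \<Longrightarrow> d \<le> 1 / 10 \<Longrightarrow> packet A a d \<theta> x > 0"
  using one_plus_V_ge[of d "\<theta> *\<^sub>R x"] by (auto simp: packet_def)

lemma packet_elementary: "elementary (packet A a d \<theta>)"
proof -
  have "packet A a d \<theta> = (\<lambda>x. A * exp ((- a) * (norm x)\<^sup>2)
      * (1 + d * (cos ((\<theta> *\<^sub>R wavevec 1) \<bullet> x) + cos ((\<theta> *\<^sub>R wavevec 2) \<bullet> x) + cos ((\<theta> *\<^sub>R wavevec 3) \<bullet> x))))"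
    by (simp add: fun_eq_iff packet_def V_def sum_3)
  then show ?thesis
    by (simp only:) (intro elementary.intros)
qed

lemma pd_packet:
  "pd i (packet A a d \<theta>) x = A * exp (- a * (norm x)\<^sup>2)
    * (- 2 * a * x $ i * (1 + d * V (\<theta> *\<^sub>R x)) + d * \<theta> * V1 i (\<theta> *\<^sub>R x))"
  unfolding packet_def
  by (rule pd_eqI, (rule derivative_eq_intros refl)+) (simp add: algebra_simps)

lemma pd_ln_packet:
  assumes "A > 0" "0 \<le> d" "d \<le> 1 / 10"
  shows "pd i (\<lambda>x. ln (packet A a d 1 x)) = (\<lambda>x. - 2 * a * x $ i + d * V1 i x * inverse (1 + d * V x))"
proof
  fix x
  have "ln (packet A a d 1 y) = ln A - a * (norm y)\<^sup>2 + ln (1 + d * V y)" for y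
    using assms one_plus_V_ge[of d y] by (simp add: packet_def ln_mult)
  then have eq: "(\<lambda>x. ln (packet A a d 1 x)) = (\<lambda>y. ln A - a * (norm y)\<^sup>2 + ln (1 + d * V y))"
    by (rule ext)
  show "pd i (\<lambda>x. ln (packet A a d 1 x)) x = - 2 * a * x $ i + d * V1 i x * inverse (1 + d * V x)"
    unfolding eq using one_plus_V_ge[OF assms(2,3), of x]
    by (intro pd_eqI) (auto intro!: derivative_eq_intros simp: field_simps)
qed

text \<open>The reciprocal \<open>r\<close> of the modulation satisfies
  \<open>r' = - d * V1 i x * r^2\<close>. Written with \<open>inverse\<close>, all higher
  log-derivatives are therefore polynomials in \<open>r\<close> and the derivatives of
  \<open>V\<close>.\<close>

lemma inverse_V_line:
  assumes "0 \<le> d" "d \<le> 1 / 10"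
  shows "((\<lambda>s. inverse (1 + d * V (x + s *\<^sub>R axis i 1))) has_real_derivative
    - (d * V1 i x * (inverse (1 + d * V x))\<^sup>2)) (at 0)"
  using one_plus_V_ge[OF assms, of x]
  by (auto intro!: derivative_eq_intros simp: power2_eq_square)

lemma negHess_packet:
  assumes "A > 0" "0 \<le> d" "d \<le> 1 / 10"
  shows "negHess (packet A a d 1) i j = (\<lambda>x. (if i = j then 2 * a else 0)
    - (d * V2 i j x * inverse (1 + d * V x) - d\<^sup>2 * V1 i x * V1 j x * (inverse (1 + d * V x))\<^sup>2))"
proof
  fix x
  show "negHess (packet A a d 1) i j x = (if i = j then 2 * a else 0)
    - (d * V2 i j x * inverse (1 + d * V x) - d\<^sup>2 * V1 i x * V1 j x * (inverse (1 + d * V x))\<^sup>2)"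
    unfolding negHess_def pd_ln_packet[OF assms] minus_equation_iff[of "pd _ _ _"]
    by (rule sym, rule pd_eqI,
        (rule inverse_V_line[OF assms(2,3), THEN DERIV_cong] derivative_eq_intros refl)+)
      (auto simp: power2_eq_square algebra_simps)
qed

lemma pd_negHess_packet:
  assumes "A > 0" "0 \<le> d" "d \<le> 1 / 10"
  shows "pd k (negHess (packet A a d 1) i j) x =
    - (d * V3 i j k x * inverse (1 + d * V x)
      - d\<^sup>2 * (V2 i j x * V1 k x + V2 k i x * V1 j x + V2 k j x * V1 i x) * (inverse (1 + d * V x))\<^sup>2
      + 2 * d^3 * V1 i x * V1 j x * V1 k x * (inverse (1 + d * V x))^3)"
proof -
  show ?thesis
    unfolding negHess_packet[OF assms]
    by (rule pd_eqI, (rule inverse_V_line[OF assms(2,3), THEN DERIV_cong] derivative_eq_intros refl)+)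
      (auto simp: power2_eq_square power3_eq_cube algebra_simps)
qed

section \<open>Fisher information along the heat flow\<close>

text \<open>Completing the square in \<open>y\<close> splits the product of the two Gaussians into
  one in \<open>x\<close> of variance \<open>s + t\<close> and one in \<open>y\<close> of variance
  \<open>s * t / (s + t)\<close> centred at \<open>s / (s + t)\<close> times \<open>x\<close>.
  Integrating a unit wave against the latter damps it by
  \<open>exp (- s * t / (2 * (s + t)))\<close> and evaluates it at the centre: these are the new
  amplitude and the new dilation.\<close>

lemma heat_packet:
  assumes "s > 0" "t \<ge> 0"
  shows "heat t (packet A (1 / (2 * s)) d 1)
    = packet (A * s / (s + t)) (1 / (2 * (s + t))) (d * exp (- s * t / (2 * (s + t)))) (s / (s + t))"
proof (cases "t = 0")
  case True
  then show ?thesis using assms by (simp add: heat_def fun_eq_iff)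
next
  case False
  with assms have t: "t > 0" by simp
  define S where "S = s + t"
  define a where "a = S / (2 * s * t)"
  have S: "S > 0" and a: "a > 0" using assms t by (auto simp: S_def a_def)
  show ?thesis
  proof
    fix x :: "real^2"
    define \<mu> where "\<mu> = (s / S) *\<^sub>R x"
    have split: "(norm y)\<^sup>2 / (2 * s) + (norm (x - y))\<^sup>2 / (2 * t) = (norm x)\<^sup>2 / (2 * S) + a * (norm (y - \<mu>))\<^sup>2" for y
    proof -
      have "a * (norm (y - \<mu>))\<^sup>2 = a * (y \<bullet> y) - 2 * a * (s / S) * (x \<bullet> y) + a * (s / S)\<^sup>2 * (x \<bullet> x)"
        unfolding power2_norm_eq_inner \<mu>_def
        by (simp add: inner_diff_left inner_diff_right inner_commute algebra_simps power2_eq_square)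
      moreover have "a * (y \<bullet> y) = (y \<bullet> y) / (2 * s) + (y \<bullet> y) / (2 * t)"
        using assms t by (simp add: a_def S_def field_simps)
      moreover have "2 * a * (s / S) * (x \<bullet> y) = (x \<bullet> y) / t"
        using S assms by (simp add: a_def)
      moreover have "a * (s / S)\<^sup>2 * (x \<bullet> x) = (x \<bullet> x) / (2 * t) - (x \<bullet> x) / (2 * S)"
      proof -
        have "a * (s / S)\<^sup>2 = s / (2 * t * S)"
          using S assms by (simp add: a_def power2_eq_square)
        also have "\<dots> = 1 / (2 * t) - 1 / (2 * S)"
          using S t assms by (simp add: divide_simps) (simp add: S_def)
        finally show ?thesis by (simp add: left_diff_distrib)
      qed
      ultimately show ?thesis
        unfolding power2_norm_eq_inner
        by (simp add: inner_diff_left inner_diff_right inner_commute diff_divide_distrib add_divide_distrib)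
    qed
    define K where "K = A / (2 * pi * t) * exp (- (norm x)\<^sup>2 / (2 * S))"
    have integrand: "packet A (1 / (2 * s)) d 1 y * exp (- (norm (x - y))\<^sup>2 / (2 * t)) / (2 * pi * t)
      = K * (exp (- a * (norm (y - \<mu>))\<^sup>2) * cos (0 \<bullet> y)
         + d * (\<Sum>m\<in>UNIV. exp (- a * (norm (y - \<mu>))\<^sup>2) * cos (wavevec m \<bullet> y)))" for y
    proof -
      have "exp (- (1 / (2 * s)) * (norm y)\<^sup>2) * exp (- (norm (x - y))\<^sup>2 / (2 * t))
          = exp (- ((norm y)\<^sup>2 / (2 * s) + (norm (x - y))\<^sup>2 / (2 * t)))"
        by (simp add: exp_add[symmetric])
      also have "\<dots> = exp (- (norm x)\<^sup>2 / (2 * S)) * exp (- a * (norm (y - \<mu>))\<^sup>2)"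
        unfolding split by (simp add: exp_add[symmetric])
      finally have e: "exp (- (1 / (2 * s)) * (norm y)\<^sup>2) * exp (- (norm (x - y))\<^sup>2 / (2 * t))
        = exp (- (norm x)\<^sup>2 / (2 * S)) * exp (- a * (norm (y - \<mu>))\<^sup>2)" .
      have "packet A (1 / (2 * s)) d 1 y * exp (- (norm (x - y))\<^sup>2 / (2 * t)) / (2 * pi * t)
        = A / (2 * pi * t) * (1 + d * V y) * (exp (- (1 / (2 * s)) * (norm y)\<^sup>2) * exp (- (norm (x - y))\<^sup>2 / (2 * t)))"
        by (simp add: packet_def)
      also have "\<dots> = K * exp (- a * (norm (y - \<mu>))\<^sup>2) * (1 + d * V y)"
        unfolding e by (simp add: K_def)
      finally show ?thesis
        by (simp add: V_def sum_3 algebra_simps)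
    qed
    have "has_bochner_integral lborel
        (\<lambda>y. packet A (1 / (2 * s)) d 1 y * exp (- (norm (x - y))\<^sup>2 / (2 * t)) / (2 * pi * t))
        (K * (pi / a * exp (- (norm (0::real^2))\<^sup>2 / (4 * a)) * cos (0 \<bullet> \<mu>)
         + d * (\<Sum>m\<in>UNIV. pi / a * exp (- (norm (wavevec m))\<^sup>2 / (4 * a)) * cos (wavevec m \<bullet> \<mu>))))"
      unfolding integrand
      by (intro has_bochner_integral_mult_right has_bochner_integral_add has_bochner_integral_sum
          gauss_cos_shift a)
    then have "heat t (packet A (1 / (2 * s)) d 1) x
      = K * (pi / a * (1 + d * exp (- 1 / (4 * a)) * V \<mu>))"
      using False unfolding heat_def
      by (simp add: has_bochner_integral_iff V_def sum_3 algebra_simps)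
    also have "K * (pi / a * (1 + d * exp (- 1 / (4 * a)) * V \<mu>)) = K * (pi / a) * (1 + d * exp (- s * t / (2 * S)) * V \<mu>)"
      using assms t by (simp add: a_def)
    also have "K * (pi / a) = A * s / S * exp (- (1 / (2 * S)) * (norm x)\<^sup>2)"
      using assms t S by (simp add: K_def a_def)
    finally show "heat t (packet A (1 / (2 * s)) d 1) x
      = packet (A * s / (s + t)) (1 / (2 * (s + t))) (d * exp (- s * t / (2 * (s + t)))) (s / (s + t)) x"
      unfolding \<mu>_def S_def packet_def[of "A * s / (s + t)"] .
  qed
qed

text \<open>Differentiating \<open>gauss_cos\<close> in the exponent \<open>a\<close> brings down
  the squared norm.\<close>

lemma gauss_norm_sq_cos:
  fixes k :: "real^2"
  assumes a: "a > 0"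
  shows "has_bochner_integral lborel (\<lambda>z. exp (- a * (norm z)\<^sup>2) * ((norm z)\<^sup>2 * cos (k \<bullet> z)))
    (pi / a\<^sup>2 * (1 - (norm k)\<^sup>2 / (4 * a)) * exp (- (norm k)\<^sup>2 / (4 * a)))"
proof -
  have int: "integrable lborel (\<lambda>z. exp (- a * (norm z)\<^sup>2) * ((norm z)\<^sup>2 * cos (k \<bullet> z)))"
  proof (rule integrable_gauss_bound[OF a, where C = 1])
    fix x :: "real^2"
    have "\<bar>(norm x)\<^sup>2 * cos (k \<bullet> x)\<bar> \<le> (norm x)\<^sup>2 * 1"
      unfolding abs_mult by (intro mult_mono) auto
    also have "\<dots> \<le> 1 * (1 + (norm x)\<^sup>2)\<^sup>2" by (simp add: power2_eq_square algebra_simps)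
    finally show "\<bar>(norm x)\<^sup>2 * cos (k \<bullet> x)\<bar> \<le> 1 * (1 + (norm x)\<^sup>2)\<^sup>2" .
  qed simp
  let ?h = "\<lambda>u z. exp (- u * (norm z)\<^sup>2) * cos (k \<bullet> z)"
  let ?h' = "\<lambda>u z. - (norm z)\<^sup>2 * exp (- u * (norm z)\<^sup>2) * cos (k \<bullet> z)"
  \<comment> \<open>On the half-line \<open>u > a / 2\<close> a Gaussian with exponent
    \<open>a / 2\<close> dominates all the derivatives at once.\<close>
  have "((\<lambda>u. \<integral>z. ?h u z \<partial>lborel) has_real_derivative (\<integral>z. ?h' a z \<partial>lborel)) (at a within {a/2<..})"
  proof (rule leibniz_dominated[where b = "\<lambda>z. exp (- (a / 2) * (norm z)\<^sup>2) * (1 + (norm z)\<^sup>2)\<^sup>2"])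
    show "((\<lambda>u. ?h u z) has_real_derivative ?h' u z) (at u within {a/2<..})" for u z
      by (auto intro!: derivative_eq_intros)
    show "\<bar>?h' u z\<bar> \<le> exp (- (a / 2) * (norm z)\<^sup>2) * (1 + (norm z)\<^sup>2)\<^sup>2" if "u \<in> {a/2<..}" for u and z :: "real^2"
    proof -
      have "\<bar>?h' u z\<bar> = exp (- u * (norm z)\<^sup>2) * ((norm z)\<^sup>2 * \<bar>cos (k \<bullet> z)\<bar>)" by (simp add: abs_mult)
      also have "\<dots> \<le> exp (- (a / 2) * (norm z)\<^sup>2) * ((norm z)\<^sup>2 * 1)"
        using that mult_right_mono[of "a / 2" u "(norm z)\<^sup>2"] by (intro mult_mono) auto
      also have "\<dots> \<le> exp (- (a / 2) * (norm z)\<^sup>2) * (1 + (norm z)\<^sup>2)\<^sup>2"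
        by (intro mult_left_mono) (auto simp: power2_eq_square algebra_simps)
      finally show ?thesis .
    qed
    show "integrable lborel (\<lambda>z::real^2. exp (- (a / 2) * (norm z)\<^sup>2) * (1 + (norm z)\<^sup>2)\<^sup>2)"
      using a by (intro integrable_gauss_weight) simp
    show "integrable lborel (?h u)" if "u \<in> {a/2<..}" for u
      using gauss_cos[of u k] that a by (auto simp: has_bochner_integral_iff)
  qed (use a in auto)
  then have "((\<lambda>u. \<integral>z. ?h u z \<partial>lborel) has_real_derivative (\<integral>z. ?h' a z \<partial>lborel)) (at a)"
    using a by (simp add: at_within_open[of a "{a/2<..}"])
  moreover have "((\<lambda>u. \<integral>z. ?h u z \<partial>lborel) has_real_derivative
     - (pi / a\<^sup>2 * (1 - (norm k)\<^sup>2 / (4 * a)) * exp (- (norm k)\<^sup>2 / (4 * a)))) (at a)"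
  proof (rule has_field_derivative_transform_within_open)
    show "((\<lambda>u. pi / u * exp (- (norm k)\<^sup>2 / (4 * u))) has_real_derivative
     - (pi / a\<^sup>2 * (1 - (norm k)\<^sup>2 / (4 * a)) * exp (- (norm k)\<^sup>2 / (4 * a)))) (at a)"
      using a by (auto intro!: derivative_eq_intros simp: field_simps power2_eq_square)
    show "pi / u * exp (- (norm k)\<^sup>2 / (4 * u)) = (\<integral>z. ?h u z \<partial>lborel)" if "u \<in> {0<..}" for u
      using gauss_cos[of u k] that by (simp add: has_bochner_integral_iff)
  qed (use a in auto)
  ultimately have "(\<integral>z. ?h' a z \<partial>lborel) = - (pi / a\<^sup>2 * (1 - (norm k)\<^sup>2 / (4 * a)) * exp (- (norm k)\<^sup>2 / (4 * a)))"
    by (rule DERIV_unique)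
  moreover have "(\<integral>z. ?h' a z \<partial>lborel) = (\<integral>z. - (exp (- a * (norm z)\<^sup>2) * ((norm z)\<^sup>2 * cos (k \<bullet> z))) \<partial>lborel)"
    by (intro Bochner_Integration.integral_cong) auto
  ultimately show ?thesis
    using int unfolding has_bochner_integral_iff by simp
qed

text \<open>Differentiating \<open>gauss_cos\<close> along the ray of wave vectors
  \<open>u *\<^sub>R k\<close> at \<open>u = 1\<close> brings down the inner product and turns the
  cosine into a sine.\<close>

lemma gauss_inner_sin:
  fixes k :: "real^2"
  assumes a: "a > 0"
  shows "has_bochner_integral lborel (\<lambda>z. exp (- a * (norm z)\<^sup>2) * ((k \<bullet> z) * sin (k \<bullet> z)))
    (pi / a * ((norm k)\<^sup>2 / (2 * a)) * exp (- (norm k)\<^sup>2 / (4 * a)))"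
proof -
  have kb: "\<bar>k \<bullet> z\<bar> \<le> norm k * (1 + (norm z)\<^sup>2)\<^sup>2" for z
  proof -
    have "norm z \<le> 1 + (norm z)\<^sup>2"
      using zero_le_power2[of "norm z - 1"] zero_le_power2[of "norm z"]
      unfolding power2_diff power_one by linarith
    also have "\<dots> \<le> (1 + (norm z)\<^sup>2)\<^sup>2" by (rule self_le_power) auto
    finally have "norm z \<le> (1 + (norm z)\<^sup>2)\<^sup>2" .
    then have "norm k * norm z \<le> norm k * (1 + (norm z)\<^sup>2)\<^sup>2" by (intro mult_left_mono) auto
    then show ?thesis using Cauchy_Schwarz_ineq2[of k z] by linarith
  qed
  have int: "integrable lborel (\<lambda>z. exp (- a * (norm z)\<^sup>2) * ((k \<bullet> z) * sin (k \<bullet> z)))"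
  proof (rule integrable_gauss_bound[OF a, where C = "norm k"])
    fix x :: "real^2"
    have "\<bar>(k \<bullet> x) * sin (k \<bullet> x)\<bar> \<le> \<bar>k \<bullet> x\<bar> * 1"
      unfolding abs_mult by (intro mult_mono) auto
    also have "\<dots> \<le> norm k * (1 + (norm x)\<^sup>2)\<^sup>2" using kb by simp
    finally show "\<bar>(k \<bullet> x) * sin (k \<bullet> x)\<bar> \<le> norm k * (1 + (norm x)\<^sup>2)\<^sup>2" .
  qed simp
  let ?h = "\<lambda>u z. exp (- a * (norm z)\<^sup>2) * cos ((u *\<^sub>R k) \<bullet> z)"
  let ?h' = "\<lambda>u z. - (exp (- a * (norm z)\<^sup>2) * ((k \<bullet> z) * sin ((u *\<^sub>R k) \<bullet> z)))"
  have "((\<lambda>u. \<integral>z. ?h u z \<partial>lborel) has_real_derivative (\<integral>z. ?h' 1 z \<partial>lborel)) (at 1)"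
  proof (rule leibniz_dominated[where b = "\<lambda>z. norm k * (exp (- a * (norm z)\<^sup>2) * (1 + (norm z)\<^sup>2)\<^sup>2)"])
    show "((\<lambda>u. ?h u z) has_real_derivative ?h' u z) (at u)" for u z
      by (auto intro!: derivative_eq_intros)
    show "\<bar>?h' u z\<bar> \<le> norm k * (exp (- a * (norm z)\<^sup>2) * (1 + (norm z)\<^sup>2)\<^sup>2)" for u z
    proof -
      have "\<bar>?h' u z\<bar> = exp (- a * (norm z)\<^sup>2) * (\<bar>k \<bullet> z\<bar> * \<bar>sin ((u *\<^sub>R k) \<bullet> z)\<bar>)" by (simp add: abs_mult)
      also have "\<dots> \<le> exp (- a * (norm z)\<^sup>2) * (norm k * (1 + (norm z)\<^sup>2)\<^sup>2 * 1)"
        by (intro mult_left_mono mult_mono kb) auto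
      finally show ?thesis by (simp add: mult_ac)
    qed
    show "integrable lborel (\<lambda>z::real^2. norm k * (exp (- a * (norm z)\<^sup>2) * (1 + (norm z)\<^sup>2)\<^sup>2))"
      using integrable_gauss_weight[OF a] by simp
    show "integrable lborel (?h u)" for u
      using gauss_cos[of a "u *\<^sub>R k"] a by (auto simp: has_bochner_integral_iff)
  qed auto
  moreover have "((\<lambda>u. \<integral>z. ?h u z \<partial>lborel) has_real_derivative
     - (pi / a * ((norm k)\<^sup>2 / (2 * a)) * exp (- (norm k)\<^sup>2 / (4 * a)))) (at 1)"
  proof -
    have eq: "(\<lambda>u. \<integral>z. ?h u z \<partial>lborel) = (\<lambda>u. pi / a * exp (- (u\<^sup>2 * (norm k)\<^sup>2) / (4 * a)))"
    proof
      fix u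
      show "(\<integral>z. ?h u z \<partial>lborel) = pi / a * exp (- (u\<^sup>2 * (norm k)\<^sup>2) / (4 * a))"
        using gauss_cos[OF a, of "u *\<^sub>R k"] by (simp add: has_bochner_integral_iff power_mult_distrib)
    qed
    show ?thesis
      unfolding eq using a by (auto intro!: derivative_eq_intros simp: field_simps power2_eq_square)
  qed
  ultimately have "(\<integral>z. ?h' 1 z \<partial>lborel) = - (pi / a * ((norm k)\<^sup>2 / (2 * a)) * exp (- (norm k)\<^sup>2 / (4 * a)))"
    by (rule DERIV_unique)
  then show ?thesis
    using int unfolding has_bochner_integral_iff by simp
qed

definition gradV_sq :: "real^2 \<Rightarrow> real" where
  "gradV_sq z = (\<Sum>i\<in>UNIV. (V1 i z)\<^sup>2)"

lemma gradV_sq_bound: "0 \<le> gradV_sq z" "gradV_sq z \<le> 18"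
proof -
  show "0 \<le> gradV_sq z" by (simp add: gradV_sq_def sum_nonneg)
  have "(V1 i z)\<^sup>2 \<le> 3\<^sup>2" for i using V1_bound[of i z] by (intro abs_le_square_iff[THEN iffD1]) simp
  from this[of 1] this[of 2] show "gradV_sq z \<le> 18" by (simp add: gradV_sq_def sum_2)
qed

lemma gradV_sq_measurable [measurable]: "gradV_sq \<in> borel_measurable borel"
  unfolding gradV_sq_def by measurable

lemma integrable_gauss_gradV:
  assumes "b > 0" "0 \<le> d" "d \<le> 1 / 10"
  shows "integrable lborel (\<lambda>z. exp (- b * (norm z)\<^sup>2) * (gradV_sq z / (1 + d * V z)))"
proof (rule integrable_gauss_bound[OF assms(1), where C = 30])
  fix x :: "real^2"
  have "\<bar>gradV_sq x / (1 + d * V x)\<bar> \<le> 18 / (7 / 10)"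
    using gradV_sq_bound[of x] one_plus_V_ge[OF assms(2,3), of x]
    unfolding abs_divide by (intro frac_le) auto
  also have "\<dots> \<le> 30 * 1" by simp
  also have "\<dots> \<le> 30 * (1 + (norm x)\<^sup>2)\<^sup>2"
    by (intro mult_left_mono one_le_power) auto
  finally show "\<bar>gradV_sq x / (1 + d * V x)\<bar> \<le> 30 * (1 + (norm x)\<^sup>2)\<^sup>2" .
qed simp

text \<open>The gradient is the sum of a part from the Gaussian and a part from the waves. After
  squaring, the denominator survives only in the square of the wave part; the other two terms have
  explicit Gaussian integrals.\<close>

lemma fisher_integrand_packet:
  assumes "A > 0" "0 \<le> d" "d \<le> 1 / 10"
  shows "fisher_integrand (packet A a d \<theta>) x = A * (exp (- a * (norm x)\<^sup>2) *
    (4 * a\<^sup>2 * (norm x)\<^sup>2 * (1 + d * V (\<theta> *\<^sub>R x)) - 4 * a * d * \<theta> * (\<Sum>i\<in>UNIV. x $ i * V1 i (\<theta> *\<^sub>R x))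
      + d\<^sup>2 * \<theta>\<^sup>2 * (gradV_sq (\<theta> *\<^sub>R x) / (1 + d * V (\<theta> *\<^sub>R x)))))"
proof -
  define q where "q = 1 + d * V (\<theta> *\<^sub>R x)"
  define w where "w = A * exp (- a * (norm x)\<^sup>2)"
  have q: "q > 0" using one_plus_V_ge[OF assms(2,3), of "\<theta> *\<^sub>R x"] by (simp add: q_def)
  have w: "w > 0" using assms by (simp add: w_def)
  have n: "(norm x)\<^sup>2 = (x $ 1)\<^sup>2 + (x $ 2)\<^sup>2"
    unfolding power2_norm_eq_inner inner_vec_def sum_2 by (simp add: power2_eq_square)
  have sq: "(w * (- 2 * a * y * q + d * \<theta> * p))\<^sup>2 / (w * q)
    = w * (4 * a\<^sup>2 * y\<^sup>2 * q - 4 * a * d * \<theta> * (y * p) + d\<^sup>2 * \<theta>\<^sup>2 * (p\<^sup>2 / q))" for y p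
  proof -
    have "(w * (X * q + Y))\<^sup>2 / (w * q) = w * (X\<^sup>2 * q + 2 * (X * Y) + Y\<^sup>2 / q)" for X Y
      using q w by (simp add: field_simps power2_eq_square)
    from this[of "- 2 * a * y" "d * \<theta> * p"] show ?thesis
      by (simp add: power_mult_distrib mult_ac)
  qed
  show ?thesis
    unfolding fisher_integrand_def pd_packet sum_2 add_divide_distrib gradV_sq_def
    unfolding packet_def mult.assoc[symmetric, of A]
    unfolding q_def[symmetric] w_def[symmetric] sq
    unfolding n
    by (simp add: algebra_simps add_divide_distrib)
qed

text \<open>
  Substituting \<open>z = \<theta> x\<close> removes \<open>\<theta>\<close>, hence the time, from the argument of \<open>V\<close>. Along the heat
  flow the exponent \<open>b\<close> is then affine in \<open>t\<close>, and differentiating in \<open>t\<close> never hits \<open>V\<close>.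
\<close>

lemma has_bochner_integral_fisher_packet:
  assumes "A > 0" "0 \<le> d" "d \<le> 1 / 10" "a > 0" "\<theta> > 0"
  defines "b \<equiv> a / \<theta>\<^sup>2"
  shows "has_bochner_integral lborel (fisher_integrand (packet A a d \<theta>))
    (A / \<theta>\<^sup>2 * (4 * a\<^sup>2 / \<theta>\<^sup>2 * (pi / b\<^sup>2) * (1 + 3 * d * (1 - 1 / (4 * b)) * exp (- 1 / (4 * b)))
      + 6 * a * d * (pi / b\<^sup>2) * exp (- 1 / (4 * b))
      + d\<^sup>2 * \<theta>\<^sup>2 * (\<integral>z. exp (- b * (norm z)\<^sup>2) * (gradV_sq z / (1 + d * V z)) \<partial>lborel)))"
    (is "has_bochner_integral lborel _ (A / \<theta>\<^sup>2 * ?val)")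
proof -
  have b: "b > 0" using assms by (simp add: b_def)
  let ?J = "\<lambda>z. exp (- b * (norm z)\<^sup>2) * (gradV_sq z / (1 + d * V z))"
  \<comment> \<open>The radial derivative of \<open>V\<close> splits wave by wave, so the cross term
    becomes a sum of integrals as in \<open>gauss_inner_sin\<close>.\<close>
  have xV1: "(\<Sum>i\<in>UNIV. z $ i * V1 i z) = - (\<Sum>m\<in>UNIV. (wavevec m \<bullet> z) * sin (wavevec m \<bullet> z))" for z
    by (simp add: V1_def inner_vec_def sum_2 sum_3 algebra_simps)
  have J: "has_bochner_integral lborel ?J (\<integral>z. ?J z \<partial>lborel)"
    by (intro has_bochner_integral_integrable integrable_gauss_gradV assms b)
  have 1: "has_bochner_integral lborel
     (\<lambda>z. 4 * a\<^sup>2 / \<theta>\<^sup>2 * (exp (- b * (norm z)\<^sup>2) * ((norm z)\<^sup>2 * cos (0 \<bullet> z))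
         + d * (\<Sum>m\<in>UNIV. exp (- b * (norm z)\<^sup>2) * ((norm z)\<^sup>2 * cos (wavevec m \<bullet> z))))
       + 4 * a * d * (\<Sum>m\<in>UNIV. exp (- b * (norm z)\<^sup>2) * ((wavevec m \<bullet> z) * sin (wavevec m \<bullet> z)))
       + d\<^sup>2 * \<theta>\<^sup>2 * ?J z)
     (4 * a\<^sup>2 / \<theta>\<^sup>2 * (pi / b\<^sup>2 * (1 - (norm (0::real^2))\<^sup>2 / (4 * b)) * exp (- (norm (0::real^2))\<^sup>2 / (4 * b))
         + d * (\<Sum>m\<in>UNIV. pi / b\<^sup>2 * (1 - (norm (wavevec m))\<^sup>2 / (4 * b)) * exp (- (norm (wavevec m))\<^sup>2 / (4 * b))))
       + 4 * a * d * (\<Sum>m\<in>UNIV. pi / b * ((norm (wavevec m))\<^sup>2 / (2 * b)) * exp (- (norm (wavevec m))\<^sup>2 / (4 * b)))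
       + d\<^sup>2 * \<theta>\<^sup>2 * (\<integral>z. ?J z \<partial>lborel))"
    by (rule has_bochner_integral_add, rule has_bochner_integral_add,
        rule has_bochner_integral_mult_right, rule has_bochner_integral_add,
        rule gauss_norm_sq_cos[OF b], rule has_bochner_integral_mult_right,
        rule has_bochner_integral_sum, rule gauss_norm_sq_cos[OF b],
        rule has_bochner_integral_mult_right, rule has_bochner_integral_sum,
        rule gauss_inner_sin[OF b], rule has_bochner_integral_mult_right, rule J)
  have 2: "fisher_integrand (packet A a d \<theta>) (0 + (1 / \<theta>) *\<^sub>R z) =
      A * (4 * a\<^sup>2 / \<theta>\<^sup>2 * (exp (- b * (norm z)\<^sup>2) * ((norm z)\<^sup>2 * cos (0 \<bullet> z))
         + d * (\<Sum>m\<in>UNIV. exp (- b * (norm z)\<^sup>2) * ((norm z)\<^sup>2 * cos (wavevec m \<bullet> z))))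
       + 4 * a * d * (\<Sum>m\<in>UNIV. exp (- b * (norm z)\<^sup>2) * ((wavevec m \<bullet> z) * sin (wavevec m \<bullet> z)))
       + d\<^sup>2 * \<theta>\<^sup>2 * ?J z)" for z
  proof -
    have n: "(norm (z /\<^sub>R \<theta>))\<^sup>2 = (norm z)\<^sup>2 / \<theta>\<^sup>2"
    proof -
      have "norm (z /\<^sub>R \<theta>) = norm z / \<theta>"
        using assms(5) by (simp add: divide_inverse_commute)
      then show ?thesis by (simp add: power_divide)
    qed
    have e: "- a * (norm (z /\<^sub>R \<theta>))\<^sup>2 = - b * (norm z)\<^sup>2"
      unfolding n by (simp add: b_def)
    have x: "\<theta> * (\<Sum>i\<in>UNIV. (z /\<^sub>R \<theta>) $ i * V1 i z) = (\<Sum>i\<in>UNIV. z $ i * V1 i z)"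
      using assms(5) by (simp add: sum_2 distrib_left mult.assoc[symmetric])
    have \<theta>z: "\<theta> *\<^sub>R (z /\<^sub>R \<theta>) = z" using assms by simp
    have "fisher_integrand (packet A a d \<theta>) (z /\<^sub>R \<theta>)
      = A * (exp (- b * (norm z)\<^sup>2) * (4 * a\<^sup>2 * ((norm z)\<^sup>2 / \<theta>\<^sup>2) * (1 + d * V z)
        - 4 * a * d * (\<Sum>i\<in>UNIV. z $ i * V1 i z) + d\<^sup>2 * \<theta>\<^sup>2 * (gradV_sq z / (1 + d * V z))))"
      unfolding fisher_integrand_packet[OF assms(1-3)] \<theta>z e
      unfolding n
      by (simp only: mult.assoc[of "4 * a * d" \<theta>] x)
    also have "\<dots> = A * (exp (- b * (norm z)\<^sup>2) * (4 * a\<^sup>2 / \<theta>\<^sup>2 * (norm z)\<^sup>2 * (1 + d * V z)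
        + 4 * a * d * (\<Sum>m\<in>UNIV. (wavevec m \<bullet> z) * sin (wavevec m \<bullet> z)) + d\<^sup>2 * \<theta>\<^sup>2 * (gradV_sq z / (1 + d * V z))))"
      unfolding xV1 by simp
    finally have F: "fisher_integrand (packet A a d \<theta>) (z /\<^sub>R \<theta>) = \<dots>" .
    have alg: "A * (g * (K * n * (1 + d * (c1 + c2 + c3)) + L * (p1 + p2 + p3) + M * j))
      = A * (K * (g * (n * 1) + d * (g * (n * c1) + g * (n * c2) + g * (n * c3)))
        + L * (g * p1 + g * p2 + g * p3) + M * (g * j))" for g K n c1 c2 c3 L p1 p2 p3 M j
      by (simp add: algebra_simps)
    have "0 + (1 / \<theta>) *\<^sub>R z = z /\<^sub>R \<theta>" by (simp add: divide_inverse)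
    then show ?thesis
      unfolding inner_zero_left cos_zero sum_3 alg[symmetric]
      by (simp only: F V_def sum_3)
  qed
  have "pi / b * (1 / (2 * b)) = pi / b\<^sup>2 / 2" by (simp add: power2_eq_square)
  then have val: "4 * a\<^sup>2 / \<theta>\<^sup>2 * (pi / b\<^sup>2 * (1 - (norm (0::real^2))\<^sup>2 / (4 * b)) * exp (- (norm (0::real^2))\<^sup>2 / (4 * b))
         + d * (\<Sum>m\<in>UNIV. pi / b\<^sup>2 * (1 - (norm (wavevec m))\<^sup>2 / (4 * b)) * exp (- (norm (wavevec m))\<^sup>2 / (4 * b))))
       + 4 * a * d * (\<Sum>m\<in>UNIV. pi / b * ((norm (wavevec m))\<^sup>2 / (2 * b)) * exp (- (norm (wavevec m))\<^sup>2 / (4 * b)))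
       + d\<^sup>2 * \<theta>\<^sup>2 * (\<integral>z. ?J z \<partial>lborel) = ?val"
    by (simp only: norm_wavevec sum_3 norm_zero power_one zero_power2) (simp add: distrib_left mult_ac)
  define W where "W = ?val"
  note 1 = 1[unfolded val, folded W_def]
  have "has_bochner_integral lborel (\<lambda>z. fisher_integrand (packet A a d \<theta>) (0 + (1 / \<theta>) *\<^sub>R z)) (A * W)"
    by (subst 2) (rule has_bochner_integral_mult_right[OF 1])
  from has_bochner_integral_lborel_affine[OF this, of \<theta> 0] assms(5)
  have "has_bochner_integral lborel (fisher_integrand (packet A a d \<theta>)) (A / \<theta>\<^sup>2 * W)"
    by (simp add: divide_inverse_commute mult.assoc)
  then show ?thesis unfolding W_def .
qed

section \<open>Time derivatives of the Fisher information\<close>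

text \<open>The amplitude found in \<open>heat_packet\<close>; it tends to the torus value
  \<open>e * exp (- t / 2)\<close> as \<open>s\<close> grows. \<open>amp1\<close> and
  \<open>amp2\<close> are its time derivatives.\<close>

definition amp :: "real \<Rightarrow> real \<Rightarrow> real \<Rightarrow> real" where
  "amp s e t = e * exp (- s * t / (2 * (s + t)))"
definition amp1 :: "real \<Rightarrow> real \<Rightarrow> real \<Rightarrow> real" where
  "amp1 s e t = - s\<^sup>2 / (2 * (s + t)\<^sup>2) * amp s e t"
definition amp2 :: "real \<Rightarrow> real \<Rightarrow> real \<Rightarrow> real" where
  "amp2 s e t = (s^4 / (4 * (s + t)^4) + s\<^sup>2 / (s + t)^3) * amp s e t"

text \<open>\<open>ratio1\<close> and \<open>ratio2\<close> are the first two derivatives of \<open>ratio v\<close>.\<close>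

definition ratio :: "real \<Rightarrow> real \<Rightarrow> real" where
  "ratio v d = d\<^sup>2 / (1 + d * v)"
definition ratio1 :: "real \<Rightarrow> real \<Rightarrow> real" where
  "ratio1 v d = (2 * d + d\<^sup>2 * v) / (1 + d * v)\<^sup>2"
definition ratio2 :: "real \<Rightarrow> real \<Rightarrow> real" where
  "ratio2 v d = 2 / (1 + d * v)^3"

text \<open>
  \<open>dens1\<close> and \<open>dens2\<close> are what the first two time derivatives of the product of \<open>dens\<close> with the
  Gaussian in \<open>gauss_int\<close> leave in front of that Gaussian.
\<close>

definition dens :: "real \<Rightarrow> real \<Rightarrow> real \<Rightarrow> real^2 \<Rightarrow> real" where
  "dens s e t z = gradV_sq z * ratio (V z) (amp s e t)"
definition dens1 :: "real \<Rightarrow> real \<Rightarrow> real \<Rightarrow> real^2 \<Rightarrow> real" where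
  "dens1 s e t z = gradV_sq z *
    (- ((norm z)\<^sup>2 / (2 * s\<^sup>2)) * ratio (V z) (amp s e t) + amp1 s e t * ratio1 (V z) (amp s e t))"
definition dens2 :: "real \<Rightarrow> real \<Rightarrow> real \<Rightarrow> real^2 \<Rightarrow> real" where
  "dens2 s e t z = gradV_sq z *
    (((norm z)\<^sup>2 / (2 * s\<^sup>2))\<^sup>2 * ratio (V z) (amp s e t)
      - (norm z)\<^sup>2 / s\<^sup>2 * (amp1 s e t * ratio1 (V z) (amp s e t))
      + amp2 s e t * ratio1 (V z) (amp s e t) + (amp1 s e t)\<^sup>2 * ratio2 (V z) (amp s e t))"

text \<open>The exponent is \<open>1 / (2 * (s + t))\<close> divided by the square of the dilation
  \<open>s / (s + t)\<close>.\<close>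

definition gauss_int :: "real \<Rightarrow> real \<Rightarrow> (real^2 \<Rightarrow> real) \<Rightarrow> real" where
  "gauss_int s t h = (\<integral>z. exp (- ((s + t) / (2 * s\<^sup>2)) * (norm z)\<^sup>2) * h z \<partial>lborel)"

lemma amp_bounds:
  assumes "s > 0" "t \<ge> 0" "0 \<le> e" "e \<le> 1 / 10"
  shows "0 \<le> amp s e t" "amp s e t \<le> 1 / 10"
proof -
  show "0 \<le> amp s e t" using assms by (simp add: amp_def)
  have "exp (- s * t / (2 * (s + t))) \<le> 1" using assms by (simp add: divide_nonpos_pos)
  then have "e * exp (- s * t / (2 * (s + t))) \<le> 1 / 10 * 1"
    using assms by (intro mult_mono) auto
  then show "amp s e t \<le> 1 / 10" by (simp add: amp_def)
qed

lemma has_bochner_integral_fisher_flow: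
  assumes "s > 0" "t \<ge> 0" "0 \<le> e" "e \<le> 1 / 10" "A > 0"
  shows "has_bochner_integral lborel (fisher_integrand (heat t (packet A (1 / (2 * s)) e 1)))
    (2 * pi * s * A * (2 / (s + t) + 3 * e * exp (- s / 2) * (2 / (s + t) + s\<^sup>2 / (s + t)\<^sup>2)
      + gauss_int s t (dens s e t) / (2 * pi * (s + t))))"
proof -
  define S where "S = s + t"
  define b where "b = S / (2 * s\<^sup>2)"
  define D where "D = amp s e t"
  define E where "E = exp (- (s\<^sup>2 / (2 * S)))"
  define J where "J = (\<integral>z. exp (- b * (norm z)\<^sup>2) * (gradV_sq z / (1 + D * V z)) \<partial>lborel)"
  have S: "S > 0" using assms by (simp add: S_def)
  have D: "0 \<le> D" "D \<le> 1 / 10" using amp_bounds[OF assms(1-4)] by (auto simp: D_def)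
  have b': "1 / (2 * S) / (s / S)\<^sup>2 = b"
    using S assms by (simp add: b_def field_simps power2_eq_square)
  have E: "exp (- 1 / (4 * b)) = E" using S assms by (simp add: b_def E_def power2_eq_square)
  \<comment> \<open>The damping of the waves and the decay of their Gaussian mean compensate each
    other exactly: this product is the contribution of one wave to the total mass, up to
    normalisation, and the heat flow conserves it. What is left is exponentially small in
    \<open>s\<close>.\<close>
  have DE: "D * E = e * exp (- s / 2)"
  proof -
    have "- s * t / (2 * S) + - (s\<^sup>2 / (2 * S)) = - (s * (s + t)) / (2 * S)"
      using S by (simp add: field_simps power2_eq_square)
    also have "\<dots> = - s / 2" using S by (simp add: S_def[symmetric])
    finally show ?thesis
      unfolding D_def amp_def E_def S_def[symmetric] by (simp only: mult.assoc exp_add[symmetric])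
  qed
  have gauss_int: "gauss_int s t (dens s e t) = D\<^sup>2 * J"
  proof -
    have "gauss_int s t (dens s e t) = (\<integral>z. D\<^sup>2 * (exp (- b * (norm z)\<^sup>2) * (gradV_sq z / (1 + D * V z))) \<partial>lborel)"
      unfolding gauss_int_def dens_def ratio_def D_def[symmetric] S_def[symmetric] b_def[symmetric]
      by (intro Bochner_Integration.integral_cong) auto
    then show ?thesis by (simp only: J_def integral_mult_right_zero)
  qed
  have "A * s / S / (s / S)\<^sup>2 * (4 * (1 / (2 * S))\<^sup>2 / (s / S)\<^sup>2 * (pi / b\<^sup>2) * (1 + 3 * D * (1 - 1 / (4 * b)) * E)
      + 6 * (1 / (2 * S)) * D * (pi / b\<^sup>2) * E + D\<^sup>2 * (s / S)\<^sup>2 * J)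
    = 2 * pi * s * A * (2 / S + 3 * (D * E) * (2 / S + s\<^sup>2 / S\<^sup>2) + D\<^sup>2 * J / (2 * pi * S))"
    using S assms(1) by (simp add: b_def divide_simps power2_eq_square) (simp add: algebra_simps)
  then have val: "A * s / S / (s / S)\<^sup>2 * (4 * (1 / (2 * S))\<^sup>2 / (s / S)\<^sup>2 * (pi / b\<^sup>2) * (1 + 3 * D * (1 - 1 / (4 * b)) * E)
      + 6 * (1 / (2 * S)) * D * (pi / b\<^sup>2) * E + D\<^sup>2 * (s / S)\<^sup>2 * J)
    = 2 * pi * s * A * (2 / S + 3 * e * exp (- s / 2) * (2 / S + s\<^sup>2 / S\<^sup>2) + D\<^sup>2 * J / (2 * pi * S))"
    unfolding DE by (simp only: mult.assoc)
  have pos: "A * s / S > 0" "1 / (2 * S) > 0" "s / S > 0" using assms S by auto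
  show ?thesis
    using has_bochner_integral_fisher_packet[OF pos(1) D pos(2,3)]
    unfolding b' E J_def[symmetric] val heat_packet[OF assms(1,2)] gauss_int
    unfolding S_def[symmetric] D_def amp_def by simp
qed

lemma amp_deriv:
  assumes "s > 0" "t \<ge> 0"
  shows "(amp s e has_real_derivative amp1 s e t) (at t within T)"
    and "(amp1 s e has_real_derivative amp2 s e t) (at t within T)"
proof -
  have nz: "s + t \<noteq> 0" using assms by simp
  have d: "((\<lambda>t. - s * t / (2 * (s + t))) has_real_derivative - s\<^sup>2 / (2 * (s + t)\<^sup>2)) (at t within T)"
    using nz by (auto intro!: derivative_eq_intros simp: divide_simps) (simp add: power2_eq_square algebra_simps)
  show 1: "(amp s e has_real_derivative amp1 s e t) (at t within T)"
    unfolding amp_def[abs_def] amp1_def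
    by (rule derivative_eq_intros d refl)+ simp
  have d2: "((\<lambda>t. - s\<^sup>2 / (2 * (s + t)\<^sup>2)) has_real_derivative s\<^sup>2 / (s + t)^3) (at t within T)"
    using nz by (auto intro!: derivative_eq_intros simp: divide_simps)
      (simp add: power2_eq_square power3_eq_cube power4_eq_xxxx algebra_simps)
  have sq: "s^4 / (4 * (s + t)^4) = - s\<^sup>2 / (2 * (s + t)\<^sup>2) * (- s\<^sup>2 / (2 * (s + t)\<^sup>2))"
    by (simp add: power2_eq_square power4_eq_xxxx mult.assoc)
  show "(amp1 s e has_real_derivative amp2 s e t) (at t within T)"
    unfolding amp1_def[abs_def] amp2_def
    by (rule DERIV_cong[OF DERIV_mult[OF d2 1]]) (simp only: amp1_def sq distrib_right distrib_left mult_ac add.commute)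
qed

lemma amp1_bound:
  assumes "s \<ge> 1" "t \<ge> 0" "0 \<le> e" "e \<le> 1 / 10"
  shows "\<bar>amp1 s e t\<bar> \<le> 1"
proof -
  have "s\<^sup>2 \<le> (s + t)\<^sup>2" using assms by (intro power_mono) auto
  then have "s\<^sup>2 \<le> 1 * (2 * (s + t)\<^sup>2)" using zero_le_power2[of "s + t"] by linarith
  moreover have "0 < 2 * (s + t)\<^sup>2" using assms by simp
  ultimately have "s\<^sup>2 / (2 * (s + t)\<^sup>2) \<le> 1" by (simp only: pos_divide_le_eq)
  then have "s\<^sup>2 / (2 * (s + t)\<^sup>2) * amp s e t \<le> 1 * 1"
    using amp_bounds[of s t e] assms by (intro mult_mono) auto
  then show ?thesis using amp_bounds[of s t e] assms by (simp add: amp1_def abs_mult)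
qed

lemma amp2_bound:
  assumes "s \<ge> 1" "t \<ge> 0" "0 \<le> e" "e \<le> 1 / 10"
  shows "\<bar>amp2 s e t\<bar> \<le> 1"
proof -
  have "s^4 \<le> (s + t)^4" using assms by (intro power_mono) auto
  moreover have "0 \<le> (s + t)^4" by simp
  ultimately have "s^4 \<le> 1 * (4 * (s + t)^4)" by linarith
  moreover have "0 < 4 * (s + t)^4" using assms by simp
  ultimately have 1: "s^4 / (4 * (s + t)^4) \<le> 1" by (simp only: pos_divide_le_eq)
  have "s\<^sup>2 * 1 \<le> (s + t)\<^sup>2 * (s + t)" using assms by (intro mult_mono power_mono) auto
  then have 2: "s\<^sup>2 / (s + t)^3 \<le> 1" using assms by (simp add: divide_le_eq power2_eq_square power3_eq_cube)
  have "(s^4 / (4 * (s + t)^4) + s\<^sup>2 / (s + t)^3) * amp s e t \<le> 2 * (1 / 10)"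
  proof (rule mult_mono)
    show "s^4 / (4 * (s + t)^4) + s\<^sup>2 / (s + t)^3 \<le> 2" using 1 2 by linarith
  qed (use amp_bounds[of s t e] assms in auto)
  then have "(s^4 / (4 * (s + t)^4) + s\<^sup>2 / (s + t)^3) * amp s e t \<le> 1" by linarith
  moreover have "\<bar>s^4 / (4 * (s + t)^4) + s\<^sup>2 / (s + t)^3\<bar> = s^4 / (4 * (s + t)^4) + s\<^sup>2 / (s + t)^3"
    using assms by simp
  ultimately show ?thesis using amp_bounds[of s t e] assms by (simp only: amp2_def abs_mult abs_of_nonneg)
qed

lemma ratio_deriv:
  assumes "(\<delta> has_real_derivative \<delta>') (at t within T)" "1 + \<delta> t * v \<noteq> 0"
  shows "((\<lambda>t. ratio v (\<delta> t)) has_real_derivative \<delta>' * ratio1 v (\<delta> t)) (at t within T)"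
    and "((\<lambda>t. ratio1 v (\<delta> t)) has_real_derivative \<delta>' * ratio2 v (\<delta> t)) (at t within T)"
  unfolding ratio_def ratio1_def ratio2_def
  by (use assms(2) in \<open>auto intro!: derivative_eq_intros assms(1) simp: divide_simps\<close>)
    (simp_all add: power2_eq_square power3_eq_cube power4_eq_xxxx algebra_simps)

lemma ratio_bounds:
  assumes "0 \<le> d" "d \<le> 1 / 10"
  shows "\<bar>ratio (V z) d\<bar> \<le> 1" "\<bar>ratio1 (V z) d\<bar> \<le> 1" "\<bar>ratio2 (V z) d\<bar> \<le> 6"
proof -
  let ?q = "1 + d * V z"
  have q: "?q \<ge> 7 / 10" using one_plus_V_ge[OF assms] .
  have d2: "d\<^sup>2 \<le> 1 / 100" using power_mono[OF assms(2,1), of 2] by (simp add: power_divide)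
  show "\<bar>ratio (V z) d\<bar> \<le> 1"
    using q d2 by (simp add: ratio_def abs_divide divide_le_eq)
  have q2: "?q\<^sup>2 \<ge> 49 / 100" using power_mono[OF q, of 2] by (simp add: power_divide)
  have "\<bar>d\<^sup>2 * V z\<bar> \<le> 1 / 100 * 3"
    unfolding abs_mult using d2 V_bound[of z] by (intro mult_mono) auto
  then have "\<bar>2 * d + d\<^sup>2 * V z\<bar> \<le> 49 / 100" using assms by linarith
  then show "\<bar>ratio1 (V z) d\<bar> \<le> 1"
    using q q2 by (simp add: ratio1_def abs_divide divide_le_eq)
  have "?q^3 \<ge> 343 / 1000" using power_mono[OF q, of 3] by (simp add: power_divide)
  then show "\<bar>ratio2 (V z) d\<bar> \<le> 6"
    using q by (simp add: ratio2_def abs_divide divide_le_eq)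
qed

text \<open>The bounds do not depend on \<open>t\<close>, as domination requires. For
  \<open>dens2\<close>, with \<open>n\<close> the squared norm, 18 bounds \<open>gradV_sq\<close>
  and \<open>n^2 + n + 7\<close> bounds the bracket, which is at most nine times the weight; 200 is
  162 rounded up, used for all three.\<close>

lemma dens_bounds:
  assumes "s \<ge> 1" "t \<ge> 0" "0 \<le> e" "e \<le> 1 / 10"
  shows "\<bar>dens s e t z\<bar> \<le> 200 * (1 + (norm z)\<^sup>2)\<^sup>2"
    "\<bar>dens1 s e t z\<bar> \<le> 200 * (1 + (norm z)\<^sup>2)\<^sup>2"
    "\<bar>dens2 s e t z\<bar> \<le> 200 * (1 + (norm z)\<^sup>2)\<^sup>2"
proof -
  define n where "n = (norm z)\<^sup>2"
  have n: "n \<ge> 0" by (simp add: n_def)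
  define D where "D = amp s e t"
  have D: "0 \<le> D" "D \<le> 1 / 10" using amp_bounds[of s t e] assms by (auto simp: D_def)
  note r = ratio_bounds[OF D, of z]
  note a1 = amp1_bound[OF assms] and a2 = amp2_bound[OF assms]
  have g: "\<bar>gradV_sq z\<bar> \<le> 18" using gradV_sq_bound[of z] by simp
  have s: "1 \<le> s\<^sup>2" using assms by simp
  have ns: "n / (2 * s\<^sup>2) \<le> n" "n / s\<^sup>2 \<le> n" "0 \<le> n / (2 * s\<^sup>2)" "0 \<le> n / s\<^sup>2"
    using s n mult_mono[of 1 "s\<^sup>2" n n] by (auto simp: divide_le_eq mult.commute intro: order_trans)
  have prod: "\<bar>x * y\<bar> \<le> a * b" if "\<bar>x\<bar> \<le> a" "\<bar>y\<bar> \<le> b" for x y a b :: real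
    unfolding abs_mult using that by (intro mult_mono) auto
  have w: "(1 + n)\<^sup>2 = 1 + 2 * n + n\<^sup>2" by (simp add: power2_eq_square algebra_simps)
  define W where "W = (1 + n)\<^sup>2"
  have w1: "1 \<le> (1 + n)\<^sup>2" "n \<le> (1 + n)\<^sup>2" "n\<^sup>2 \<le> (1 + n)\<^sup>2" "0 \<le> n\<^sup>2" using n by (auto simp: w)
  note w1 = w1[folded W_def]
  have t11: "\<bar>amp1 s e t * ratio1 (V z) D\<bar> \<le> 1 * 1" by (intro prod a1 r)
  have t0: "\<bar>dens s e t z\<bar> \<le> 18 * 1"
    unfolding dens_def D_def[symmetric] by (intro prod g r)
  then show "\<bar>dens s e t z\<bar> \<le> 200 * (1 + (norm z)\<^sup>2)\<^sup>2" using w1 unfolding n_def[symmetric] W_def[symmetric] by linarith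
  have "\<bar>- (n / (2 * s\<^sup>2)) * ratio (V z) D\<bar> \<le> n * 1" using ns by (intro prod r) auto
  then have "\<bar>- (n / (2 * s\<^sup>2)) * ratio (V z) D + amp1 s e t * ratio1 (V z) D\<bar> \<le> n + 1"
    using t11 by linarith
  then have "\<bar>dens1 s e t z\<bar> \<le> 18 * (n + 1)"
    unfolding dens1_def D_def[symmetric] n_def[symmetric] by (intro prod g)
  moreover have "18 * (n + 1) \<le> 200 * W" using w1(1,2) by simp
  ultimately have "\<bar>dens1 s e t z\<bar> \<le> 200 * W" by (rule order_trans)
  then show "\<bar>dens1 s e t z\<bar> \<le> 200 * (1 + (norm z)\<^sup>2)\<^sup>2" unfolding n_def[symmetric] W_def[symmetric] .
  have u1: "\<bar>(n / (2 * s\<^sup>2))\<^sup>2 * ratio (V z) D\<bar> \<le> n\<^sup>2 * 1"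
    using ns power_mono[of "n / (2 * s\<^sup>2)" n 2] by (intro prod r) auto
  have u2: "\<bar>n / s\<^sup>2 * (amp1 s e t * ratio1 (V z) D)\<bar> \<le> n * 1" using ns t11 by (intro prod) auto
  have u3: "\<bar>amp2 s e t * ratio1 (V z) D\<bar> \<le> 1 * 1" by (intro prod a2 r)
  have u4: "\<bar>(amp1 s e t)\<^sup>2 * ratio2 (V z) D\<bar> \<le> 1 * 6"
    using a1 by (intro prod r) (simp add: power_le_one abs_square_le_1)
  have "\<bar>(n / (2 * s\<^sup>2))\<^sup>2 * ratio (V z) D - n / s\<^sup>2 * (amp1 s e t * ratio1 (V z) D)
      + amp2 s e t * ratio1 (V z) D + (amp1 s e t)\<^sup>2 * ratio2 (V z) D\<bar> \<le> n\<^sup>2 + n + 7"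
    using u1 u2 u3 u4 by linarith
  then have "\<bar>dens2 s e t z\<bar> \<le> 18 * (n\<^sup>2 + n + 7)"
    unfolding dens2_def D_def[symmetric] n_def[symmetric] by (intro prod g)
  moreover have "18 * (n\<^sup>2 + n + 7) \<le> 200 * W" using w1 by simp
  ultimately have "\<bar>dens2 s e t z\<bar> \<le> 200 * W" by (rule order_trans)
  then show "\<bar>dens2 s e t z\<bar> \<le> 200 * (1 + (norm z)\<^sup>2)\<^sup>2" unfolding n_def[symmetric] W_def[symmetric] .
qed

lemma dens_measurable [measurable]:
  "dens s e t \<in> borel_measurable borel" "dens1 s e t \<in> borel_measurable borel"
  "dens2 s e t \<in> borel_measurable borel"
  unfolding dens_def dens1_def dens2_def ratio_def ratio1_def ratio2_def by measurable

lemma dens_deriv: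
  assumes "s \<ge> 1" "t \<ge> 0" "0 \<le> e" "e \<le> 1 / 10"
  defines "G \<equiv> \<lambda>t z. exp (- ((s + t) / (2 * s\<^sup>2)) * (norm z)\<^sup>2)"
  shows "((\<lambda>t. G t z * dens s e t z) has_real_derivative G t z * dens1 s e t z) (at t within T)"
    and "((\<lambda>t. G t z * dens1 s e t z) has_real_derivative G t z * dens2 s e t z) (at t within T)"
proof -
  have s: "s > 0" using assms by simp
  have nz: "1 + amp s e t * V z \<noteq> 0"
    using one_plus_V_ge[of "amp s e t" z] amp_bounds[of s t e] assms by auto
  define n where "n = (norm z)\<^sup>2"
  have "((\<lambda>t. - ((s + t) / (2 * s\<^sup>2)) * n) has_real_derivative - (n / (2 * s\<^sup>2))) (at t within T)"
    using s by (auto intro!: derivative_eq_intros simp: field_simps power2_eq_square power4_eq_xxxx)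
  from DERIV_chain2[OF DERIV_exp this]
  have G: "((\<lambda>t. G t z) has_real_derivative G t z * - (n / (2 * s\<^sup>2))) (at t within T)"
    unfolding G_def n_def .
  note a = amp_deriv[OF s assms(2), of e T]
  note r = ratio_deriv[OF a(1) nz]
  show "((\<lambda>t. G t z * dens s e t z) has_real_derivative G t z * dens1 s e t z) (at t within T)"
    unfolding dens_def dens1_def n_def[symmetric]
    by (rule derivative_eq_intros G r refl)+ (simp add: algebra_simps)
  show "((\<lambda>t. G t z * dens1 s e t z) has_real_derivative G t z * dens2 s e t z) (at t within T)"
    unfolding dens1_def dens2_def n_def[symmetric]
    by (rule derivative_eq_intros G r a refl)+ (simp add: power2_eq_square algebra_simps)
qed

text \<open>In the rescaled variable the Gaussian is widest at time zero, so that one serves as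
  dominator for all later times.\<close>

lemma gauss_int_weight_le:
  assumes "s \<ge> 1" "t \<ge> 0" "\<bar>h z\<bar> \<le> 200 * (1 + (norm z)\<^sup>2)\<^sup>2"
  shows "\<bar>exp (- ((s + t) / (2 * s\<^sup>2)) * (norm z)\<^sup>2) * h z\<bar>
    \<le> 200 * (exp (- (s / (2 * s\<^sup>2)) * (norm z)\<^sup>2) * (1 + (norm (z::real^2))\<^sup>2)\<^sup>2)"
proof -
  have "s / (2 * s\<^sup>2) * (norm z)\<^sup>2 \<le> (s + t) / (2 * s\<^sup>2) * (norm z)\<^sup>2"
    using assms by (intro mult_right_mono divide_right_mono) auto
  then have "\<bar>exp (- ((s + t) / (2 * s\<^sup>2)) * (norm z)\<^sup>2) * h z\<bar>
    \<le> exp (- (s / (2 * s\<^sup>2)) * (norm z)\<^sup>2) * (200 * (1 + (norm z)\<^sup>2)\<^sup>2)"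
    unfolding abs_mult using assms(3) by (intro mult_mono) auto
  then show ?thesis by (simp only: mult.left_commute)
qed

lemma gauss_int_integrable:
  fixes h :: "real^2 \<Rightarrow> real"
  assumes "s > 0" "t \<ge> 0" "h \<in> borel_measurable borel" "\<And>z. \<bar>h z\<bar> \<le> C * (1 + (norm z)\<^sup>2)\<^sup>2"
  shows "integrable lborel (\<lambda>z. exp (- ((s + t) / (2 * s\<^sup>2)) * (norm z)\<^sup>2) * h z)"
  by (rule integrable_gauss_bound[OF _ assms(3), where C = C]) (use assms in auto)

lemma gauss_int_dens_deriv:
  assumes "s \<ge> 1" "t \<ge> 0" "0 \<le> e" "e \<le> 1 / 10"
  shows "((\<lambda>t. gauss_int s t (dens s e t)) has_real_derivative gauss_int s t (dens1 s e t)) (at t within {0..})"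
    and "((\<lambda>t. gauss_int s t (dens1 s e t)) has_real_derivative gauss_int s t (dens2 s e t)) (at t within {0..})"
proof -
  have s: "s > 0" using assms by simp
  have w: "integrable lborel (\<lambda>z::real^2. 200 * (exp (- (s / (2 * s\<^sup>2)) * (norm z)\<^sup>2) * (1 + (norm z)\<^sup>2)\<^sup>2))"
    using s by (intro integrable_mult_right integrable_gauss_weight) auto
  show "((\<lambda>t. gauss_int s t (dens s e t)) has_real_derivative gauss_int s t (dens1 s e t)) (at t within {0..})"
    unfolding gauss_int_def
  proof (rule leibniz_dominated[OF _ _ _ _ w])
    fix u :: real and z :: "real^2" assume "u \<in> {0..}"
    then have u: "u \<ge> 0" by simp
    show "((\<lambda>u. exp (- ((s + u) / (2 * s\<^sup>2)) * (norm z)\<^sup>2) * dens s e u z) has_real_derivative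
      exp (- ((s + u) / (2 * s\<^sup>2)) * (norm z)\<^sup>2) * dens1 s e u z) (at u within {0..})"
      by (intro dens_deriv u assms)
    show "\<bar>exp (- ((s + u) / (2 * s\<^sup>2)) * (norm z)\<^sup>2) * dens1 s e u z\<bar>
      \<le> 200 * (exp (- (s / (2 * s\<^sup>2)) * (norm z)\<^sup>2) * (1 + (norm z)\<^sup>2)\<^sup>2)"
      by (intro gauss_int_weight_le dens_bounds u assms)
    show "integrable lborel (\<lambda>z. exp (- ((s + u) / (2 * s\<^sup>2)) * (norm z)\<^sup>2) * dens s e u z)"
      by (rule gauss_int_integrable[OF s u dens_measurable(1) dens_bounds(1)[OF assms(1) u assms(3,4)]])
  qed (use assms in auto)
  show "((\<lambda>t. gauss_int s t (dens1 s e t)) has_real_derivative gauss_int s t (dens2 s e t)) (at t within {0..})"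
    unfolding gauss_int_def
  proof (rule leibniz_dominated[OF _ _ _ _ w])
    fix u :: real and z :: "real^2" assume "u \<in> {0..}"
    then have u: "u \<ge> 0" by simp
    show "((\<lambda>u. exp (- ((s + u) / (2 * s\<^sup>2)) * (norm z)\<^sup>2) * dens1 s e u z) has_real_derivative
      exp (- ((s + u) / (2 * s\<^sup>2)) * (norm z)\<^sup>2) * dens2 s e u z) (at u within {0..})"
      by (intro dens_deriv u assms)
    show "\<bar>exp (- ((s + u) / (2 * s\<^sup>2)) * (norm z)\<^sup>2) * dens2 s e u z\<bar>
      \<le> 200 * (exp (- (s / (2 * s\<^sup>2)) * (norm z)\<^sup>2) * (1 + (norm z)\<^sup>2)\<^sup>2)"
      by (intro gauss_int_weight_le dens_bounds u assms)
    show "integrable lborel (\<lambda>z. exp (- ((s + u) / (2 * s\<^sup>2)) * (norm z)\<^sup>2) * dens1 s e u z)"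
      by (rule gauss_int_integrable[OF s u dens_measurable(2) dens_bounds(2)[OF assms(1) u assms(3,4)]])
  qed (use assms in auto)
qed

text \<open>Continuity of the second derivative at zero is what carries the sign at time zero over
  to small positive times.\<close>

lemma gauss_int_dens2_tendsto:
  assumes "s \<ge> 1" "0 \<le> e" "e \<le> 1 / 10"
  shows "((\<lambda>t. gauss_int s t (dens2 s e t)) \<longlongrightarrow> gauss_int s 0 (dens2 s e 0)) (at 0 within {0..})"
proof -
  have s: "s > 0" using assms by simp
  have w: "integrable lborel (\<lambda>z::real^2. 200 * (exp (- (s / (2 * s\<^sup>2)) * (norm z)\<^sup>2) * (1 + (norm z)\<^sup>2)\<^sup>2))"
    using s by (intro integrable_mult_right integrable_gauss_weight) auto
  show ?thesis
    unfolding gauss_int_def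
  proof (rule tendsto_integral_dominated[OF _ _ _ w])
    fix z :: "real^2"
    have nz: "1 + amp s e 0 * V z \<noteq> 0"
      using one_plus_V_ge[of "amp s e 0" z] amp_bounds[of s 0 e] assms by auto
    have amp: "(amp s e \<longlongrightarrow> amp s e 0) (at 0 within {0..})"
      "(amp1 s e \<longlongrightarrow> amp1 s e 0) (at 0 within {0..})"
      using amp_deriv[OF s order_refl, of e "{0..}"]
      by (auto dest!: DERIV_continuous simp: continuous_within)
    have amp2: "(amp2 s e \<longlongrightarrow> amp2 s e 0) (at 0 within {0..})"
      unfolding amp2_def[abs_def] by (intro tendsto_intros amp) (use s in auto)
    show "((\<lambda>t. exp (- ((s + t) / (2 * s\<^sup>2)) * (norm z)\<^sup>2) * dens2 s e t z)
       \<longlongrightarrow> exp (- ((s + 0) / (2 * s\<^sup>2)) * (norm z)\<^sup>2) * dens2 s e 0 z) (at 0 within {0..})"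
      unfolding dens2_def ratio_def ratio1_def ratio2_def
      by (intro tendsto_intros amp amp2) (use s nz in auto)
  next
    fix u :: real and z :: "real^2" assume "u \<in> {0..}"
    then have u: "u \<ge> 0" by simp
    show "\<bar>exp (- ((s + u) / (2 * s\<^sup>2)) * (norm z)\<^sup>2) * dens2 s e u z\<bar>
      \<le> 200 * (exp (- (s / (2 * s\<^sup>2)) * (norm z)\<^sup>2) * (1 + (norm z)\<^sup>2)\<^sup>2)"
      by (intro gauss_int_weight_le dens_bounds u assms)
  qed auto
qed

section \<open>Means over the torus as limits of Gaussian means\<close>

definition gauss_mean :: "real \<Rightarrow> (real^2 \<Rightarrow> real) \<Rightarrow> real" where
  "gauss_mean s h = (\<integral>z. exp (- (1 / (2 * s)) * (norm z)\<^sup>2) * h z \<partial>lborel) / (2 * pi * s)"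

lemma gauss_mean_integrable:
  fixes h :: "real^2 \<Rightarrow> real"
  assumes "s > 0" "h \<in> borel_measurable borel" "\<And>x. \<bar>h x\<bar> \<le> C * (1 + (norm x)\<^sup>2)\<^sup>2"
  shows "integrable lborel (\<lambda>z. exp (- (1 / (2 * s)) * (norm z)\<^sup>2) * h z)"
  by (rule integrable_gauss_bound[OF _ assms(2,3)]) (use assms(1) in auto)

lemma gauss_mean_integrable_bounded:
  fixes h :: "real^2 \<Rightarrow> real"
  assumes "s > 0" "h \<in> borel_measurable borel" "\<And>x. \<bar>h x\<bar> \<le> C"
  shows "integrable lborel (\<lambda>z. exp (- (1 / (2 * s)) * (norm z)\<^sup>2) * h z)"
proof (rule gauss_mean_integrable[OF assms(1,2)])
  fix x :: "real^2"
  have C: "C \<ge> 0" using assms(3)[of 0] by linarith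
  have "C * 1 \<le> C * (1 + (norm x)\<^sup>2)\<^sup>2" using C by (intro mult_left_mono one_le_power) auto
  then show "\<bar>h x\<bar> \<le> C * (1 + (norm x)\<^sup>2)\<^sup>2" using assms(3)[of x] by linarith
qed

lemma gauss_mean_cos:
  assumes "s > 0"
  shows "gauss_mean s (\<lambda>z. cos (k \<bullet> z)) = exp (- (s * (norm k)\<^sup>2 / 2))"
  using gauss_cos[of "1 / (2 * s)" k] assms by (simp add: gauss_mean_def has_bochner_integral_iff mult.commute)

lemma gauss_mean_add:
  assumes "integrable lborel (\<lambda>z. exp (- (1 / (2 * s)) * (norm z)\<^sup>2) * g z)"
    "integrable lborel (\<lambda>z. exp (- (1 / (2 * s)) * (norm z)\<^sup>2) * h z)"
  shows "gauss_mean s (\<lambda>z. g z + h z) = gauss_mean s g + gauss_mean s h"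
  unfolding gauss_mean_def distrib_left Bochner_Integration.integral_add[OF assms] add_divide_distrib ..

lemma gauss_mean_cmult: "gauss_mean s (\<lambda>z. c * h z) = c * gauss_mean s h"
proof -
  have "(\<lambda>z. exp (- (1 / (2 * s)) * (norm z)\<^sup>2) * (c * h z))
      = (\<lambda>z. c * (exp (- (1 / (2 * s)) * (norm z)\<^sup>2) * h z))"
    by (simp add: fun_eq_iff)
  then show ?thesis unfolding gauss_mean_def by (simp only: integral_mult_right_zero times_divide_eq_right)
qed

lemma gauss_mean_mono:
  assumes "s > 0" "integrable lborel (\<lambda>z. exp (- (1 / (2 * s)) * (norm z)\<^sup>2) * g z)"
    "integrable lborel (\<lambda>z. exp (- (1 / (2 * s)) * (norm z)\<^sup>2) * h z)" "\<And>z. \<bar>g z\<bar> \<le> h z"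
  shows "\<bar>gauss_mean s g\<bar> \<le> gauss_mean s h"
proof -
  have "\<bar>\<integral>z. exp (- (1 / (2 * s)) * (norm z)\<^sup>2) * g z \<partial>lborel\<bar>
      \<le> (\<integral>z. \<bar>exp (- (1 / (2 * s)) * (norm z)\<^sup>2) * g z\<bar> \<partial>lborel)"
    by (rule integral_abs_bound)
  also have "\<dots> \<le> (\<integral>z. exp (- (1 / (2 * s)) * (norm z)\<^sup>2) * h z \<partial>lborel)"
    using assms(2-4) by (intro integral_mono integrable_abs) (auto simp: abs_mult intro!: mult_left_mono)
  finally show ?thesis using assms(1) unfolding gauss_mean_def by (simp add: divide_right_mono)
qed

lemma gauss_mean_const:
  assumes "s > 0"
  shows "gauss_mean s (\<lambda>_. c) = c"
  using gauss_mean_cmult[of s c "\<lambda>_. 1"] gauss_mean_cos[OF assms, of 0] by simp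

text \<open>Substituting \<open>z = sqrt s * y\<close> shows that a weight in the natural scale
  \<open>(norm z)^2 / s\<close> has a mean independent of \<open>s\<close>. Terms bounded by this
  weight thus disappear in the limit as soon as they carry a factor \<open>1 / s\<close>.\<close>

lemma gauss_mean_weight:
  assumes "s > 0"
  shows "gauss_mean s (\<lambda>z. (1 + (norm z)\<^sup>2 / s)\<^sup>2) = gauss_mean 1 (\<lambda>z. (1 + (norm z)\<^sup>2)\<^sup>2)"
proof -
  have n: "(norm (0 + (1 / sqrt s) *\<^sub>R z))\<^sup>2 = (norm z)\<^sup>2 / s" for z :: "real^2"
    using assms by (simp add: power_divide)
  have "has_bochner_integral lborel (\<lambda>y::real^2. exp (- (1 / (2 * 1)) * (norm y)\<^sup>2) * (1 + (norm y)\<^sup>2)\<^sup>2)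
    (2 * pi * gauss_mean 1 (\<lambda>z. (1 + (norm z)\<^sup>2)\<^sup>2))"
    using integrable_gauss_weight[of "1 / 2"] by (simp add: has_bochner_integral_iff gauss_mean_def)
  from has_bochner_integral_lborel_affine[OF this, of "1 / sqrt s" 0]
  have "has_bochner_integral lborel
    (\<lambda>z::real^2. exp (- (1 / (2 * 1)) * ((norm z)\<^sup>2 / s)) * (1 + (norm z)\<^sup>2 / s)\<^sup>2)
    (2 * pi * s * gauss_mean 1 (\<lambda>z. (1 + (norm z)\<^sup>2)\<^sup>2))"
    unfolding n using assms by (simp add: power_divide mult_ac)
  then show ?thesis
    using assms by (simp add: has_bochner_integral_iff gauss_mean_def)
qed

lemma gauss_mean_weight_integrable:
  assumes "s \<ge> 1"
  shows "integrable lborel (\<lambda>z::real^2. exp (- (1 / (2 * s)) * (norm z)\<^sup>2) * (1 + (norm z)\<^sup>2 / s)\<^sup>2)"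
proof (rule gauss_mean_integrable[where C = 1])
  fix x :: "real^2"
  have "(norm x)\<^sup>2 / s \<le> (norm x)\<^sup>2 / 1" using assms by (intro divide_left_mono) auto
  then show "\<bar>(1 + (norm x)\<^sup>2 / s)\<^sup>2\<bar> \<le> 1 * (1 + (norm x)\<^sup>2)\<^sup>2"
    using assms by (auto intro!: power_mono)
qed (use assms in auto)

text \<open>The mean over the period lattice is encoded as a limit of Gaussian means, so no integral
  over a fundamental cell occurs. Measurability and boundedness are included to make the means
  additive.\<close>

definition torus_mean :: "(real^2 \<Rightarrow> real) \<Rightarrow> real \<Rightarrow> bool" where
  "torus_mean h m \<longleftrightarrow> h \<in> borel_measurable borel \<and> (\<exists>C. \<forall>z. \<bar>h z\<bar> \<le> C) \<and> ((\<lambda>s. gauss_mean s h) \<longlongrightarrow> m) at_top"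

lemma torus_mean_integrable:
  assumes "torus_mean h m" "s > 0"
  shows "integrable lborel (\<lambda>z. exp (- (1 / (2 * s)) * (norm z)\<^sup>2) * h z)"
proof -
  obtain C where "h \<in> borel_measurable borel" "\<And>z. \<bar>h z\<bar> \<le> C"
    using assms(1) unfolding torus_mean_def by auto
  then show ?thesis by (rule gauss_mean_integrable_bounded[OF assms(2)])
qed

lemma torus_mean_add:
  assumes "torus_mean g m" "torus_mean h n"
  shows "torus_mean (\<lambda>z. g z + h z) (m + n)"
proof -
  obtain C D where "\<And>z. \<bar>g z\<bar> \<le> C" "\<And>z. \<bar>h z\<bar> \<le> D" using assms unfolding torus_mean_def by auto
  then have "\<bar>g z + h z\<bar> \<le> C + D" for z by (intro order_trans[OF abs_triangle_ineq] add_mono)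
  moreover have "((\<lambda>s. gauss_mean s (\<lambda>z. g z + h z)) \<longlongrightarrow> m + n) at_top"
  proof (rule Lim_transform_eventually)
    show "((\<lambda>s. gauss_mean s g + gauss_mean s h) \<longlongrightarrow> m + n) at_top"
      using assms by (auto simp: torus_mean_def intro!: tendsto_add)
    show "\<forall>\<^sub>F s in at_top. gauss_mean s g + gauss_mean s h = gauss_mean s (\<lambda>z. g z + h z)"
      using eventually_gt_at_top[of 0]
      by eventually_elim (rule gauss_mean_add[symmetric]; rule torus_mean_integrable, (rule assms | assumption)+)
  qed
  ultimately show ?thesis using assms unfolding torus_mean_def by (auto intro: borel_measurable_add)
qed

lemma torus_mean_cmult:
  assumes "torus_mean h m"
  shows "torus_mean (\<lambda>z. c * h z) (c * m)"
proof -
  obtain C where C: "\<And>z. \<bar>h z\<bar> \<le> C" using assms unfolding torus_mean_def by auto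
  have "\<bar>c * h z\<bar> \<le> \<bar>c\<bar> * C" for z
    unfolding abs_mult by (intro mult_left_mono C) auto
  then show ?thesis
    using assms unfolding torus_mean_def by (auto simp: gauss_mean_cmult intro!: tendsto_intros)
qed

lemma torus_mean_sum:
  assumes "finite I" "\<And>i. i \<in> I \<Longrightarrow> torus_mean (h i) (m i)"
  shows "torus_mean (\<lambda>z. \<Sum>i\<in>I. h i z) (\<Sum>i\<in>I. m i)"
  using assms
proof (induction rule: finite_induct)
  case empty
  have "torus_mean (\<lambda>z. 0) 0"
    by (auto simp: torus_mean_def gauss_mean_def)
  then show ?case by simp
next
  case (insert i I)
  then show ?case by (simp add: torus_mean_add)
qed

text \<open>Orthogonality of characters: the Gaussian mean is
  \<open>exp (- s * (norm k)^2 / 2)\<close>, which vanishes in the limit unless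
  \<open>k = 0\<close>.\<close>

lemma torus_mean_cos: "torus_mean (\<lambda>z. cos (k \<bullet> z)) (if k = 0 then 1 else 0)"
proof (cases "k = 0")
  case True
  have "((\<lambda>s. gauss_mean s (\<lambda>_. 1)) \<longlongrightarrow> 1) at_top"
    by (rule Lim_transform_eventually[OF tendsto_const])
      (use eventually_gt_at_top[of 0] in eventually_elim, simp add: gauss_mean_const)
  then show ?thesis using True unfolding torus_mean_def by auto
next
  case False
  then have k: "(norm k)\<^sup>2 / 2 > 0" by simp
  have "((\<lambda>s. exp (- (s * ((norm k)\<^sup>2 / 2)))) \<longlongrightarrow> 0) at_top"
    by (intro filterlim_compose[OF exp_at_bot] filterlim_compose[OF filterlim_uminus_at_bot_at_top]
        filterlim_at_top_mult_tendsto_pos[OF tendsto_const k filterlim_ident])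
  then have "((\<lambda>s. gauss_mean s (\<lambda>z. cos (k \<bullet> z))) \<longlongrightarrow> 0) at_top"
    by (rule Lim_transform_eventually)
      (use eventually_gt_at_top[of 0] in eventually_elim, simp add: gauss_mean_cos)
  moreover have "\<exists>C. \<forall>z. \<bar>cos (k \<bullet> z)\<bar> \<le> C" by (intro exI[of _ 1]) simp
  ultimately show ?thesis using False unfolding torus_mean_def by auto
qed

lemma torus_mean_cos_cos:
  "torus_mean (\<lambda>z. cos (wavevec m \<bullet> z) * cos (wavevec n \<bullet> z)) (if m = n then 1 / 2 else 0)"
proof -
  have eq: "(\<lambda>z. cos (wavevec m \<bullet> z) * cos (wavevec n \<bullet> z))
    = (\<lambda>z. 1 / 2 * (cos ((wavevec m - wavevec n) \<bullet> z) + cos ((wavevec m + wavevec n) \<bullet> z)))"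
    by (simp add: fun_eq_iff cos_times_cos inner_diff_left inner_add_left)
  have val: "1 / 2 * ((if wavevec m - wavevec n = 0 then 1 else 0) + (if wavevec m + wavevec n = 0 then 1 else 0))
    = (if m = n then 1 / 2 else (0::real))"
    using exhaust_3[of m] exhaust_3[of n]
    by (elim disjE) (simp_all add: vec_eq_iff forall_2 wavevec_simps)
  show ?thesis unfolding eq val[symmetric] by (intro torus_mean_cmult torus_mean_add torus_mean_cos)
qed

lemma torus_mean_sin_sin:
  "torus_mean (\<lambda>z. sin (wavevec m \<bullet> z) * sin (wavevec n \<bullet> z)) (if m = n then 1 / 2 else 0)"
proof -
  have eq: "(\<lambda>z. sin (wavevec m \<bullet> z) * sin (wavevec n \<bullet> z))
    = (\<lambda>z. 1 / 2 * (cos ((wavevec m - wavevec n) \<bullet> z) + (- 1) * cos ((wavevec m + wavevec n) \<bullet> z)))"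
    by (simp add: fun_eq_iff sin_times_sin inner_diff_left inner_add_left)
  have val: "1 / 2 * ((if wavevec m - wavevec n = 0 then 1 else 0) + (- 1) * (if wavevec m + wavevec n = 0 then 1 else 0))
    = (if m = n then 1 / 2 else (0::real))"
    using exhaust_3[of m] exhaust_3[of n]
    by (elim disjE) (simp_all add: vec_eq_iff forall_2 wavevec_simps)
  show ?thesis unfolding eq val[symmetric] by (intro torus_mean_cmult torus_mean_add torus_mean_cos)
qed

definition distinct3 :: "3 \<Rightarrow> 3 \<Rightarrow> 3 \<Rightarrow> bool" where
  "distinct3 m n p \<longleftrightarrow> m \<noteq> n \<and> n \<noteq> p \<and> m \<noteq> p"

text \<open>Two distinct wave vectors add up to minus the third, never to a wave vector, and twice a
  wave vector is too long to be cancelled by a single one. So, up to a global sign, only equal signs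
  resonate, and only when all three waves take part.\<close>

lemma wavevec_resonance:
  "wavevec m + wavevec n + wavevec p = 0 \<longleftrightarrow> distinct3 m n p"
  "wavevec m + wavevec n - wavevec p \<noteq> 0" "wavevec m - wavevec n + wavevec p \<noteq> 0" "wavevec m - wavevec n - wavevec p \<noteq> 0"
  using exhaust_3[of m] exhaust_3[of n] exhaust_3[of p]
  by (elim disjE; simp add: distinct3_def vec_eq_iff forall_2 wavevec_simps)+

lemma torus_mean_cos_cos_cos:
  "torus_mean (\<lambda>z. cos (wavevec m \<bullet> z) * cos (wavevec n \<bullet> z) * cos (wavevec p \<bullet> z)) (if distinct3 m n p then 1 / 4 else 0)"
proof -
  have eq: "(\<lambda>z. cos (wavevec m \<bullet> z) * cos (wavevec n \<bullet> z) * cos (wavevec p \<bullet> z))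
    = (\<lambda>z. 1 / 4 * (cos ((wavevec m + wavevec n + wavevec p) \<bullet> z) + cos ((wavevec m + wavevec n - wavevec p) \<bullet> z)
        + cos ((wavevec m - wavevec n + wavevec p) \<bullet> z) + cos ((wavevec m - wavevec n - wavevec p) \<bullet> z)))"
    by (simp add: fun_eq_iff inner_diff_left inner_add_left cos_add cos_diff sin_add sin_diff algebra_simps)
  have val: "1 / 4 * ((if wavevec m + wavevec n + wavevec p = 0 then 1 else 0) + (if wavevec m + wavevec n - wavevec p = 0 then 1 else 0)
      + (if wavevec m - wavevec n + wavevec p = 0 then 1 else 0) + (if wavevec m - wavevec n - wavevec p = 0 then 1 else 0))
    = (if distinct3 m n p then 1 / 4 else (0::real))"
    by (simp only: wavevec_resonance if_False) simp
  show ?thesis unfolding eq val[symmetric] by (intro torus_mean_cmult torus_mean_add torus_mean_cos)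
qed

text \<open>The resonant frequency enters with a sign opposite to that in the product of three
  cosines.\<close>

lemma torus_mean_cos_sin_sin:
  "torus_mean (\<lambda>z. cos (wavevec m \<bullet> z) * sin (wavevec n \<bullet> z) * sin (wavevec p \<bullet> z)) (if distinct3 m n p then - 1 / 4 else 0)"
proof -
  have eq: "(\<lambda>z. cos (wavevec m \<bullet> z) * sin (wavevec n \<bullet> z) * sin (wavevec p \<bullet> z))
    = (\<lambda>z. 1 / 4 * ((- 1) * cos ((wavevec m + wavevec n + wavevec p) \<bullet> z) + cos ((wavevec m + wavevec n - wavevec p) \<bullet> z)
        + cos ((wavevec m - wavevec n + wavevec p) \<bullet> z) + (- 1) * cos ((wavevec m - wavevec n - wavevec p) \<bullet> z)))"
    by (simp add: fun_eq_iff inner_diff_left inner_add_left cos_add cos_diff sin_add sin_diff algebra_simps)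
  have val: "1 / 4 * ((- 1) * (if wavevec m + wavevec n + wavevec p = 0 then 1 else 0) + (if wavevec m + wavevec n - wavevec p = 0 then 1 else 0)
      + (if wavevec m - wavevec n + wavevec p = 0 then 1 else 0) + (- 1) * (if wavevec m - wavevec n - wavevec p = 0 then 1 else 0))
    = (if distinct3 m n p then - 1 / 4 else (0::real))"
    by (simp only: wavevec_resonance if_False) simp
  show ?thesis unfolding eq val[symmetric] by (intro torus_mean_cmult torus_mean_add torus_mean_cos)
qed

lemma torus_mean_prod2:
  fixes a b :: "3 \<Rightarrow> real"
  assumes "\<And>m n. torus_mean (\<lambda>z. P m z * Q n z) (if m = n then 1 / 2 else 0)"
  shows "torus_mean (\<lambda>z. (\<Sum>m\<in>UNIV. a m * P m z) * (\<Sum>m\<in>UNIV. b m * Q m z)) (\<Sum>m\<in>UNIV. a m * b m / 2)"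
proof -
  have eq: "(\<lambda>z. (\<Sum>m\<in>UNIV. a m * P m z) * (\<Sum>m\<in>UNIV. b m * Q m z))
    = (\<lambda>z. \<Sum>m\<in>UNIV. \<Sum>n\<in>UNIV. (a m * b n) * (P m z * Q n z))"
    by (simp add: fun_eq_iff sum_product mult_ac)
  have val: "(\<Sum>m\<in>UNIV. a m * b m / 2) = (\<Sum>m\<in>UNIV. \<Sum>n\<in>UNIV. (a m * b n) * (if m = n then 1 / 2 else 0))"
    by (simp add: if_distrib cong: if_cong)
  show ?thesis unfolding eq val
    by (intro torus_mean_sum torus_mean_cmult assms) auto
qed

text \<open>The permanent of three coefficient vectors: the sum over the resonant triples of waves.\<close>

definition perm3 :: "(3 \<Rightarrow> real) \<Rightarrow> (3 \<Rightarrow> real) \<Rightarrow> (3 \<Rightarrow> real) \<Rightarrow> real" where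
  "perm3 a b c = a 1 * (b 2 * c 3 + b 3 * c 2) + a 2 * (b 1 * c 3 + b 3 * c 1) + a 3 * (b 1 * c 2 + b 2 * c 1)"

lemma torus_mean_prod3:
  fixes a b c :: "3 \<Rightarrow> real"
  assumes "\<And>m n p. torus_mean (\<lambda>z. P m z * Q n z * R p z) (if distinct3 m n p then w else 0)"
  shows "torus_mean (\<lambda>z. (\<Sum>m\<in>UNIV. a m * P m z) * (\<Sum>m\<in>UNIV. b m * Q m z) * (\<Sum>m\<in>UNIV. c m * R m z))
    (w * perm3 a b c)"
proof -
  have eq: "(\<lambda>z. (\<Sum>m\<in>UNIV. a m * P m z) * (\<Sum>m\<in>UNIV. b m * Q m z) * (\<Sum>m\<in>UNIV. c m * R m z))
    = (\<lambda>z. \<Sum>m\<in>UNIV. \<Sum>n\<in>UNIV. \<Sum>p\<in>UNIV. (a m * b n * c p) * (P m z * Q n z * R p z))"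
    by (simp add: fun_eq_iff sum_3 algebra_simps)
  have val: "w * perm3 a b c
    = (\<Sum>m\<in>UNIV. \<Sum>n\<in>UNIV. \<Sum>p\<in>UNIV. (a m * b n * c p) * (if distinct3 m n p then w else 0))"
    by (simp add: sum_3 distinct3_def perm3_def algebra_simps)
  show ?thesis unfolding eq val
    by (intro torus_mean_sum torus_mean_cmult assms) auto
qed

text \<open>Explicit unit coefficients bring \<open>V\<close> into the shape of the factors in
  \<open>torus_mean_prod3\<close>.\<close>

lemma V_alt: "V z = (\<Sum>m\<in>UNIV. 1 * cos (wavevec m \<bullet> z))"
  by (simp add: V_def)

lemma torus_mean_eq: "torus_mean g m \<Longrightarrow> (\<And>z. h z = g z) \<Longrightarrow> m = n \<Longrightarrow> torus_mean h n"
proof -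
  assume "torus_mean g m" "\<And>z. h z = g z" "m = n"
  moreover from this(2) have "h = g" by (rule ext)
  ultimately show ?thesis by simp
qed

lemma torus_mean_lap: "torus_mean (\<lambda>z. \<Sum>i\<in>UNIV. V2 i i z) 0"
proof -
  have "torus_mean (\<lambda>z. \<Sum>i\<in>UNIV. V2 i i z)
    (\<Sum>i\<in>(UNIV::2 set). \<Sum>m\<in>(UNIV::3 set). - (wavevec m $ i * wavevec m $ i) * (if wavevec m = 0 then 1 else 0))"
    unfolding V2_def by (intro torus_mean_sum torus_mean_cmult torus_mean_cos) auto
  moreover have "wavevec m \<noteq> 0" for m using norm_wavevec[of m] by (metis norm_zero zero_neq_one)
  ultimately show ?thesis by simp
qed

abbreviation w1 where "w1 i m \<equiv> - wavevec m $ i"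
abbreviation w2 where "w2 i j m \<equiv> - (wavevec m $ i * wavevec m $ j)"
abbreviation w3 where "w3 i j k m \<equiv> wavevec m $ i * wavevec m $ j * wavevec m $ k"

text \<open>Odd derivatives of \<open>V\<close> are sums of sines, even ones sums of cosines. Each
  product here contains either no sines or two, with a cosine sum leading the triple
  products.\<close>

lemma torus_mean_V_products:
  "torus_mean (\<lambda>z. V1 i z * V1 j z) (\<Sum>m\<in>UNIV. w1 i m * w1 j m / 2)"
  "torus_mean (\<lambda>z. V2 i j z * V2 k l z) (\<Sum>m\<in>UNIV. w2 i j m * w2 k l m / 2)"
  "torus_mean (\<lambda>z. V3 i j k z * V3 l p q z) (\<Sum>m\<in>UNIV. w3 i j k m * w3 l p q m / 2)"
  "torus_mean (\<lambda>z. V z * V1 i z * V1 j z) (- 1 / 4 * perm3 (\<lambda>_. 1) (w1 i) (w1 j))"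
  "torus_mean (\<lambda>z. V z * V2 i j z * V2 k l z) (1 / 4 * perm3 (\<lambda>_. 1) (w2 i j) (w2 k l))"
  "torus_mean (\<lambda>z. V2 i j z * V1 k z * V1 l z) (- 1 / 4 * perm3 (w2 i j) (w1 k) (w1 l))"
  "torus_mean (\<lambda>z. V z * V3 i j k z * V3 l p q z) (- 1 / 4 * perm3 (\<lambda>_. 1) (w3 i j k) (w3 l p q))"
  "torus_mean (\<lambda>z. V2 i j z * V3 k l p z * V1 q z) (- 1 / 4 * perm3 (w2 i j) (w3 k l p) (w1 q))"
  "torus_mean (\<lambda>z. V2 i j z * V2 k l z * V2 p q z) (1 / 4 * perm3 (w2 i j) (w2 k l) (w2 p q))"
  unfolding V_alt V1_def V2_def V3_def
  by (rule torus_mean_prod2 torus_mean_prod3 torus_mean_cos_cos torus_mean_sin_sin torus_mean_cos_cos_cos torus_mean_cos_sin_sin)+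

lemma gradV_sq_torus_mean: "torus_mean gradV_sq (3 / 2)"
proof (rule torus_mean_eq)
  show "torus_mean (\<lambda>z. \<Sum>i\<in>UNIV. V1 i z * V1 i z) (\<Sum>i\<in>UNIV. \<Sum>m\<in>UNIV. w1 i m * w1 i m / 2)"
    by (intro torus_mean_sum torus_mean_V_products) auto
qed (simp_all add: gradV_sq_def power2_eq_square sum_2 sum_3 wavevec_simps)

text \<open>Six ordered resonant triples, each with weight -1/4 and with inner product -1/2 of the
  two differentiated waves: \<open>- 1/4 * 6 * (- 1/2) = 3/4\<close>.\<close>

lemma V_gradV_sq_torus_mean: "torus_mean (\<lambda>z. V z * gradV_sq z) (3 / 4)"
proof (rule torus_mean_eq)
  show "torus_mean (\<lambda>z. \<Sum>i\<in>UNIV. V z * V1 i z * V1 i z) (\<Sum>i\<in>UNIV. - 1 / 4 * perm3 (\<lambda>_. 1) (w1 i) (w1 i))"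
    by (intro torus_mean_sum torus_mean_V_products) auto
qed (simp_all add: gradV_sq_def power2_eq_square sum_2 perm3_def wavevec_simps distrib_left)

text \<open>Tensor powers of a unit vector have norm 1, so each of the three waves contributes 1/2,
  at every order of differentiation.\<close>

lemma V2_sq_torus_mean: "torus_mean (\<lambda>z. \<Sum>i\<in>UNIV. \<Sum>j\<in>UNIV. (V2 i j z)\<^sup>2) (3 / 2)"
proof (rule torus_mean_eq)
  show "torus_mean (\<lambda>z. \<Sum>i\<in>UNIV. \<Sum>j\<in>UNIV. V2 i j z * V2 i j z)
      (\<Sum>i\<in>UNIV. \<Sum>j\<in>UNIV. \<Sum>m\<in>UNIV. w2 i j m * w2 i j m / 2)"
    by (intro torus_mean_sum torus_mean_V_products) auto
qed (simp_all add: power2_eq_square sum_2 sum_3 wavevec_simps)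

lemma V3_sq_torus_mean: "torus_mean (\<lambda>z. \<Sum>i\<in>UNIV. \<Sum>j\<in>UNIV. \<Sum>k\<in>UNIV. (V3 i j k z)\<^sup>2) (3 / 2)"
proof (rule torus_mean_eq)
  show "torus_mean (\<lambda>z. \<Sum>i\<in>UNIV. \<Sum>j\<in>UNIV. \<Sum>k\<in>UNIV. V3 i j k z * V3 i j k z)
      (\<Sum>i\<in>UNIV. \<Sum>j\<in>UNIV. \<Sum>k\<in>UNIV. \<Sum>m\<in>UNIV. w3 i j k m * w3 i j k m / 2)"
    by (intro torus_mean_sum torus_mean_V_products) auto
qed (simp_all add: power2_eq_square sum_2 sum_3 wavevec_simps)

text \<open>Contracting the indices leaves products of inner products -1/2, summed over six resonant
  triples: the first term gives 3/8 and the second one 3/4.\<close>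

lemma Q_cubic_torus_mean:
  "torus_mean (\<lambda>z. \<Sum>i\<in>UNIV. \<Sum>j\<in>UNIV. V z * V2 i j z * V2 i j z + 2 * (V2 i j z * V1 i z * V1 j z)) (9 / 8)"
proof (rule torus_mean_eq[OF _ refl])
  show "torus_mean (\<lambda>z. \<Sum>i\<in>UNIV. \<Sum>j\<in>UNIV. V z * V2 i j z * V2 i j z + 2 * (V2 i j z * V1 i z * V1 j z))
    (\<Sum>i\<in>UNIV. \<Sum>j\<in>UNIV. 1 / 4 * perm3 (\<lambda>_. 1) (w2 i j) (w2 i j) + 2 * (- 1 / 4 * perm3 (w2 i j) (w1 i) (w1 j)))"
    by (intro torus_mean_sum torus_mean_add torus_mean_cmult torus_mean_V_products) auto
qed (simp add: sum_2 perm3_def wavevec_simps)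

text \<open>By the same count the three lines contribute 3/16, 18/16 and 6/16.\<close>

lemma D_cubic_torus_mean:
  "torus_mean (\<lambda>z. \<Sum>i\<in>UNIV. \<Sum>j\<in>UNIV. \<Sum>k\<in>UNIV. V z * V3 i j k z * V3 i j k z
      + 2 * (V2 i j z * V3 i j k z * V1 k z + V2 k i z * V3 i j k z * V1 j z + V2 k j z * V3 i j k z * V1 i z)
      + 2 * (V2 i j z * V2 j k z * V2 k i z)) (27 / 16)"
proof (rule torus_mean_eq[OF _ refl])
  show "torus_mean (\<lambda>z. \<Sum>i\<in>UNIV. \<Sum>j\<in>UNIV. \<Sum>k\<in>UNIV. V z * V3 i j k z * V3 i j k z
      + 2 * (V2 i j z * V3 i j k z * V1 k z + V2 k i z * V3 i j k z * V1 j z + V2 k j z * V3 i j k z * V1 i z)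
      + 2 * (V2 i j z * V2 j k z * V2 k i z))
    (\<Sum>i\<in>UNIV. \<Sum>j\<in>UNIV. \<Sum>k\<in>UNIV. - 1 / 4 * perm3 (\<lambda>_. 1) (w3 i j k) (w3 i j k)
      + 2 * (- 1 / 4 * perm3 (w2 i j) (w3 i j k) (w1 k) + - 1 / 4 * perm3 (w2 k i) (w3 i j k) (w1 j)
        + - 1 / 4 * perm3 (w2 k j) (w3 i j k) (w1 i))
      + 2 * (1 / 4 * perm3 (w2 i j) (w2 j k) (w2 k i)))"
    by (intro torus_mean_sum torus_mean_add torus_mean_cmult torus_mean_V_products) auto
qed (simp add: sum_2 perm3_def wavevec_simps)

section \<open>Bounds uniform in amplitude and variance\<close>

text \<open>The remainders of the expansions are long polynomials; with this predicate their bounds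
  are assembled by introduction rules and the constants stay implicit.\<close>

definition unif_bdd :: "(real \<Rightarrow> real \<Rightarrow> real^2 \<Rightarrow> real) \<Rightarrow> bool" where
  "unif_bdd X \<longleftrightarrow> (\<exists>C. \<forall>e s z. 0 \<le> e \<longrightarrow> e \<le> 1 / 10 \<longrightarrow> 1 \<le> s \<longrightarrow> \<bar>X e s z\<bar> \<le> C)"

definition weight_bdd :: "(real \<Rightarrow> real \<Rightarrow> real^2 \<Rightarrow> real) \<Rightarrow> bool" where
  "weight_bdd X \<longleftrightarrow> (\<exists>C. \<forall>e s z. 0 \<le> e \<longrightarrow> e \<le> 1 / 10 \<longrightarrow> 1 \<le> s \<longrightarrow> \<bar>X e s z\<bar> \<le> C * (1 + (norm z)\<^sup>2 / s)\<^sup>2)"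

lemma bdI: "(\<And>e s z. 0 \<le> e \<Longrightarrow> e \<le> 1 / 10 \<Longrightarrow> 1 \<le> s \<Longrightarrow> \<bar>X e s z\<bar> \<le> C) \<Longrightarrow> unif_bdd X"
  unfolding unif_bdd_def by blast

lemma bwI: "(\<And>e s z. 0 \<le> e \<Longrightarrow> e \<le> 1 / 10 \<Longrightarrow> 1 \<le> s \<Longrightarrow> \<bar>X e s z\<bar> \<le> C * (1 + (norm z)\<^sup>2 / s)\<^sup>2) \<Longrightarrow> weight_bdd X"
  unfolding weight_bdd_def by blast

lemma unif_bdd_add: "unif_bdd X \<Longrightarrow> unif_bdd Y \<Longrightarrow> unif_bdd (\<lambda>e s z. X e s z + Y e s z)"
  unfolding unif_bdd_def by (meson abs_triangle_ineq add_mono order_trans)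

lemma unif_bdd_mult:
  assumes "unif_bdd X" "unif_bdd Y"
  shows "unif_bdd (\<lambda>e s z. X e s z * Y e s z)"
proof -
  obtain C D where "\<And>e s z. 0 \<le> e \<Longrightarrow> e \<le> 1 / 10 \<Longrightarrow> 1 \<le> s \<Longrightarrow> \<bar>X e s z\<bar> \<le> C"
    "\<And>e s z. 0 \<le> e \<Longrightarrow> e \<le> 1 / 10 \<Longrightarrow> 1 \<le> s \<Longrightarrow> \<bar>Y e s z\<bar> \<le> D"
    using assms unfolding unif_bdd_def by metis
  then show ?thesis
    by (intro bdI[of _ "C * D"]) (auto simp: abs_mult intro!: mult_mono order_trans[OF abs_ge_zero])
qed

lemma weight_bdd_add:
  assumes "weight_bdd X" "weight_bdd Y"
  shows "weight_bdd (\<lambda>e s z. X e s z + Y e s z)"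
proof -
  obtain C D where "\<And>e s z. 0 \<le> e \<Longrightarrow> e \<le> 1 / 10 \<Longrightarrow> 1 \<le> s \<Longrightarrow> \<bar>X e s z\<bar> \<le> C * (1 + (norm z)\<^sup>2 / s)\<^sup>2"
    "\<And>e s z. 0 \<le> e \<Longrightarrow> e \<le> 1 / 10 \<Longrightarrow> 1 \<le> s \<Longrightarrow> \<bar>Y e s z\<bar> \<le> D * (1 + (norm z)\<^sup>2 / s)\<^sup>2"
    using assms unfolding weight_bdd_def by metis
  then show ?thesis
    by (intro bwI[of _ "C + D"]) (unfold distrib_right, intro order_trans[OF abs_triangle_ineq] add_mono)
qed

lemma weight_bdd_unif_bdd_mult:
  assumes "unif_bdd X" "weight_bdd Y"
  shows "weight_bdd (\<lambda>e s z. X e s z * Y e s z)"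
proof -
  obtain C D where "\<And>e s z. 0 \<le> e \<Longrightarrow> e \<le> 1 / 10 \<Longrightarrow> 1 \<le> s \<Longrightarrow> \<bar>X e s z\<bar> \<le> C"
    "\<And>e s z. 0 \<le> e \<Longrightarrow> e \<le> 1 / 10 \<Longrightarrow> 1 \<le> s \<Longrightarrow> \<bar>Y e s z\<bar> \<le> D * (1 + (norm z)\<^sup>2 / s)\<^sup>2"
    using assms unfolding unif_bdd_def weight_bdd_def by metis
  then show ?thesis
    by (intro bwI[of _ "C * D"]) (unfold abs_mult mult.assoc, intro mult_mono, auto intro: order_trans[OF abs_ge_zero])
qed

lemma weight_bdd_unif_bdd:
  assumes "unif_bdd X"
  shows "weight_bdd X"
proof -
  have "weight_bdd (\<lambda>e s z. 1)" by (rule bwI[of _ 1]) (simp add: one_le_power)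
  from weight_bdd_unif_bdd_mult[OF assms this] show ?thesis by simp
qed

lemma weight_bdd_norm: "weight_bdd (\<lambda>e s z. (norm z)\<^sup>2 / s)" "weight_bdd (\<lambda>e s z. ((norm z)\<^sup>2 / s)\<^sup>2)"
proof -
  have *: "\<bar>n\<bar> \<le> 1 * (1 + n)\<^sup>2" "\<bar>n\<^sup>2\<bar> \<le> 1 * (1 + n)\<^sup>2" if "n \<ge> 0" for n :: real
    using that by (auto simp: power2_eq_square algebra_simps)
  show "weight_bdd (\<lambda>e s z. (norm z)\<^sup>2 / s)" by (rule bwI[of _ 1]) (rule *, simp)
  show "weight_bdd (\<lambda>e s z. ((norm z)\<^sup>2 / s)\<^sup>2)" by (rule bwI[of _ 1]) (rule *, simp)
qed

lemma unif_bdd_const: "unif_bdd (\<lambda>e s z. c)" by (rule bdI[of _ "\<bar>c\<bar>"]) simp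
lemma unif_bdd_e: "unif_bdd (\<lambda>e s z. e)" by (rule bdI[of _ 1]) simp
lemma unif_bdd_inv_s: "unif_bdd (\<lambda>e s z. 1 / s)" by (rule bdI[of _ 1]) simp
lemma unif_bdd_V: "unif_bdd (\<lambda>e s. V)" by (rule bdI[of _ 3]) (rule V_bound)
lemma unif_bdd_V1: "unif_bdd (\<lambda>e s. V1 i)" by (rule bdI[of _ 3]) (rule V1_bound)
lemma unif_bdd_V2: "unif_bdd (\<lambda>e s. V2 i j)" by (rule bdI[of _ 3]) (rule V2_bound)
lemma unif_bdd_V3: "unif_bdd (\<lambda>e s. V3 i j k)" by (rule bdI[of _ 3]) (rule V3_bound)
lemma unif_bdd_gradV_sq: "unif_bdd (\<lambda>e s. gradV_sq)" by (rule bdI[of _ 18]) (simp add: gradV_sq_bound)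
lemma unif_bdd_inverse: "unif_bdd (\<lambda>e s z. inverse (1 + e * V z))"
proof (rule bdI[of _ 2])
  fix e s :: real and z
  assume "0 \<le> e" "e \<le> 1 / 10"
  from one_plus_V_ge[OF this, of z] show "\<bar>inverse (1 + e * V z)\<bar> \<le> 2"
    by (simp add: field_simps)
qed
lemma unif_bdd_minus: "unif_bdd X \<Longrightarrow> unif_bdd (\<lambda>e s z. - X e s z)"
  unfolding unif_bdd_def by simp
lemma unif_bdd_diff: "unif_bdd X \<Longrightarrow> unif_bdd Y \<Longrightarrow> unif_bdd (\<lambda>e s z. X e s z - Y e s z)"
  using unif_bdd_add[OF _ unif_bdd_minus] by simp
lemma unif_bdd_power: "unif_bdd X \<Longrightarrow> unif_bdd (\<lambda>e s z. X e s z ^ n)"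
  by (induction n) (auto intro: unif_bdd_mult unif_bdd_const)
lemma unif_bdd_sum: "finite I \<Longrightarrow> (\<And>i. i \<in> I \<Longrightarrow> unif_bdd (X i)) \<Longrightarrow> unif_bdd (\<lambda>e s z. \<Sum>i\<in>I. X i e s z)"
  by (induction rule: finite_induct) (auto intro: unif_bdd_add unif_bdd_const)

lemmas unif_bdd_intros = unif_bdd_add unif_bdd_mult unif_bdd_minus unif_bdd_diff unif_bdd_power unif_bdd_const unif_bdd_e unif_bdd_inv_s unif_bdd_V unif_bdd_V1 unif_bdd_V2
  unif_bdd_V3 unif_bdd_gradV_sq unif_bdd_inverse

section \<open>Expansion to third order in the amplitude\<close>

text \<open>
  \<open>F e s = a e\<^sup>2 + b e\<^sup>3 + O(e\<^sup>4)\<close>, where for each \<open>e\<close> the bound is only required for all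
  sufficiently large \<open>s\<close>: the limit in \<open>s\<close> is taken before the one in \<open>e\<close>.
\<close>

definition cubic_approx :: "(real \<Rightarrow> real \<Rightarrow> real) \<Rightarrow> real \<Rightarrow> real \<Rightarrow> bool" where
  "cubic_approx F a b \<longleftrightarrow> (\<exists>C. \<forall>e. 0 < e \<longrightarrow> e \<le> 1 / 10 \<longrightarrow>
    (\<forall>\<^sub>F s in at_top. \<bar>F e s - (a * e\<^sup>2 + b * e^3)\<bar> \<le> C * e^4))"

text \<open>The polynomial part converges to the torus means, \<open>R\<close> costs a constant
  times \<open>e^4\<close>, and \<open>U * (1 / s)\<close> vanishes because the mean of its weight
  does not depend on \<open>s\<close>.\<close>

lemma cubic_approx_gauss_mean:
  fixes h :: "real \<Rightarrow> real \<Rightarrow> real^2 \<Rightarrow> real"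
  assumes p: "torus_mean p1 0" "torus_mean p2 a" "torus_mean p3 b" and R: "unif_bdd R" and U: "weight_bdd U"
    and h: "\<And>e s z. 0 < e \<Longrightarrow> e \<le> 1 / 10 \<Longrightarrow> s \<ge> 1 \<Longrightarrow>
      h e s z = e * p1 z + e\<^sup>2 * p2 z + e^3 * p3 z + e^4 * R e s z + U e s z * (1 / s)"
    and meas: "\<And>e s. h e s \<in> borel_measurable borel"
  shows "cubic_approx (\<lambda>e s. gauss_mean s (h e s)) a b"
proof -
  obtain CR where CR: "\<And>e s z. 0 \<le> e \<Longrightarrow> e \<le> 1 / 10 \<Longrightarrow> 1 \<le> s \<Longrightarrow> \<bar>R e s z\<bar> \<le> CR"
    using R unfolding unif_bdd_def by blast
  obtain CU where CU: "\<And>e s z. 0 \<le> e \<Longrightarrow> e \<le> 1 / 10 \<Longrightarrow> 1 \<le> s \<Longrightarrow> \<bar>U e s z\<bar> \<le> CU * (1 + (norm z)\<^sup>2 / s)\<^sup>2"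
    using U unfolding weight_bdd_def by blast
  define M where "M = gauss_mean 1 (\<lambda>z. (1 + (norm z)\<^sup>2)\<^sup>2)"
  have pm: "p1 \<in> borel_measurable borel" "p2 \<in> borel_measurable borel" "p3 \<in> borel_measurable borel"
    using p by (auto simp: torus_mean_def)
  show ?thesis
    unfolding cubic_approx_def
  \<comment> \<open>The extra 1 pays for two errors of \<open>e^4 / 2\<close> each: the distance of
    the polynomial part from its limit, and the contribution of \<open>U\<close>.\<close>
  proof (intro exI[of _ "CR + 1"] allI impI)
    fix e :: real
    assume e: "0 < e" "e \<le> 1 / 10"
    define q where "q z = e * p1 z + e\<^sup>2 * p2 z + e^3 * p3 z" for z
    define L where "L = a * e\<^sup>2 + b * e^3"
    have q: "torus_mean q L"
      using torus_mean_add[OF torus_mean_add[OF torus_mean_cmult[OF p(1), of e] torus_mean_cmult[OF p(2), of "e\<^sup>2"]]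
          torus_mean_cmult[OF p(3), of "e^3"]]
      unfolding q_def[abs_def] L_def by (simp add: mult.commute)
    have bound: "\<bar>gauss_mean s (h e s) - gauss_mean s q\<bar> \<le> CR * e^4 + CU * M / s" if s: "s \<ge> 1" for s
    proof -
      have s0: "s > 0" using s by simp
      define D where "D z = h e s z - q z" for z
      have D: "\<bar>D z\<bar> \<le> e^4 * CR + CU / s * (1 + (norm z)\<^sup>2 / s)\<^sup>2" for z
      proof -
        have "D z = e^4 * R e s z + U e s z * (1 / s)"
          using h[OF e s] by (simp add: D_def q_def)
        moreover have "\<bar>e^4 * R e s z\<bar> \<le> e^4 * CR"
          unfolding abs_mult using e CR[of e s z] s by (intro mult_mono) auto
        moreover have "\<bar>U e s z * (1 / s)\<bar> \<le> CU * (1 + (norm z)\<^sup>2 / s)\<^sup>2 * (1 / s)"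
          unfolding abs_mult using e CU[of e s z] s by (intro mult_mono) (auto intro: order_trans[OF abs_ge_zero])
        moreover have "CU * (1 + (norm z)\<^sup>2 / s)\<^sup>2 * (1 / s) = CU / s * (1 + (norm z)\<^sup>2 / s)\<^sup>2" by simp
        ultimately show ?thesis by linarith
      qed
      have Dm: "D \<in> borel_measurable borel"
        unfolding D_def q_def using meas[of e s] pm by measurable
      have i1: "integrable lborel (\<lambda>z::real^2. exp (- (1 / (2 * s)) * (norm z)\<^sup>2) * (e^4 * CR))"
        by (rule gauss_mean_integrable_bounded[OF s0 _ order_refl]) simp
      have "integrable lborel (\<lambda>z::real^2. CU / s * (exp (- (1 / (2 * s)) * (norm z)\<^sup>2) * (1 + (norm z)\<^sup>2 / s)\<^sup>2))"
        by (intro integrable_mult_right gauss_mean_weight_integrable s)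
      then have i2: "integrable lborel (\<lambda>z::real^2. exp (- (1 / (2 * s)) * (norm z)\<^sup>2) * (CU / s * (1 + (norm z)\<^sup>2 / s)\<^sup>2))"
        by (simp only: mult.left_commute)
      have i: "integrable lborel (\<lambda>z::real^2. exp (- (1 / (2 * s)) * (norm z)\<^sup>2) * (e^4 * CR + CU / s * (1 + (norm z)\<^sup>2 / s)\<^sup>2))"
        unfolding distrib_left by (intro Bochner_Integration.integrable_add i1 i2)
      have iD: "integrable lborel (\<lambda>z. exp (- (1 / (2 * s)) * (norm z)\<^sup>2) * D z)"
      proof (rule Bochner_Integration.integrable_bound[OF i])
        show "AE z in lborel. norm (exp (- (1 / (2 * s)) * (norm z)\<^sup>2) * D z)
          \<le> norm (exp (- (1 / (2 * s)) * (norm z)\<^sup>2) * (e^4 * CR + CU / s * (1 + (norm z)\<^sup>2 / s)\<^sup>2))"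
        proof (rule AE_I2)
          fix z
          show "norm (exp (- (1 / (2 * s)) * (norm z)\<^sup>2) * D z)
            \<le> norm (exp (- (1 / (2 * s)) * (norm z)\<^sup>2) * (e^4 * CR + CU / s * (1 + (norm z)\<^sup>2 / s)\<^sup>2))"
            unfolding real_norm_def abs_mult by (rule mult_left_mono[OF order_trans[OF D abs_ge_self]]) simp
        qed
      qed (use Dm in simp)
      have "gauss_mean s (\<lambda>z. q z + D z) = gauss_mean s q + gauss_mean s D"
        by (intro gauss_mean_add torus_mean_integrable[OF q s0] iD)
      then have "gauss_mean s (h e s) - gauss_mean s q = gauss_mean s D" by (simp add: D_def)
      moreover have "\<bar>gauss_mean s D\<bar> \<le> gauss_mean s (\<lambda>z. e^4 * CR + CU / s * (1 + (norm z)\<^sup>2 / s)\<^sup>2)"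
        by (rule gauss_mean_mono[OF s0 iD i D])
      moreover have "gauss_mean s (\<lambda>z. e^4 * CR + CU / s * (1 + (norm z)\<^sup>2 / s)\<^sup>2) = e^4 * CR + CU / s * M"
        by (simp only: gauss_mean_add[OF i1 i2] gauss_mean_const[OF s0] gauss_mean_cmult gauss_mean_weight[OF s0] M_def)
      ultimately show ?thesis by (simp add: mult.commute)
    qed
    have e4: "e^4 / 2 > 0" using e by simp
    have "((\<lambda>s. gauss_mean s q) \<longlongrightarrow> L) at_top" using q by (simp add: torus_mean_def)
    from tendstoD[OF this e4] have ev1: "\<forall>\<^sub>F s in at_top. \<bar>gauss_mean s q - L\<bar> < e^4 / 2"
      by (simp add: dist_real_def)
    have "((\<lambda>s. CU * M / s) \<longlongrightarrow> 0) at_top"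
      by (intro tendsto_divide_0[OF tendsto_const] filterlim_at_top_imp_at_infinity filterlim_ident)
    from order_tendstoD(2)[OF this e4] have ev2: "\<forall>\<^sub>F s in at_top. CU * M / s < e^4 / 2" .
    from ev1 ev2
    show "\<forall>\<^sub>F s in at_top. \<bar>gauss_mean s (h e s) - (a * e\<^sup>2 + b * e^3)\<bar> \<le> (CR + 1) * e^4"
      using eventually_ge_at_top[of 1]
    proof eventually_elim
      case (elim s)
      from bound[OF elim(3)] elim(1,2) show ?case
        unfolding L_def[symmetric] distrib_right by linarith
    qed
  qed
qed

lemma cubic_approx_add:
  assumes "cubic_approx F a b" "cubic_approx G c d"
  shows "cubic_approx (\<lambda>e s. F e s + G e s) (a + c) (b + d)"
proof -
  obtain C where C: "\<And>e. 0 < e \<Longrightarrow> e \<le> 1 / 10 \<Longrightarrow> \<forall>\<^sub>F s in at_top. \<bar>F e s - (a * e\<^sup>2 + b * e^3)\<bar> \<le> C * e^4"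
    using assms(1) unfolding cubic_approx_def by blast
  obtain D where D: "\<And>e. 0 < e \<Longrightarrow> e \<le> 1 / 10 \<Longrightarrow> \<forall>\<^sub>F s in at_top. \<bar>G e s - (c * e\<^sup>2 + d * e^3)\<bar> \<le> D * e^4"
    using assms(2) unfolding cubic_approx_def by blast
  show ?thesis
    unfolding cubic_approx_def
  proof (intro exI[of _ "C + D"] allI impI)
    fix e :: real assume "0 < e" "e \<le> 1 / 10"
    from C[OF this] D[OF this]
    show "\<forall>\<^sub>F s in at_top. \<bar>F e s + G e s - ((a + c) * e\<^sup>2 + (b + d) * e^3)\<bar> \<le> (C + D) * e^4"
      by eventually_elim (unfold distrib_right, linarith)
  qed
qed

lemma cubic_approx_null:
  assumes "\<And>e. ((\<lambda>s. F e s) \<longlongrightarrow> 0) at_top"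
  shows "cubic_approx F 0 0"
  unfolding cubic_approx_def
proof (intro exI[of _ 1] allI impI)
  fix e :: real assume "0 < e"
  then have "e^4 > 0" by simp
  from tendstoD[OF assms[of e] this] show "\<forall>\<^sub>F s in at_top. \<bar>F e s - (0 * e\<^sup>2 + 0 * e^3)\<bar> \<le> 1 * e^4"
    by (rule eventually_mono) (simp add: dist_real_def)
qed

lemma cubic_approx_div:
  assumes "cubic_approx F a b"
  shows "cubic_approx (\<lambda>e s. c * F e s / s) 0 0"
proof -
  obtain C where C: "\<And>e. 0 < e \<Longrightarrow> e \<le> 1 / 10 \<Longrightarrow> \<forall>\<^sub>F s in at_top. \<bar>F e s - (a * e\<^sup>2 + b * e^3)\<bar> \<le> C * e^4"
    using assms unfolding cubic_approx_def by blast
  show ?thesis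
    unfolding cubic_approx_def
  proof (intro exI[of _ 1] allI impI)
    fix e :: real assume e: "0 < e" "e \<le> 1 / 10"
    define K where "K = \<bar>c\<bar> * (C * e^4 + \<bar>a * e\<^sup>2 + b * e^3\<bar>)"
    have "((\<lambda>s. K / s) \<longlongrightarrow> 0) at_top"
      by (intro tendsto_divide_0[OF tendsto_const] filterlim_at_top_imp_at_infinity filterlim_ident)
    moreover have "e^4 > 0" using e by simp
    ultimately have "\<forall>\<^sub>F s in at_top. K / s < e^4" by (rule order_tendstoD(2))
    with C[OF e] eventually_ge_at_top[of 1]
    show "\<forall>\<^sub>F s in at_top. \<bar>c * F e s / s - (0 * e\<^sup>2 + 0 * e^3)\<bar> \<le> 1 * e^4"
    proof eventually_elim
      case (elim s)
      have "\<bar>F e s\<bar> \<le> C * e^4 + \<bar>a * e\<^sup>2 + b * e^3\<bar>" using elim(1) by linarith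
      then have "\<bar>c * F e s\<bar> / s \<le> K / s"
        unfolding abs_mult K_def using elim(2) by (intro divide_right_mono mult_left_mono) auto
      then show ?case using elim by (simp add: abs_divide)
    qed
  qed
qed

lemma cubic_approx_minus: "cubic_approx F a b \<Longrightarrow> cubic_approx (\<lambda>e s. - F e s) (- a) (- b)"
  unfolding cubic_approx_def by (simp add: abs_minus_commute algebra_simps)

lemma cubic_approx_cong:
  assumes "cubic_approx F a b" "\<And>e s. 0 < e \<Longrightarrow> e \<le> 1 / 10 \<Longrightarrow> s \<ge> 1 \<Longrightarrow> G e s = F e s"
  shows "cubic_approx G a b"
proof -
  obtain C where C: "\<And>e. 0 < e \<Longrightarrow> e \<le> 1 / 10 \<Longrightarrow> \<forall>\<^sub>F s in at_top. \<bar>F e s - (a * e\<^sup>2 + b * e^3)\<bar> \<le> C * e^4"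
    using assms(1) unfolding cubic_approx_def by blast
  show ?thesis
    unfolding cubic_approx_def
  proof (intro exI[of _ C] allI impI)
    fix e :: real assume e: "0 < e" "e \<le> 1 / 10"
    from C[OF e] eventually_ge_at_top[of 1]
    show "\<forall>\<^sub>F s in at_top. \<bar>G e s - (a * e\<^sup>2 + b * e^3)\<bar> \<le> C * e^4"
      by eventually_elim (simp add: assms(2)[OF e])
  qed
qed

text \<open>The leading terms cancel, since all three are \<open>3/2 * e^2\<close>. At order
  \<open>e^5\<close> there remains
  \<open>3/2 * (- 27/16) + (- 3/4) * 3/2 + 2 * (3/2) * (9/8) = - 9/32\<close>.\<close>

lemma cubic_approx_negative:
  assumes X: "cubic_approx X (3 / 2) (- 3 / 4)" and Y: "cubic_approx Y (3 / 2) (- 27 / 16)" and W: "cubic_approx W (3 / 2) (- 9 / 8)"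
  obtains e0 where "e0 > 0" "e0 \<le> 1 / 10"
    "\<And>e. 0 < e \<Longrightarrow> e \<le> e0 \<Longrightarrow> \<forall>\<^sub>F s in at_top. X e s * Y e s - (W e s)\<^sup>2 < 0"
proof -
  \<comment> \<open>With all constants at least 1, each of them is at most their sum.\<close>
  have ex: "\<exists>C\<ge>1. \<forall>e. 0 < e \<longrightarrow> e \<le> 1 / 10 \<longrightarrow> (\<forall>\<^sub>F s in at_top. \<bar>F e s - (a * e\<^sup>2 + b * e^3)\<bar> \<le> C * e^4)"
    if "cubic_approx F a b" for F a b
  proof -
    obtain C where C: "\<And>e. 0 < e \<Longrightarrow> e \<le> 1 / 10 \<Longrightarrow> \<forall>\<^sub>F s in at_top. \<bar>F e s - (a * e\<^sup>2 + b * e^3)\<bar> \<le> C * e^4"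
      using \<open>cubic_approx F a b\<close> unfolding cubic_approx_def by blast
    have "\<forall>\<^sub>F s in at_top. \<bar>F e s - (a * e\<^sup>2 + b * e^3)\<bar> \<le> max 1 C * e^4" if "0 < e" "e \<le> 1 / 10" for e
      using C[OF that]
      by eventually_elim (erule order_trans, intro mult_right_mono, auto)
    then show ?thesis by (intro exI[of _ "max 1 C"]) auto
  qed
  obtain CX where CX: "CX \<ge> 1" "\<And>e. 0 < e \<Longrightarrow> e \<le> 1 / 10 \<Longrightarrow> \<forall>\<^sub>F s in at_top. \<bar>X e s - (3 / 2 * e\<^sup>2 + - 3 / 4 * e^3)\<bar> \<le> CX * e^4"
    using ex[OF X] by blast
  obtain CY where CY: "CY \<ge> 1" "\<And>e. 0 < e \<Longrightarrow> e \<le> 1 / 10 \<Longrightarrow> \<forall>\<^sub>F s in at_top. \<bar>Y e s - (3 / 2 * e\<^sup>2 + - 27 / 16 * e^3)\<bar> \<le> CY * e^4"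
    using ex[OF Y] by blast
  obtain CW where CW: "CW \<ge> 1" "\<And>e. 0 < e \<Longrightarrow> e \<le> 1 / 10 \<Longrightarrow> \<forall>\<^sub>F s in at_top. \<bar>W e s - (3 / 2 * e\<^sup>2 + - 9 / 8 * e^3)\<bar> \<le> CW * e^4"
    using ex[OF W] by blast
  define C where "C = CX + CY + CW"
  have C: "C \<ge> 1" using CX CY CW by (simp add: C_def)
  \<comment> \<open>After division by \<open>e^2\<close> the errors are at most
    \<open>C * e^2\<close>, hence at most \<open>e / 100\<close> for this range of \<open>e\<close>:
    small against \<open>9/32 * e\<close> even when multiplied by the coefficients below.\<close>
  define e0 where "e0 = 1 / (100 * C)"
  show thesis
  proof (rule that[of e0])
    show "e0 > 0" "e0 \<le> 1 / 10" using C by (auto simp: e0_def divide_simps)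
    fix e assume e: "0 < e" "e \<le> e0"
    then have e1: "e \<le> 1 / 10" using \<open>e0 \<le> 1 / 10\<close> by simp
    have Ce: "C * e \<le> 1 / 100" using e C by (simp add: e0_def field_simps)
    from CX(2)[OF e(1) e1] CY(2)[OF e(1) e1] CW(2)[OF e(1) e1]
    show "\<forall>\<^sub>F s in at_top. X e s * Y e s - (W e s)\<^sup>2 < 0"
    proof eventually_elim
      case (elim s)
      define x where "x = X e s / e\<^sup>2 - (3 / 2 - 3 / 4 * e)"
      define y where "y = Y e s / e\<^sup>2 - (3 / 2 - 27 / 16 * e)"
      define w where "w = W e s / e\<^sup>2 - (3 / 2 - 9 / 8 * e)"
      have Xx: "X e s = e\<^sup>2 * (3 / 2 - 3 / 4 * e + x)" and Yy: "Y e s = e\<^sup>2 * (3 / 2 - 27 / 16 * e + y)"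
        and Ww: "W e s = e\<^sup>2 * (3 / 2 - 9 / 8 * e + w)"
        using e by (auto simp: x_def y_def w_def field_simps)
      have small: "\<bar>u\<bar> \<le> e / 100" if "\<bar>F - (3 / 2 * e\<^sup>2 + c * e^3)\<bar> \<le> B * e^4" "F = e\<^sup>2 * (3 / 2 + c * e + u)" "B \<le> C"
        for u F B c
      proof -
        have "F - (3 / 2 * e\<^sup>2 + c * e^3) = e\<^sup>2 * u"
          unfolding that(2) by (simp add: power2_eq_square power3_eq_cube algebra_simps)
        then have "e\<^sup>2 * \<bar>u\<bar> \<le> B * e^4" using that(1) e by (simp add: abs_mult)
        also have "\<dots> = e\<^sup>2 * (B * e * e)" by (simp add: power2_eq_square power4_eq_xxxx)
        finally have "\<bar>u\<bar> \<le> B * e * e" using e by simp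
        also have "\<dots> \<le> C * e * e" using that(3) e by (intro mult_right_mono) auto
        also have "\<dots> \<le> 1 / 100 * e" using Ce e by (intro mult_right_mono) auto
        finally show ?thesis by simp
      qed
      have x: "\<bar>x\<bar> \<le> e / 100"
        by (rule small[OF elim(1)]) (use CX CY CW in \<open>auto simp: Xx C_def\<close>)
      have y: "\<bar>y\<bar> \<le> e / 100"
        by (rule small[OF elim(2)]) (use CX CY CW in \<open>auto simp: Yy C_def\<close>)
      have w: "\<bar>w\<bar> \<le> e / 100"
        by (rule small[OF elim(3)]) (use CX CY CW in \<open>auto simp: Ww C_def\<close>)
      have xy: "\<bar>x * y\<bar> \<le> 1 / 1000 * (e / 100)"
        unfolding abs_mult using x y e1 e by (intro mult_mono) auto
      have xe: "\<bar>x * e\<bar> \<le> e / 100 * (1 / 10)" "\<bar>y * e\<bar> \<le> e / 100 * (1 / 10)" "\<bar>w * e\<bar> \<le> e / 100 * (1 / 10)"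
        unfolding abs_mult using x y w e1 e by (intro mult_mono; auto)+
      \<comment> \<open>The terms in \<open>e^2\<close> alone cancel too: 3/4, 9/8 and 27/16 form a
        geometric progression, because each time derivative multiplies the cubic term by
        -3/2.\<close>
      have "(3 / 2 - 3 / 4 * e + x) * (3 / 2 - 27 / 16 * e + y) - (3 / 2 - 9 / 8 * e + w)\<^sup>2
        = - 9 / 32 * e + 3 / 2 * x + 3 / 2 * y - 3 * w - 27 / 16 * (x * e) - 3 / 4 * (y * e) + 9 / 4 * (w * e) + x * y - w\<^sup>2"
        by (simp add: power2_eq_square algebra_simps add_divide_distrib)
      also have "\<dots> < 0" using x y w xy xe e zero_le_power2[of w] by linarith
      finally have neg: "(3 / 2 - 3 / 4 * e + x) * (3 / 2 - 27 / 16 * e + y) - (3 / 2 - 9 / 8 * e + w)\<^sup>2 < 0" .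
      have "X e s * Y e s - (W e s)\<^sup>2
        = e^4 * ((3 / 2 - 3 / 4 * e + x) * (3 / 2 - 27 / 16 * e + y) - (3 / 2 - 9 / 8 * e + w)\<^sup>2)"
        unfolding Xx Yy Ww power_mult_distrib power2_eq_square[of "e\<^sup>2"]
        by (simp only: right_diff_distrib power2_eq_square power4_eq_xxxx mult_ac)
      then show ?case using neg e by (simp add: mult_pos_neg)
    qed
  qed
qed

text \<open>Exact identities instead of Taylor estimates: the remainder is again a polynomial in
  \<open>r\<close>, and all that is used of the reciprocal is the relation
  \<open>r * (1 + e * v) = 1\<close>.\<close>

lemma expand_r:
  fixes e v r :: real
  assumes "r * (1 + e * v) = 1"
  shows "e\<^sup>2 * r = e\<^sup>2 - e^3 * v + e^4 * (v\<^sup>2 * r)"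
    and "(2 * e\<^sup>2 + e^3 * v) * r\<^sup>2 = 2 * e\<^sup>2 - 3 * (e^3 * v) + e^4 * (v\<^sup>2 * (4 + 3 * (e * v)) * r\<^sup>2)"
    and "e\<^sup>2 * r^3 = e\<^sup>2 - 3 * (e^3 * v) + e^4 * (v\<^sup>2 * (6 + 8 * (e * v) + 3 * (e\<^sup>2 * v\<^sup>2)) * r^3)"
  using assms by algebra+

text \<open>The outer factor is the modulation of the density; it absorbs one of the reciprocals in
  the square of a second log-derivative.\<close>

lemma expand_square:
  fixes e v r :: real
  assumes "r * (1 + e * v) = 1"
  shows "(1 + e * v) * (e * a * r - e\<^sup>2 * b * r\<^sup>2)\<^sup>2
    = e\<^sup>2 * a\<^sup>2 + e^3 * (- (v * a * a + 2 * (a * b)))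
      + e^4 * (v\<^sup>2 * r * a\<^sup>2 + 2 * (v * r * (1 + r) * a * b) + r^3 * b\<^sup>2)"
  using assms by algebra

lemma expand_square3:
  fixes e v r :: real
  assumes "r * (1 + e * v) = 1"
  shows "(1 + e * v) * (e * a * r - e\<^sup>2 * b * r\<^sup>2 + 2 * e^3 * p * r^3)\<^sup>2
    = e\<^sup>2 * a\<^sup>2 + e^3 * (- (v * a * a + 2 * (a * b)))
      + e^4 * (v\<^sup>2 * r * a\<^sup>2 + 2 * (v * r * (1 + r) * a * b) + r * (r\<^sup>2 * b\<^sup>2 + 4 * (r\<^sup>2 * (a * p)))
        - 4 * (e * r^4 * (b * p)) + 4 * (e\<^sup>2 * r^5 * p\<^sup>2))"
  using assms by algebra

lemma expand_cube:
  fixes e v r :: real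
  assumes "r * (1 + e * v) = 1"
  shows "(1 + e * v) * ((e * a * r - e\<^sup>2 * m * r\<^sup>2) * (e * b * r - e\<^sup>2 * n * r\<^sup>2) * (e * c * r - e\<^sup>2 * p * r\<^sup>2))
    = e^3 * (a * b * c) + e^4 * (- (r * (m * b * c + a * n * c + a * b * p))
      + e * r\<^sup>2 * (m * n * c + m * b * p + a * n * p) - e\<^sup>2 * r^3 * (m * n * p)
      - v * r * (1 + r) * ((a - e * m * r) * (b - e * n * r) * (c - e * p * r)))"
proof -
  have "(1 + e * v) * ((e * a * r - e\<^sup>2 * m * r\<^sup>2) * (e * b * r - e\<^sup>2 * n * r\<^sup>2) * (e * c * r - e\<^sup>2 * p * r\<^sup>2))
    = (r * (1 + e * v)) * r\<^sup>2 * (e^3 * ((a - e * m * r) * (b - e * n * r) * (c - e * p * r)))"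
    by (simp add: power2_eq_square power3_eq_cube algebra_simps)
  \<comment> \<open>One reciprocal is absorbed by the density. Replacing the remaining
    \<open>r^2\<close> by 1 costs a factor \<open>e\<close>, which moves the difference into the
    remainder.\<close>
  also have "\<dots> = (1 - e * (v * r * (1 + r))) * (e^3 * ((a - e * m * r) * (b - e * n * r) * (c - e * p * r)))"
  proof -
    have "r\<^sup>2 = 1 - e * (v * r * (1 + r))" using assms by algebra
    then show ?thesis unfolding assms by simp
  qed
  finally show ?thesis
    by (simp add: power2_eq_square power3_eq_cube power4_eq_xxxx algebra_simps)
qed

lemma torus_mean_zero: "torus_mean (\<lambda>_. 0) 0"
  using torus_mean_cmult[OF torus_mean_lap, of 0] by simp

abbreviation recip :: "real \<Rightarrow> real^2 \<Rightarrow> real" where "recip e z \<equiv> inverse (1 + e * V z)"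

lemma recip_eq:
  assumes "0 \<le> e" "e \<le> 1 / 10"
  shows "recip e z * (1 + e * V z) = 1"
  using one_plus_V_ge[OF assms, of z] by simp

lemma amp_0:

  \<comment> \<open>Expansion of the flow at time zero\<close>
  assumes "s > 0"
  shows "amp s e 0 = e" "amp1 s e 0 = - e / 2" "amp2 s e 0 = (1 / 4 + 1 / s) * e"
  using assms by (simp_all add: amp_def amp1_def amp2_def power2_eq_square power3_eq_cube)

text \<open>The shape expected by \<open>cubic_approx_gauss_mean\<close>: first the part that
  survives for large \<open>s\<close>, then \<open>1 / s\<close> times a part in which the squared
  norm occurs only divided by \<open>s\<close>.\<close>

lemma dens_0:
  assumes "s > 0"
  shows "dens s e 0 z = gradV_sq z * (e\<^sup>2 * recip e z)"
    and "dens1 s e 0 z = gradV_sq z * (- (1 / 2) * ((2 * e\<^sup>2 + e^3 * V z) * (recip e z)\<^sup>2))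
      + - (1 / 2) * (e\<^sup>2 * recip e z * gradV_sq z) * ((norm z)\<^sup>2 / s) * (1 / s)"
    and "dens2 s e 0 z = gradV_sq z * (1 / 4 * ((2 * e\<^sup>2 + e^3 * V z) * (recip e z)\<^sup>2) + 1 / 2 * (e\<^sup>2 * (recip e z)^3))
      + (1 / 4 * (1 / s * (e\<^sup>2 * recip e z * gradV_sq z)) * ((norm z)\<^sup>2 / s)\<^sup>2
        + 1 / 2 * ((2 * e\<^sup>2 + e^3 * V z) * (recip e z)\<^sup>2 * gradV_sq z) * ((norm z)\<^sup>2 / s)
        + (2 * e\<^sup>2 + e^3 * V z) * (recip e z)\<^sup>2 * gradV_sq z) * (1 / s)"
proof -
  define n where "n = (norm z)\<^sup>2 / s"
  have n: "(norm z)\<^sup>2 / (2 * s\<^sup>2) = n * (1 / s) / 2" "(norm z)\<^sup>2 / s\<^sup>2 = n * (1 / s)"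
    by (simp_all add: n_def power2_eq_square)
  have r: "ratio (V z) e = e\<^sup>2 * recip e z" "ratio1 (V z) e = (2 * e + e\<^sup>2 * V z) * (recip e z)\<^sup>2"
    "ratio2 (V z) e = 2 * (recip e z)^3"
    by (simp_all add: ratio_def ratio1_def ratio2_def divide_inverse power_inverse)
  have E: "e * ((2 * e + e\<^sup>2 * V z) * (recip e z)\<^sup>2) = (2 * e\<^sup>2 + e^3 * V z) * (recip e z)\<^sup>2"
    by (simp add: power2_eq_square power3_eq_cube algebra_simps)
  show "dens s e 0 z = gradV_sq z * (e\<^sup>2 * recip e z)"
    unfolding dens_def amp_0[OF assms] r ..
  show "dens1 s e 0 z = gradV_sq z * (- (1 / 2) * ((2 * e\<^sup>2 + e^3 * V z) * (recip e z)\<^sup>2))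
      + - (1 / 2) * (e\<^sup>2 * recip e z * gradV_sq z) * ((norm z)\<^sup>2 / s) * (1 / s)"
    unfolding dens1_def amp_0[OF assms] r n n_def[symmetric] E[symmetric]
    by (simp add: algebra_simps)
  show "dens2 s e 0 z = gradV_sq z * (1 / 4 * ((2 * e\<^sup>2 + e^3 * V z) * (recip e z)\<^sup>2) + 1 / 2 * (e\<^sup>2 * (recip e z)^3))
      + (1 / 4 * (1 / s * (e\<^sup>2 * recip e z * gradV_sq z)) * ((norm z)\<^sup>2 / s)\<^sup>2
        + 1 / 2 * ((2 * e\<^sup>2 + e^3 * V z) * (recip e z)\<^sup>2 * gradV_sq z) * ((norm z)\<^sup>2 / s)
        + (2 * e\<^sup>2 + e^3 * V z) * (recip e z)\<^sup>2 * gradV_sq z) * (1 / s)"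
    unfolding dens2_def amp_0[OF assms] r n n_def[symmetric] E[symmetric]
    by (simp add: power_mult_distrib power_divide power2_eq_square algebra_simps)
qed

lemma cubic_approx_dens: "cubic_approx (\<lambda>e s. gauss_mean s (dens s e 0)) (3 / 2) (- 3 / 4)"
proof (rule cubic_approx_gauss_mean[where ?p1.0 = "\<lambda>_. 0" and ?p2.0 = gradV_sq and ?p3.0 = "\<lambda>z. - 1 * (V z * gradV_sq z)"
      and R = "\<lambda>e s z. gradV_sq z * ((V z)\<^sup>2 * recip e z)" and U = "\<lambda>e s z. 0"])
  show "torus_mean (\<lambda>z. - 1 * (V z * gradV_sq z)) (- 3 / 4)"
    using torus_mean_cmult[OF V_gradV_sq_torus_mean, of "- 1"] by simp
  fix e s :: real and z assume e: "0 < e" "e \<le> 1 / 10" and s: "s \<ge> 1"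
  have r: "recip e z * (1 + e * V z) = 1" using recip_eq[of e z] e by simp
  show "dens s e 0 z = e * 0 + e\<^sup>2 * gradV_sq z + e^3 * (- 1 * (V z * gradV_sq z))
      + e^4 * (gradV_sq z * ((V z)\<^sup>2 * recip e z)) + 0 * (1 / s)"
    using s by (subst dens_0, simp, subst expand_r(1)[OF r]) (simp add: algebra_simps)
qed (auto intro!: torus_mean_zero gradV_sq_torus_mean weight_bdd_unif_bdd unif_bdd_intros)

text \<open>A time derivative acts on \<open>e^k\<close> as multiplication by
  \<open>- k / 2\<close>, so 3/2 and -3/4 become -3/2 and 9/8.\<close>

lemma cubic_approx_dens1: "cubic_approx (\<lambda>e s. gauss_mean s (dens1 s e 0)) (- 3 / 2) (9 / 8)"
proof (rule cubic_approx_gauss_mean[where ?p1.0 = "\<lambda>_. 0" and ?p2.0 = "\<lambda>z. - 1 * gradV_sq z" and ?p3.0 = "\<lambda>z. 3 / 2 * (V z * gradV_sq z)"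
      and R = "\<lambda>e s z. gradV_sq z * (- (1 / 2) * ((V z)\<^sup>2 * (4 + 3 * (e * V z)) * (recip e z)\<^sup>2))"
      and U = "\<lambda>e s z. - (1 / 2) * (e\<^sup>2 * recip e z * gradV_sq z) * ((norm z)\<^sup>2 / s)"])
  show "torus_mean (\<lambda>z. - 1 * gradV_sq z) (- 3 / 2)"
    using torus_mean_cmult[OF gradV_sq_torus_mean, of "- 1"] by simp
  show "torus_mean (\<lambda>z. 3 / 2 * (V z * gradV_sq z)) (9 / 8)"
    using torus_mean_cmult[OF V_gradV_sq_torus_mean, of "3 / 2"] by simp
  show "weight_bdd (\<lambda>e s z. - (1 / 2) * (e\<^sup>2 * recip e z * gradV_sq z) * ((norm z)\<^sup>2 / s))"
    by (intro weight_bdd_unif_bdd_mult weight_bdd_norm unif_bdd_intros)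
  fix e s :: real and z assume e: "0 < e" "e \<le> 1 / 10" and s: "s \<ge> 1"
  have r: "recip e z * (1 + e * V z) = 1" using recip_eq[of e z] e by simp
  show "dens1 s e 0 z = e * 0 + e\<^sup>2 * (- 1 * gradV_sq z) + e^3 * (3 / 2 * (V z * gradV_sq z))
      + e^4 * (gradV_sq z * (- (1 / 2) * ((V z)\<^sup>2 * (4 + 3 * (e * V z)) * (recip e z)\<^sup>2)))
      + - (1 / 2) * (e\<^sup>2 * recip e z * gradV_sq z) * ((norm z)\<^sup>2 / s) * (1 / s)"
    using s by (subst dens_0, simp, subst expand_r(2)[OF r]) (simp add: algebra_simps)
qed (rule torus_mean_zero dens_measurable | intro unif_bdd_intros)+

lemma cubic_approx_dens2: "cubic_approx (\<lambda>e s. gauss_mean s (dens2 s e 0)) (3 / 2) (- 27 / 16)"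
proof (rule cubic_approx_gauss_mean[where ?p1.0 = "\<lambda>_. 0" and ?p2.0 = gradV_sq and ?p3.0 = "\<lambda>z. - 9 / 4 * (V z * gradV_sq z)"
      and R = "\<lambda>e s z. gradV_sq z * (1 / 4 * ((V z)\<^sup>2 * (4 + 3 * (e * V z)) * (recip e z)\<^sup>2)
        + 1 / 2 * ((V z)\<^sup>2 * (6 + 8 * (e * V z) + 3 * (e\<^sup>2 * (V z)\<^sup>2)) * (recip e z)^3))"
      and U = "\<lambda>e s z. 1 / 4 * (1 / s * (e\<^sup>2 * recip e z * gradV_sq z)) * ((norm z)\<^sup>2 / s)\<^sup>2
        + 1 / 2 * ((2 * e\<^sup>2 + e^3 * V z) * (recip e z)\<^sup>2 * gradV_sq z) * ((norm z)\<^sup>2 / s)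
        + (2 * e\<^sup>2 + e^3 * V z) * (recip e z)\<^sup>2 * gradV_sq z"])
  show "torus_mean (\<lambda>z. - 9 / 4 * (V z * gradV_sq z)) (- 27 / 16)"
    using torus_mean_cmult[OF V_gradV_sq_torus_mean, of "- 9 / 4"] by simp
  show "weight_bdd (\<lambda>e s z. 1 / 4 * (1 / s * (e\<^sup>2 * recip e z * gradV_sq z)) * ((norm z)\<^sup>2 / s)\<^sup>2
        + 1 / 2 * ((2 * e\<^sup>2 + e^3 * V z) * (recip e z)\<^sup>2 * gradV_sq z) * ((norm z)\<^sup>2 / s)
        + (2 * e\<^sup>2 + e^3 * V z) * (recip e z)\<^sup>2 * gradV_sq z)"
    by (rule weight_bdd_add[OF weight_bdd_add[OF weight_bdd_unif_bdd_mult[OF _ weight_bdd_norm(2)] weight_bdd_unif_bdd_mult[OF _ weight_bdd_norm(1)]] weight_bdd_unif_bdd]; intro unif_bdd_intros)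
  fix e s :: real and z assume e: "0 < e" "e \<le> 1 / 10" and s: "s \<ge> 1"
  have r: "recip e z * (1 + e * V z) = 1" using recip_eq[of e z] e by simp
  have main: "gradV_sq z * (1 / 4 * ((2 * e\<^sup>2 + e^3 * V z) * (recip e z)\<^sup>2) + 1 / 2 * (e\<^sup>2 * (recip e z)^3))
    = e * 0 + e\<^sup>2 * gradV_sq z + e^3 * (- 9 / 4 * (V z * gradV_sq z))
      + e^4 * (gradV_sq z * (1 / 4 * ((V z)\<^sup>2 * (4 + 3 * (e * V z)) * (recip e z)\<^sup>2)
        + 1 / 2 * ((V z)\<^sup>2 * (6 + 8 * (e * V z) + 3 * (e\<^sup>2 * (V z)\<^sup>2)) * (recip e z)^3)))"
  \<comment> \<open>The cubic coefficient -9/4 is \<open>1/4 * (- 3) + 1/2 * (- 3)\<close>, that is,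
    minus the square of 3/2.\<close>
  proof -
    have alg: "g * (1 / 4 * (2 * a - 3 * (b * v) + c * p) + 1 / 2 * (a - 3 * (b * v) + c * q))
      = e * 0 + a * g + b * (- 9 / 4 * (v * g)) + c * (g * (1 / 4 * p + 1 / 2 * q))" for g a b c p q v :: real
      by (simp add: algebra_simps add_divide_distrib)
    show ?thesis
      unfolding expand_r(2)[OF r] expand_r(3)[OF r] by (rule alg)
  qed
  show "dens2 s e 0 z = e * 0 + e\<^sup>2 * gradV_sq z + e^3 * (- 9 / 4 * (V z * gradV_sq z))
      + e^4 * (gradV_sq z * (1 / 4 * ((V z)\<^sup>2 * (4 + 3 * (e * V z)) * (recip e z)\<^sup>2)
        + 1 / 2 * ((V z)\<^sup>2 * (6 + 8 * (e * V z) + 3 * (e\<^sup>2 * (V z)\<^sup>2)) * (recip e z)^3)))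
      + (1 / 4 * (1 / s * (e\<^sup>2 * recip e z * gradV_sq z)) * ((norm z)\<^sup>2 / s)\<^sup>2
        + 1 / 2 * ((2 * e\<^sup>2 + e^3 * V z) * (recip e z)\<^sup>2 * gradV_sq z) * ((norm z)\<^sup>2 / s)
        + (2 * e\<^sup>2 + e^3 * V z) * (recip e z)\<^sup>2 * gradV_sq z) * (1 / s)"
    using s unfolding main[symmetric] by (intro dens_0) simp
qed (rule torus_mean_zero gradV_sq_torus_mean dens_measurable | intro unif_bdd_intros)+

text \<open>The Fisher information of the heat flow, up to the normalising constant of the density.\<close>

definition flow :: "real \<Rightarrow> real \<Rightarrow> real \<Rightarrow> real" where
  "flow s e t = 2 / (s + t) + 3 * e * exp (- s / 2) * (2 / (s + t) + s\<^sup>2 / (s + t)\<^sup>2)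
    + gauss_int s t (dens s e t) / (2 * pi * (s + t))"

definition flow1 :: "real \<Rightarrow> real \<Rightarrow> real \<Rightarrow> real" where
  "flow1 s e t = - 2 / (s + t)\<^sup>2 + 3 * e * exp (- s / 2) * (- 2 / (s + t)\<^sup>2 - 2 * s\<^sup>2 / (s + t)^3)
    + (gauss_int s t (dens1 s e t) / (2 * pi * (s + t)) - gauss_int s t (dens s e t) / (2 * pi * (s + t)\<^sup>2))"

definition flow2 :: "real \<Rightarrow> real \<Rightarrow> real \<Rightarrow> real" where
  "flow2 s e t = 4 / (s + t)^3 + 3 * e * exp (- s / 2) * (4 / (s + t)^3 + 6 * s\<^sup>2 / (s + t)^4)
    + (gauss_int s t (dens2 s e t) / (2 * pi * (s + t)) - 2 * gauss_int s t (dens1 s e t) / (2 * pi * (s + t)\<^sup>2)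
      + 2 * gauss_int s t (dens s e t) / (2 * pi * (s + t)^3))"

lemma flow_deriv:
  assumes "s \<ge> 1" "t \<ge> 0" "0 \<le> e" "e \<le> 1 / 10"
  shows "(flow s e has_real_derivative flow1 s e t) (at t within {0..})"
    and "(flow1 s e has_real_derivative flow2 s e t) (at t within {0..})"
proof -
  have nz: "s + t \<noteq> 0" using assms by simp
  have p: "((\<lambda>t. c / (s + t)) has_real_derivative - c / (s + t)\<^sup>2) (at t within {0..})"
    "((\<lambda>t. c / (s + t)\<^sup>2) has_real_derivative - 2 * c / (s + t)^3) (at t within {0..})"
    "((\<lambda>t. c / (s + t)^3) has_real_derivative - 3 * c / (s + t)^4) (at t within {0..})" for c
    using nz by (auto intro!: derivative_eq_intros simp: divide_simps)
      (simp_all add: power2_eq_square power3_eq_cube power4_eq_xxxx algebra_simps)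
  note g = gauss_int_dens_deriv[OF assms]
  have q: "((\<lambda>t. G t / (2 * pi * (s + t))) has_real_derivative G' / (2 * pi * (s + t)) - G t / (2 * pi * (s + t)\<^sup>2)) (at t within {0..})"
    "((\<lambda>t. G t / (2 * pi * (s + t)\<^sup>2)) has_real_derivative G' / (2 * pi * (s + t)\<^sup>2) - 2 * G t / (2 * pi * (s + t)^3)) (at t within {0..})"
    if G: "(G has_real_derivative G') (at t within {0..})" for G G'
    using DERIV_mult[OF G p(1)[of "1 / (2 * pi)"]] DERIV_mult[OF G p(2)[of "1 / (2 * pi)"]]
    by (simp_all add: algebra_simps)
  show "(flow s e has_real_derivative flow1 s e t) (at t within {0..})"
    unfolding flow_def[abs_def] flow1_def
    by (rule derivative_eq_intros p q[OF g(1)] refl)+ simp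
  show "(flow1 s e has_real_derivative flow2 s e t) (at t within {0..})"
    unfolding flow1_def[abs_def] flow2_def
    by (rule derivative_eq_intros p q(1)[OF g(2)] q(2)[OF g(1)] refl)+ (simp add: algebra_simps)
qed

lemma flow2_tendsto:
  assumes "s \<ge> 1" "0 \<le> e" "e \<le> 1 / 10"
  shows "(flow2 s e \<longlongrightarrow> flow2 s e 0) (at 0 within {0..})"
proof -
  have "((\<lambda>t. gauss_int s t (dens s e t)) \<longlongrightarrow> gauss_int s 0 (dens s e 0)) (at 0 within {0..})"
    "((\<lambda>t. gauss_int s t (dens1 s e t)) \<longlongrightarrow> gauss_int s 0 (dens1 s e 0)) (at 0 within {0..})"
    using gauss_int_dens_deriv[OF assms(1) order_refl assms(2,3)]
    by (auto dest!: DERIV_continuous simp: continuous_within)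
  then show ?thesis
    unfolding flow2_def[abs_def]
    by (intro tendsto_intros gauss_int_dens2_tendsto assms) (use assms in auto)
qed

lemma gauss_int_0: "s > 0 \<Longrightarrow> gauss_int s 0 h = 2 * pi * s * gauss_mean s h"
  by (simp add: gauss_int_def gauss_mean_def power2_eq_square)

lemma inverse_s_tendsto: "((\<lambda>s::real. 1 / s) \<longlongrightarrow> 0) at_top"
  by (intro tendsto_divide_0[OF tendsto_const] filterlim_at_top_imp_at_infinity filterlim_ident)

lemma exp_s_tendsto: "((\<lambda>s::real. exp (- s / 2)) \<longlongrightarrow> 0) at_top"
proof -
  have "filterlim (\<lambda>s::real. s * (1 / 2)) at_top at_top"
    by (intro filterlim_at_top_mult_tendsto_pos[OF tendsto_const _ filterlim_ident]) simp
  then have "filterlim (\<lambda>s::real. - (s * (1 / 2))) at_bot at_top"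
    by (rule filterlim_compose[OF filterlim_uminus_at_bot_at_top])
  from filterlim_compose[OF exp_at_bot this] show ?thesis by simp
qed

text \<open>The explicit terms, contributed by the gradient of the Gaussian, vanish for large
  \<open>s\<close>; only the wave part is left.\<close>

lemma cubic_approx_flow: "cubic_approx (\<lambda>e s. flow s e 0) (3 / 2) (- 3 / 4)"
proof (rule cubic_approx_cong)
  have "cubic_approx (\<lambda>e s. 2 * (1 / s) + 3 * e * exp (- s / 2) * (2 * (1 / s) + 1)) 0 0"
    by (rule cubic_approx_null, (rule inverse_s_tendsto exp_s_tendsto tendsto_eq_intros refl)+) simp
  from cubic_approx_add[OF this cubic_approx_dens]
  show "cubic_approx (\<lambda>e s. 2 * (1 / s) + 3 * e * exp (- s / 2) * (2 * (1 / s) + 1) + gauss_mean s (dens s e 0)) (3 / 2) (- 3 / 4)"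
    by simp
qed (simp add: flow_def gauss_int_0)

text \<open>With the minus sign the derivative takes the place of \<open>calQ\<close>, and
  \<open>cubic_approx_negative\<close> applies to both situations.\<close>

lemma cubic_approx_flow1: "cubic_approx (\<lambda>e s. - flow1 s e 0) (3 / 2) (- 9 / 8)"
proof (rule cubic_approx_cong)
  have "cubic_approx (\<lambda>e s. - 2 * (1 / s)\<^sup>2 + 3 * e * exp (- s / 2) * (- 2 * (1 / s)\<^sup>2 - 2 * (1 / s))) 0 0"
    by (rule cubic_approx_null, (rule inverse_s_tendsto exp_s_tendsto tendsto_eq_intros refl)+) simp
  from cubic_approx_minus[OF cubic_approx_add[OF cubic_approx_add[OF this cubic_approx_dens1] cubic_approx_div[OF cubic_approx_dens, of "- 1"]]]
  show "cubic_approx (\<lambda>e s. - (- 2 * (1 / s)\<^sup>2 + 3 * e * exp (- s / 2) * (- 2 * (1 / s)\<^sup>2 - 2 * (1 / s))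
    + gauss_mean s (dens1 s e 0) + - 1 * gauss_mean s (dens s e 0) / s)) (3 / 2) (- 9 / 8)"
    by simp
qed (simp add: flow1_def gauss_int_0 power_divide power2_eq_square power3_eq_cube)

lemma cubic_approx_flow2: "cubic_approx (\<lambda>e s. flow2 s e 0) (3 / 2) (- 27 / 16)"
proof (rule cubic_approx_cong)
  have "cubic_approx (\<lambda>e s. 4 * (1 / s)^3 + 3 * e * exp (- s / 2) * (4 * (1 / s)^3 + 6 * (1 / s)\<^sup>2)) 0 0"
    by (rule cubic_approx_null, (rule inverse_s_tendsto exp_s_tendsto tendsto_eq_intros refl)+) simp
  from cubic_approx_add[OF cubic_approx_add[OF cubic_approx_add[OF this cubic_approx_dens2] cubic_approx_div[OF cubic_approx_dens1, of "- 2"]]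
      cubic_approx_div[OF cubic_approx_div[OF cubic_approx_dens, of 1], of 2]]
  show "cubic_approx (\<lambda>e s. 4 * (1 / s)^3 + 3 * e * exp (- s / 2) * (4 * (1 / s)^3 + 6 * (1 / s)\<^sup>2)
    + gauss_mean s (dens2 s e 0) + - 2 * gauss_mean s (dens1 s e 0) / s + 2 * (1 * gauss_mean s (dens s e 0) / s) / s) (3 / 2) (- 27 / 16)"
    by simp
qed (simp add: flow2_def gauss_int_0 power_divide power2_eq_square power3_eq_cube power4_eq_xxxx)

section \<open>Expansion of the functionals of the Hessian\<close>

definition kdelta :: "2 \<Rightarrow> 2 \<Rightarrow> real" where "kdelta i j = (if i = j then 1 else 0)"

text \<open>The Hessian of \<open>ln (1 + e * V z)\<close>, the wave part of the log-density; the
  Gaussian part only adds \<open>1 / s\<close> on the diagonal of the negative Hessian.\<close>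

definition hess_ln :: "real \<Rightarrow> 2 \<Rightarrow> 2 \<Rightarrow> real^2 \<Rightarrow> real" where
  "hess_ln e i j z = e * V2 i j z * recip e z - e\<^sup>2 * (V1 i z * V1 j z) * (recip e z)\<^sup>2"

definition sym_grad_hess :: "2 \<Rightarrow> 2 \<Rightarrow> 2 \<Rightarrow> real^2 \<Rightarrow> real" where
  "sym_grad_hess i j k z = V2 i j z * V1 k z + V2 k i z * V1 j z + V2 k j z * V1 i z"

lemma V2_commute: "V2 i j z = V2 j i z"
  by (simp add: V2_def mult.commute)

lemma hess_ln_commute: "hess_ln e i j z = hess_ln e j i z"
  by (simp add: hess_ln_def V2_commute[of i j] mult.commute)

lemma kdelta_commute: "kdelta i j = kdelta j i"
  by (simp add: kdelta_def)

lemma unif_bdd_hess_ln: "unif_bdd (\<lambda>e s. hess_ln e i j)"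
  unfolding hess_ln_def by (intro unif_bdd_intros)

lemma unif_bdd_sym_grad_hess: "unif_bdd (\<lambda>e s. sym_grad_hess i j k)"
  unfolding sym_grad_hess_def by (intro unif_bdd_intros)

lemma hess_ln_measurable [measurable]: "hess_ln e i j \<in> borel_measurable borel"
  unfolding hess_ln_def by measurable

lemma sym_grad_hess_measurable [measurable]: "sym_grad_hess i j k \<in> borel_measurable borel"
  unfolding sym_grad_hess_def by measurable

lemma negHess_packet_eq:
  assumes "A > 0" "0 \<le> e" "e \<le> 1 / 10"
  shows "negHess (packet A (1 / (2 * s)) e 1) i j z = kdelta i j * (1 / s) - hess_ln e i j z"
  unfolding negHess_packet[OF assms] hess_ln_def kdelta_def by (simp add: mult.assoc)

text \<open>
  The integrands of \<open>calI\<close>, \<open>calQ\<close> and \<open>calD\<close>, up to the Gaussian factor of the density.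
\<close>

definition tr_H :: "real \<Rightarrow> real \<Rightarrow> real^2 \<Rightarrow> real" where
  "tr_H e s z = (1 + e * V z) * (\<Sum>i\<in>UNIV. kdelta i i * (1 / s) - hess_ln e i i z)"

definition sq_H :: "real \<Rightarrow> real \<Rightarrow> real^2 \<Rightarrow> real" where
  "sq_H e s z = (1 + e * V z) * (\<Sum>i\<in>UNIV. \<Sum>j\<in>UNIV. (kdelta i j * (1 / s) - hess_ln e i j z)\<^sup>2)"

definition cub_H :: "real \<Rightarrow> real \<Rightarrow> real^2 \<Rightarrow> real" where
  "cub_H e s z = (1 + e * V z) * (\<Sum>i\<in>UNIV. \<Sum>j\<in>UNIV. \<Sum>k\<in>UNIV.
    (e * V3 i j k z * recip e z - e\<^sup>2 * sym_grad_hess i j k z * (recip e z)\<^sup>2 + 2 * e^3 * (V1 i z * V1 j z * V1 k z) * (recip e z)^3)\<^sup>2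
    + 2 * ((kdelta i j * (1 / s) - hess_ln e i j z) * (kdelta j k * (1 / s) - hess_ln e j k z) * (kdelta k i * (1 / s) - hess_ln e k i z)))"

lemma unif_bdd_H: "unif_bdd tr_H" "unif_bdd sq_H" "unif_bdd cub_H"
  unfolding tr_H_def sq_H_def cub_H_def
  by (intro unif_bdd_intros unif_bdd_sum unif_bdd_hess_ln unif_bdd_sym_grad_hess finite)+

lemma H_measurable [measurable]:
  "tr_H e s \<in> borel_measurable borel" "sq_H e s \<in> borel_measurable borel" "cub_H e s \<in> borel_measurable borel"
  unfolding tr_H_def sq_H_def cub_H_def by measurable

lemma packet_integral:
  assumes "unif_bdd h" "h e s \<in> borel_measurable borel" "A > 0" "0 \<le> e" "e \<le> 1 / 10" "s \<ge> 1"
    "\<And>z. h e s z = (1 + e * V z) * T z"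
  shows "integrable lborel (\<lambda>x. T x * packet A (1 / (2 * s)) e 1 x)"
    and "(\<integral>x. T x * packet A (1 / (2 * s)) e 1 x \<partial>lborel) = 2 * pi * s * A * gauss_mean s (h e s)"
proof -
  have eq: "(\<lambda>x. T x * packet A (1 / (2 * s)) e 1 x) = (\<lambda>x. A * (exp (- (1 / (2 * s)) * (norm x)\<^sup>2) * h e s x))"
    by (simp add: fun_eq_iff packet_def assms(7) mult_ac)
  obtain C where C: "\<And>z. \<bar>h e s z\<bar> \<le> C" using assms(1,4-6) unfolding unif_bdd_def by meson
  have "s > 0" using assms(6) by simp
  from gauss_mean_integrable_bounded[OF this assms(2) C]
  have "integrable lborel (\<lambda>x. exp (- (1 / (2 * s)) * (norm x)\<^sup>2) * h e s x)" .
  then show "integrable lborel (\<lambda>x. T x * packet A (1 / (2 * s)) e 1 x)"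
    unfolding eq by (rule integrable_mult_right)
  show "(\<integral>x. T x * packet A (1 / (2 * s)) e 1 x \<partial>lborel) = 2 * pi * s * A * gauss_mean s (h e s)"
    unfolding eq integral_mult_right_zero gauss_mean_def using assms by simp
qed

lemma H_factor:
  fixes s :: real
  assumes "A > 0" "0 \<le> e" "e \<le> 1 / 10"
  defines "f \<equiv> packet A (1 / (2 * s)) e 1"
  shows "tr_H e s z = (1 + e * V z) * trH f z"
    and "sq_H e s z = (1 + e * V z) * trH2 f z"
    and "cub_H e s z = (1 + e * V z) * (gradH_sq f z + 2 * trH3 f z)"
proof -
  note H = negHess_packet_eq[OF assms(1-3)]
  show "tr_H e s z = (1 + e * V z) * trH f z"
    unfolding tr_H_def trH_def f_def H ..
  show "sq_H e s z = (1 + e * V z) * trH2 f z"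
    unfolding sq_H_def trH2_def f_def H power2_eq_square
    by (simp only: hess_ln_commute kdelta_commute)
  have pd: "(pd k (negHess f i j) z)\<^sup>2 = (e * V3 i j k z * recip e z - e\<^sup>2 * sym_grad_hess i j k z * (recip e z)\<^sup>2
      + 2 * e^3 * (V1 i z * V1 j z * V1 k z) * (recip e z)^3)\<^sup>2" for i j k
    unfolding f_def pd_negHess_packet[OF assms(1-3)] power2_minus sym_grad_hess_def by (simp only: mult.assoc)
  show "cub_H e s z = (1 + e * V z) * (gradH_sq f z + 2 * trH3 f z)"
    unfolding cub_H_def gradH_sq_def trH3_def pd unfolding f_def H
    by (simp only: sum.distrib sum_distrib_left)
qed

text \<open>Up to a multiple of the Laplacian of \<open>V\<close>, which has mean zero, and a term
  of order \<open>1 / s\<close>, this is the wave part of the Fisher integrand. Hence the same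
  coefficients as for \<open>flow\<close>.\<close>

lemma cubic_approx_tr_H: "cubic_approx (\<lambda>e s. gauss_mean s (tr_H e s)) (3 / 2) (- 3 / 4)"
proof (rule cubic_approx_gauss_mean[where ?p1.0 = "\<lambda>z. - 1 * (\<Sum>i\<in>UNIV. V2 i i z)" and ?p2.0 = gradV_sq
      and ?p3.0 = "\<lambda>z. - 1 * (V z * gradV_sq z)"
      and R = "\<lambda>e s z. gradV_sq z * ((V z)\<^sup>2 * recip e z)" and U = "\<lambda>e s z. 2 * (1 + e * V z)"])
  show "torus_mean (\<lambda>z. - 1 * (V z * gradV_sq z)) (- 3 / 4)"
    using torus_mean_cmult[OF V_gradV_sq_torus_mean, of "- 1"] by simp
  show "torus_mean (\<lambda>z. - 1 * (\<Sum>i\<in>UNIV. V2 i i z)) 0"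
    using torus_mean_cmult[OF torus_mean_lap, of "- 1"] by simp
  fix e s :: real and z assume e: "0 < e" "e \<le> 1 / 10" and s: "s \<ge> 1"
  have r: "recip e z * (1 + e * V z) = 1" using recip_eq[of e z] e by simp
  have step: "(1 + e * V z) * (i - (e * a * recip e z - e\<^sup>2 * b * (recip e z)\<^sup>2)) = (1 + e * V z) * i - e * a + e\<^sup>2 * recip e z * b" for a b i
    using r by algebra
  have "tr_H e s z = 2 * (1 + e * V z) * (1 / s) - e * (\<Sum>i\<in>UNIV. V2 i i z) + e\<^sup>2 * recip e z * gradV_sq z"
    unfolding tr_H_def sum_distrib_left hess_ln_def step
    by (simp add: sum_2 kdelta_def gradV_sq_def power2_eq_square algebra_simps)
  then show "tr_H e s z = e * (- 1 * (\<Sum>i\<in>UNIV. V2 i i z)) + e\<^sup>2 * gradV_sq z + e^3 * (- 1 * (V z * gradV_sq z))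
      + e^4 * (gradV_sq z * ((V z)\<^sup>2 * recip e z)) + 2 * (1 + e * V z) * (1 / s)"
    unfolding expand_r(1)[OF r] by (simp add: algebra_simps)
qed (auto intro!: gradV_sq_torus_mean weight_bdd_unif_bdd unif_bdd_intros)

lemma cubic_approx_sq_H: "cubic_approx (\<lambda>e s. gauss_mean s (sq_H e s)) (3 / 2) (- 9 / 8)"
proof (rule cubic_approx_gauss_mean[where ?p1.0 = "\<lambda>_. 0" and ?p2.0 = "\<lambda>z. \<Sum>i\<in>UNIV. \<Sum>j\<in>UNIV. (V2 i j z)\<^sup>2"
      and ?p3.0 = "\<lambda>z. - 1 * (\<Sum>i\<in>UNIV. \<Sum>j\<in>UNIV. V z * V2 i j z * V2 i j z + 2 * (V2 i j z * V1 i z * V1 j z))"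
      and R = "\<lambda>e s z. \<Sum>i\<in>UNIV. \<Sum>j\<in>UNIV. (V z)\<^sup>2 * recip e z * (V2 i j z)\<^sup>2
        + 2 * (V z * recip e z * (1 + recip e z) * V2 i j z * (V1 i z * V1 j z)) + (recip e z)^3 * (V1 i z * V1 j z)\<^sup>2"
      and U = "\<lambda>e s z. \<Sum>i\<in>UNIV. \<Sum>j\<in>UNIV. (1 + e * V z) * kdelta i j * (kdelta i j * (1 / s) - 2 * hess_ln e i j z)"])
  show "torus_mean (\<lambda>z. - 1 * (\<Sum>i\<in>UNIV. \<Sum>j\<in>UNIV. V z * V2 i j z * V2 i j z + 2 * (V2 i j z * V1 i z * V1 j z))) (- 9 / 8)"
    using torus_mean_cmult[OF Q_cubic_torus_mean, of "- 1"] by simp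
  fix e s :: real and z assume e: "0 < e" "e \<le> 1 / 10" and s: "s \<ge> 1"
  have r: "recip e z * (1 + e * V z) = 1" using recip_eq[of e z] e by simp
  \<comment> \<open>Everything that involves the diagonal part of the Hessian carries a factor
    \<open>1 / s\<close> and goes into \<open>U\<close>.\<close>
  have alg: "q * (d * t - w)\<^sup>2 = q * w\<^sup>2 + q * d * (d * t - 2 * w) * t" for q d t w :: real
    by (simp add: power2_eq_square algebra_simps)
  have "(1 + e * V z) * (kdelta i j * (1 / s) - hess_ln e i j z)\<^sup>2
    = e\<^sup>2 * (V2 i j z)\<^sup>2 + e^3 * (- 1 * (V z * V2 i j z * V2 i j z + 2 * (V2 i j z * V1 i z * V1 j z)))
      + e^4 * ((V z)\<^sup>2 * recip e z * (V2 i j z)\<^sup>2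
        + 2 * (V z * recip e z * (1 + recip e z) * V2 i j z * (V1 i z * V1 j z)) + (recip e z)^3 * (V1 i z * V1 j z)\<^sup>2)
      + (1 + e * V z) * kdelta i j * (kdelta i j * (1 / s) - 2 * hess_ln e i j z) * (1 / s)" for i j
    unfolding alg using expand_square[OF r, of "V2 i j z" "V1 i z * V1 j z"] unfolding hess_ln_def[symmetric]
    by (simp only: mult_minus1 mult.assoc[of "V2 i j z" "V1 i z" "V1 j z"])
  then show "sq_H e s z = e * 0 + e\<^sup>2 * (\<Sum>i\<in>UNIV. \<Sum>j\<in>UNIV. (V2 i j z)\<^sup>2)
      + e^3 * (- 1 * (\<Sum>i\<in>UNIV. \<Sum>j\<in>UNIV. V z * V2 i j z * V2 i j z + 2 * (V2 i j z * V1 i z * V1 j z)))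
      + e^4 * (\<Sum>i\<in>UNIV. \<Sum>j\<in>UNIV. (V z)\<^sup>2 * recip e z * (V2 i j z)\<^sup>2
        + 2 * (V z * recip e z * (1 + recip e z) * V2 i j z * (V1 i z * V1 j z)) + (recip e z)^3 * (V1 i z * V1 j z)\<^sup>2)
      + (\<Sum>i\<in>UNIV. \<Sum>j\<in>UNIV. (1 + e * V z) * kdelta i j * (kdelta i j * (1 / s) - 2 * hess_ln e i j z)) * (1 / s)"
    unfolding sq_H_def sum_distrib_left sum_distrib_right sum.distrib[symmetric] mult_zero_right add_0
    by (intro sum.cong refl) (simp only: sum_distrib_left)
qed (rule torus_mean_zero V2_sq_torus_mean H_measurable | intro weight_bdd_unif_bdd unif_bdd_sum unif_bdd_intros unif_bdd_hess_ln finite)+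

lemma cubic_approx_cub_H: "cubic_approx (\<lambda>e s. gauss_mean s (cub_H e s)) (3 / 2) (- 27 / 16)"
proof -
  define P where "P i j k z = V1 i z * V1 j z * V1 k z" for i j k z
  define B where "B i j k z = V z * V3 i j k z * V3 i j k z
      + 2 * (V2 i j z * V3 i j k z * V1 k z + V2 k i z * V3 i j k z * V1 j z + V2 k j z * V3 i j k z * V1 i z)
      + 2 * (V2 i j z * V2 j k z * V2 k i z)" for i j k z
  \<comment> \<open>\<open>R1\<close> and \<open>R2\<close> are the remainders of
    \<open>expand_square3\<close> and \<open>expand_cube\<close>; \<open>U\<close> collects the
    terms containing the diagonal part of the Hessian.\<close>
  define R1 where "R1 i j k e z = (V z)\<^sup>2 * recip e z * (V3 i j k z)\<^sup>2 + 2 * (V z * recip e z * (1 + recip e z) * V3 i j k z * sym_grad_hess i j k z)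
      + recip e z * ((recip e z)\<^sup>2 * (sym_grad_hess i j k z)\<^sup>2 + 4 * ((recip e z)\<^sup>2 * (V3 i j k z * P i j k z)))
      - 4 * (e * (recip e z)^4 * (sym_grad_hess i j k z * P i j k z)) + 4 * (e\<^sup>2 * (recip e z)^5 * (P i j k z)\<^sup>2)" for i j k e z
  define M where "M i j z = V1 i z * V1 j z" for i j z
  define R2 where "R2 i j k e z = - (recip e z * (M i j z * V2 j k z * V2 k i z + V2 i j z * M j k z * V2 k i z + V2 i j z * V2 j k z * M k i z))
      + e * (recip e z)\<^sup>2 * (M i j z * M j k z * V2 k i z + M i j z * V2 j k z * M k i z + V2 i j z * M j k z * M k i z)
      - e\<^sup>2 * (recip e z)^3 * (M i j z * M j k z * M k i z)
      - V z * recip e z * (1 + recip e z) * ((V2 i j z - e * M i j z * recip e z) * (V2 j k z - e * M j k z * recip e z) * (V2 k i z - e * M k i z * recip e z))" for i j k e z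
  define U where "U i j k e s z = 2 * (1 + e * V z) *
      (kdelta i j * hess_ln e j k z * hess_ln e k i z + hess_ln e i j z * kdelta j k * hess_ln e k i z + hess_ln e i j z * hess_ln e j k z * kdelta k i
      - 1 / s * (kdelta i j * kdelta j k * hess_ln e k i z + kdelta i j * hess_ln e j k z * kdelta k i + hess_ln e i j z * kdelta j k * kdelta k i)
      + 1 / s * (1 / s) * (kdelta i j * kdelta j k * kdelta k i))" for i j k e s z
  have bdP: "unif_bdd (\<lambda>e s. P i j k)" and bdM: "unif_bdd (\<lambda>e s. M i j)" for i j k
    unfolding P_def M_def by (intro unif_bdd_intros)+
  have bdR: "unif_bdd (\<lambda>e s z. R1 i j k e z + - 2 * R2 i j k e z)" and bdU: "unif_bdd (U i j k)" for i j k
    unfolding R1_def R2_def U_def by (intro unif_bdd_intros bdP bdM unif_bdd_sym_grad_hess unif_bdd_hess_ln)+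
  show ?thesis
  proof (rule cubic_approx_gauss_mean[where ?p1.0 = "\<lambda>_. 0" and ?p2.0 = "\<lambda>z. \<Sum>i\<in>UNIV. \<Sum>j\<in>UNIV. \<Sum>k\<in>UNIV. (V3 i j k z)\<^sup>2"
        and ?p3.0 = "\<lambda>z. - 1 * (\<Sum>i\<in>UNIV. \<Sum>j\<in>UNIV. \<Sum>k\<in>UNIV. B i j k z)"
        and R = "\<lambda>e s z. \<Sum>i\<in>UNIV. \<Sum>j\<in>UNIV. \<Sum>k\<in>UNIV. R1 i j k e z + - 2 * R2 i j k e z"
        and U = "\<lambda>e s z. \<Sum>i\<in>UNIV. \<Sum>j\<in>UNIV. \<Sum>k\<in>UNIV. U i j k e s z"])
    show "torus_mean (\<lambda>z. - 1 * (\<Sum>i\<in>UNIV. \<Sum>j\<in>UNIV. \<Sum>k\<in>UNIV. B i j k z)) (- 27 / 16)"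
      using torus_mean_cmult[OF D_cubic_torus_mean, of "- 1"] unfolding B_def by simp
    fix e s :: real and z assume e: "0 < e" "e \<le> 1 / 10" and s: "s \<ge> 1"
    have r: "recip e z * (1 + e * V z) = 1" using recip_eq[of e z] e by simp
    have c1: "(1 + e * V z) * (e * V3 i j k z * recip e z - e\<^sup>2 * sym_grad_hess i j k z * (recip e z)\<^sup>2 + 2 * e^3 * (V1 i z * V1 j z * V1 k z) * (recip e z)^3)\<^sup>2
      = e\<^sup>2 * (V3 i j k z)\<^sup>2 + e^3 * (- (V z * V3 i j k z * V3 i j k z + 2 * (V3 i j k z * sym_grad_hess i j k z))) + e^4 * R1 i j k e z" for i j k
      unfolding R1_def P_def by (rule expand_square3[OF r])
    have c2: "(1 + e * V z) * (hess_ln e i j z * hess_ln e j k z * hess_ln e k i z)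
      = e^3 * (V2 i j z * V2 j k z * V2 k i z) + e^4 * R2 i j k e z" for i j k
      unfolding hess_ln_def R2_def M_def by (rule expand_cube[OF r])
    \<comment> \<open>The product of the three wave parts comes with -2, as the negative Hessian
      contains \<open>hess_ln\<close> with a minus sign; this is why \<open>R2\<close> enters with
      that factor.\<close>
    have alg: "q * (2 * ((d1 * t - w1) * (d2 * t - w2) * (d3 * t - w3)))
      = - 2 * (q * (w1 * w2 * w3)) + 2 * q * (d1 * w2 * w3 + w1 * d2 * w3 + w1 * w2 * d3
      - t * (d1 * d2 * w3 + d1 * w2 * d3 + w1 * d2 * d3) + t * t * (d1 * d2 * d3)) * t" for q d1 d2 d3 w1 w2 w3 t :: real
      by (simp add: algebra_simps)
    have LT3: "V3 i j k z * sym_grad_hess i j k z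
      = V2 i j z * V3 i j k z * V1 k z + V2 k i z * V3 i j k z * V1 j z + V2 k j z * V3 i j k z * V1 i z" for i j k
      by (simp add: sym_grad_hess_def algebra_simps)
    have c: "(1 + e * V z) * ((e * V3 i j k z * recip e z - e\<^sup>2 * sym_grad_hess i j k z * (recip e z)\<^sup>2 + 2 * e^3 * (V1 i z * V1 j z * V1 k z) * (recip e z)^3)\<^sup>2
        + 2 * ((kdelta i j * (1 / s) - hess_ln e i j z) * (kdelta j k * (1 / s) - hess_ln e j k z) * (kdelta k i * (1 / s) - hess_ln e k i z)))
      = e\<^sup>2 * (V3 i j k z)\<^sup>2 + e^3 * (- 1 * B i j k z) + e^4 * (R1 i j k e z + - 2 * R2 i j k e z) + U i j k e s z * (1 / s)" for i j k
      unfolding distrib_left[of "1 + e * V z"] c1 alg c2 U_def[symmetric] B_def LT3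
      by (simp add: algebra_simps)
    show "cub_H e s z = e * 0 + e\<^sup>2 * (\<Sum>i\<in>UNIV. \<Sum>j\<in>UNIV. \<Sum>k\<in>UNIV. (V3 i j k z)\<^sup>2)
      + e^3 * (- 1 * (\<Sum>i\<in>UNIV. \<Sum>j\<in>UNIV. \<Sum>k\<in>UNIV. B i j k z))
      + e^4 * (\<Sum>i\<in>UNIV. \<Sum>j\<in>UNIV. \<Sum>k\<in>UNIV. R1 i j k e z + - 2 * R2 i j k e z)
      + (\<Sum>i\<in>UNIV. \<Sum>j\<in>UNIV. \<Sum>k\<in>UNIV. U i j k e s z) * (1 / s)"
      unfolding cub_H_def sum_distrib_left sum_distrib_right sum.distrib[symmetric] mult_zero_right add_0
      by (intro sum.cong refl) (simp only: c sum_distrib_left)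
  qed (rule torus_mean_zero V3_sq_torus_mean H_measurable | intro weight_bdd_unif_bdd unif_bdd_sum bdR bdU finite)+
qed

section \<open>Choice of the parameters and conclusion\<close>

theorem theorem1p1:
  "\<exists>f :: real^2 \<Rightarrow> real.
     prob_density f \<and> smooth_fun f \<and> gaussian_decay f \<and>
     integrable lborel (\<lambda>x. trH f x * f x) \<and>
     integrable lborel (\<lambda>x. trH2 f x * f x) \<and>
     integrable lborel (\<lambda>x. (gradH_sq f x + 2 * trH3 f x) * f x) \<and>
     calI f * calD f - (calQ f)\<^sup>2 < 0 \<and>
     (\<forall>t\<ge>0. integrable lborel (fisher_integrand (heat t f))) \<and>
     (\<exists>I1 I2 :: real \<Rightarrow> real.
        (\<forall>t\<ge>0. (fisher_flow f has_real_derivative I1 t) (at t within {0..}) \<and>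
                (I1 has_real_derivative I2 t) (at t within {0..})) \<and>
        fisher_flow f 0 * I2 0 - (I1 0)\<^sup>2 < 0 \<and>
        (\<exists>\<epsilon>>0. \<forall>t. 0 < t \<and> t < \<epsilon> \<longrightarrow> fisher_flow f t * I2 t - (I1 t)\<^sup>2 < 0))"
proof -
  obtain e1 where e1: "e1 > 0" "e1 \<le> 1 / 10"
    "\<And>e. 0 < e \<Longrightarrow> e \<le> e1 \<Longrightarrow> \<forall>\<^sub>F s in at_top. gauss_mean s (tr_H e s) * gauss_mean s (cub_H e s) - (gauss_mean s (sq_H e s))\<^sup>2 < 0"
    using cubic_approx_negative[OF cubic_approx_tr_H cubic_approx_cub_H cubic_approx_sq_H] by blast
  obtain e2 where e2: "e2 > 0" "e2 \<le> 1 / 10"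
    "\<And>e. 0 < e \<Longrightarrow> e \<le> e2 \<Longrightarrow> \<forall>\<^sub>F s in at_top. flow s e 0 * flow2 s e 0 - (- flow1 s e 0)\<^sup>2 < 0"
    using cubic_approx_negative[OF cubic_approx_flow cubic_approx_flow2 cubic_approx_flow1] by blast
  define e where "e = min e1 e2"
  have e: "0 < e" "e \<le> e1" "e \<le> e2" "e \<le> 1 / 10" "0 \<le> e" using e1 e2 by (auto simp: e_def)
  have "\<forall>\<^sub>F s in at_top. s \<ge> 1 \<and> gauss_mean s (tr_H e s) * gauss_mean s (cub_H e s) - (gauss_mean s (sq_H e s))\<^sup>2 < 0
      \<and> flow s e 0 * flow2 s e 0 - (- flow1 s e 0)\<^sup>2 < 0"
    using e1(3)[OF e(1,2)] e2(3)[OF e(1,3)] eventually_ge_at_top[of 1] by eventually_elim simp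
  then obtain s where s: "s \<ge> 1" "s > 0"
    and neg1: "gauss_mean s (tr_H e s) * gauss_mean s (cub_H e s) - (gauss_mean s (sq_H e s))\<^sup>2 < 0"
    and neg2: "flow s e 0 * flow2 s e 0 - (flow1 s e 0)\<^sup>2 < 0"
    by (force dest: eventually_happens)
  \<comment> \<open>The integrand of the total mass in the form of \<open>packet_integral\<close>;
    its mean \<open>Z\<close> fixes the normalisation \<open>A\<close>.\<close>
  define h where "h e s z = 1 + e * V z" for e and s :: real and z
  have bdh: "unif_bdd h" unfolding h_def by (intro unif_bdd_intros)
  have hm: "h e s \<in> borel_measurable borel" unfolding h_def by measurable
  define Z where "Z = gauss_mean s (h e s)"
  have bound: "\<bar>e * V z\<bar> \<le> 3 / 10" for z
    using mult_mono[of e "1 / 10" "\<bar>V z\<bar>" 3] e V_bound[of z] by (simp add: abs_mult)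
  have "\<bar>gauss_mean s (\<lambda>_. 7 / 10)\<bar> \<le> gauss_mean s (h e s)"
  proof (rule gauss_mean_mono[OF s(2)])
    show "integrable lborel (\<lambda>z. exp (- (1 / (2 * s)) * (norm z)\<^sup>2) * h e s z)"
    proof (rule gauss_mean_integrable_bounded[OF s(2) hm, where C = 2])
      show "\<bar>h e s z\<bar> \<le> 2" for z using bound[of z] unfolding h_def by linarith
    qed
    show "integrable lborel (\<lambda>z::real^2. exp (- (1 / (2 * s)) * (norm z)\<^sup>2) * (7 / 10))"
      by (rule gauss_mean_integrable_bounded[OF s(2) _ order_refl]) simp
    show "\<bar>7 / 10\<bar> \<le> h e s z" for z using bound[of z] unfolding h_def by linarith
  qed
  then have Zpos: "Z > 0" unfolding gauss_mean_const[OF s(2)] Z_def by simp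
  define A where "A = 1 / (2 * pi * s * Z)"
  have A: "A > 0" using Zpos s by (simp add: A_def)
  define N where "N = 2 * pi * s * A"
  have N: "N > 0" using A s by (simp add: N_def)
  define f where "f = packet A (1 / (2 * s)) e 1"
  note pint = packet_integral[OF _ _ A e(5,4) s(1), folded f_def N_def]
  note fac = H_factor[OF A e(5,4), where s = s, folded f_def]
  have int: "integrable lborel (\<lambda>x. trH f x * f x)" "integrable lborel (\<lambda>x. trH2 f x * f x)"
    "integrable lborel (\<lambda>x. (gradH_sq f x + 2 * trH3 f x) * f x)"
    by (rule pint(1)[OF unif_bdd_H(1) H_measurable(1) fac(1)] pint(1)[OF unif_bdd_H(2) H_measurable(2) fac(2)]
        pint(1)[OF unif_bdd_H(3) H_measurable(3) fac(3)])+
  have cal: "calI f = N * gauss_mean s (tr_H e s)" "calQ f = N * gauss_mean s (sq_H e s)" "calD f = N * gauss_mean s (cub_H e s)"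
    unfolding calI_def calQ_def calD_def
    by (rule pint(2)[OF unif_bdd_H(1) H_measurable(1) fac(1)] pint(2)[OF unif_bdd_H(2) H_measurable(2) fac(2)]
        pint(2)[OF unif_bdd_H(3) H_measurable(3) fac(3)])+
  \<comment> \<open>All quantities are the normalised ones times \<open>N\<close>, and both
    expressions are homogeneous of degree two.\<close>
  have scale: "N * x * (N * y) - (N * w)\<^sup>2 < 0 \<longleftrightarrow> x * y - w\<^sup>2 < 0" for x y w
  proof -
    have "N * x * (N * y) - (N * w)\<^sup>2 = N\<^sup>2 * (x * y - w\<^sup>2)"
      by (simp add: power2_eq_square algebra_simps)
    moreover have "N\<^sup>2 > 0" using N by simp
    ultimately show ?thesis by (simp only: mult_less_0_iff) auto
  qed
  have dens: "prob_density f"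
    unfolding prob_density_def
  proof (intro conjI allI)
    show "f x > 0" for x unfolding f_def by (intro packet_pos A e)
    show "integrable lborel f" using pint(1)[OF bdh hm, of "\<lambda>_. 1"] by (simp add: h_def)
    have "(\<integral>x. 1 * f x \<partial>lborel) = N * Z"
      unfolding Z_def by (rule pint(2)[OF bdh hm]) (simp add: h_def)
    then show "(\<integral>x. f x \<partial>lborel) = 1" using Zpos s by (simp add: N_def A_def)
  qed
  have decay: "gaussian_decay f"
    unfolding gaussian_decay_def
  proof (rule exI[of _ "A * 2"], rule exI[of _ "1 / (2 * s)"], intro conjI allI)
    fix x
    have "\<bar>1 + e * V x\<bar> \<le> 2" using bound[of x] by linarith
    then have "A * exp (- (1 / (2 * s)) * (norm x)\<^sup>2) * \<bar>1 + e * V x\<bar> \<le> A * exp (- (1 / (2 * s)) * (norm x)\<^sup>2) * 2"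
      using A by (intro mult_left_mono) auto
    then show "\<bar>f x\<bar> \<le> A * 2 * exp (- (1 / (2 * s)) * (norm x)\<^sup>2)"
      using A by (simp add: f_def packet_def abs_mult mult_ac)
  qed (use s in simp)
  have fisher: "has_bochner_integral lborel (fisher_integrand (heat t f)) (N * flow s e t)" if "t \<ge> 0" for t
    unfolding f_def N_def flow_def by (rule has_bochner_integral_fisher_flow[OF s(2) that e(5,4) A])
  then have flow: "fisher_flow f t = N * flow s e t" if "t \<ge> 0" for t
    using that by (simp add: fisher_flow_def has_bochner_integral_iff)
  have d1: "(fisher_flow f has_real_derivative N * flow1 s e t) (at t within {0..})" if t: "t \<ge> 0" for t
  \<comment> \<open>The formula for \<open>fisher_flow\<close> holds only at nonnegative times, so
    it is transferred within the half-line; the radius 1 is arbitrary.\<close>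
  proof (rule has_field_derivative_transform_within[OF _ zero_less_one])
    show "((\<lambda>t. N * flow s e t) has_real_derivative N * flow1 s e t) (at t within {0..})"
      by (intro DERIV_cmult flow_deriv s t e)
  qed (use t in \<open>auto simp: flow\<close>)
  have d2: "((\<lambda>t. N * flow1 s e t) has_real_derivative N * flow2 s e t) (at t within {0..})" if t: "t \<ge> 0" for t
    by (intro DERIV_cmult flow_deriv s t e)
  have lim: "((\<lambda>t. flow s e t * flow2 s e t - (flow1 s e t)\<^sup>2) \<longlongrightarrow> flow s e 0 * flow2 s e 0 - (flow1 s e 0)\<^sup>2) (at 0 within {0..})"
    using flow_deriv[OF s(1) order_refl e(5,4)]
    by (intro tendsto_intros flow2_tendsto s e) (auto dest!: DERIV_continuous simp: continuous_within)
  from order_tendstoD(2)[OF lim neg2] obtain \<epsilon> where \<epsilon>: "\<epsilon> > 0"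
    "\<And>t. t \<in> {0..} \<Longrightarrow> t \<noteq> 0 \<Longrightarrow> dist t 0 < \<epsilon> \<Longrightarrow> flow s e t * flow2 s e t - (flow1 s e t)\<^sup>2 < 0"
    unfolding eventually_at by blast
  show ?thesis
  proof (intro exI[of _ f] conjI)
    show "smooth_fun f" unfolding f_def by (intro elementary_smooth packet_elementary)
    show "calI f * calD f - (calQ f)\<^sup>2 < 0" unfolding cal scale by (rule neg1)
    show "\<forall>t\<ge>0. integrable lborel (fisher_integrand (heat t f))"
      using fisher by (auto simp: has_bochner_integral_iff)
    show "\<exists>I1 I2. (\<forall>t\<ge>0. (fisher_flow f has_real_derivative I1 t) (at t within {0..}) \<and>
                (I1 has_real_derivative I2 t) (at t within {0..})) \<and>
        fisher_flow f 0 * I2 0 - (I1 0)\<^sup>2 < 0 \<and>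
        (\<exists>\<epsilon>>0. \<forall>t. 0 < t \<and> t < \<epsilon> \<longrightarrow> fisher_flow f t * I2 t - (I1 t)\<^sup>2 < 0)"
    proof (rule exI[of _ "\<lambda>t. N * flow1 s e t"], rule exI[of _ "\<lambda>t. N * flow2 s e t"], intro conjI allI impI)
      show "fisher_flow f 0 * (N * flow2 s e 0) - (N * flow1 s e 0)\<^sup>2 < 0"
        using neg2 by (simp only: flow order_refl scale)
      show "\<exists>\<epsilon>>0. \<forall>t. 0 < t \<and> t < \<epsilon> \<longrightarrow> fisher_flow f t * (N * flow2 s e t) - (N * flow1 s e t)\<^sup>2 < 0"
      proof (intro exI[of _ \<epsilon>] conjI allI impI \<epsilon>(1))
        fix t :: real assume t: "0 < t \<and> t < \<epsilon>"
        then have "flow s e t * flow2 s e t - (flow1 s e t)\<^sup>2 < 0" by (intro \<epsilon>(2)) auto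
        then show "fisher_flow f t * (N * flow2 s e t) - (N * flow1 s e t)\<^sup>2 < 0"
          using t by (simp only: flow less_imp_le scale)
      qed
    qed (auto intro: d1 d2)
  qed (use dens decay int in auto)
qed

end
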